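(* For all reals $\alpha, \beta >0$ there exists a constant $c$ (a positive integer) such that the following holds. Whenever $p$ is a prime and $A$ and $B$ are non-empty subsets of $\mathbb{Z}_p$ with $\alpha |B| \leq |A| \leq \frac{1}{\alpha}|B|$ and $|A|+|B| \leq (1-\beta)p$, there exist $b_1, \dots, b_c \in B$ such that $$|A+\{b_1, \dots, b_c\} |\geq |A|+|B|-1.$$
   Context: $\mathbb{Z}_p$ is the cyclic group of prime order $p$. For subsets $X,Y$ of an abelian group, $X+Y=\{x+y : x\in X, y\in Y\}$. The elements $b_1,\dots,b_c$ are not required to be distinct. *)

theory Defs
  imports Complex_Main "HOL-Number_Theory.Residues"
begin

end

theory Submission
  imports Defs
begin

text \<open>Suppose that no bounded number of translates suffices. Adding translates greedily gives a bounded
  $F \<subseteq> B$ and $S = A + F$ with $|S| < |A| + |B|$ that almost contains every $A + b$ with $b \<in> B$.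
  A pigeonhole argument gives a translation that almost fixes $B$; by submodularity (Pollard's
  theorem bounds unions from below) $B$ can then be replaced by subsets $Y$ of any smaller size that
  are still near-extremal with $A$, and $Y - Y$ consists of translations moving at most about $|Y|$
  elements of $A$. Hence the number of $x$ with $|(A + x) - A| \<le> r$ is about $2r$ for all $r$.
  Fourier analysis puts these $x$ into a short arc after a dilation, a Freiman-type argument in the
  integers shows that they fill a progression, and after a further dilation $A$ is close to an arc
  and $B$ is contained in an interval $[0, M]$ of about $|B|$ elements. Then $A + 0$ and
  $A + M$ take care of the two ends, a few more translates fill the middle, up to no more elements
  than there are holes in the middle of $A$, and the part of $A$ away from the arc is multiplied.\<close>

text \<open>The first obstacle is that S contains the translates of A only up to an error, so no
  exact theorem on A + B applies. Pollard's theorem makes this harmless: with t about \<epsilon> n,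
  errors of \<epsilon>^2 n per translate cost only O(\<epsilon> n). The translation d that almost
  fixes B gives control over sizes: while y runs through the multiples of d, the overlap of Y with Y
  + y varies slowly, so it can be stopped near any prescribed value between |Y| and the average
  |Y|^2 / p. Balls of translations are studied because their doubling comes for free: a sum of two
  elements of the ball of radius R lies in the ball of radius 2R, and sizes of about 2R and 4R are
  well within the range of Freiman's argument. All these estimates lose a small proportion of n,
  whereas the goal is exact up to 1. The covering at the end must therefore lose nothing: the number
  of holes in the middle of A enters once as a loss in the middle and once as a gain outside, and
  cancels.\<close>

text \<open>Subsets of the integers modulo $p$ are represented by $p$-periodic sets of integers,
  so that translations need no reduction modulo $p$.\<close>

definition periodic :: "int \<Rightarrow> int set \<Rightarrow> bool" where
  "periodic p A \<longleftrightarrow> (\<forall>x. x + p \<in> A \<longleftrightarrow> x \<in> A)"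

definition pcard :: "int \<Rightarrow> int set \<Rightarrow> nat" where
  "pcard p A = card (A \<inter> {0..<p})"

definition shift :: "int \<Rightarrow> int set \<Rightarrow> int set" where
  "shift x A = {z. z - x \<in> A}"

definition translates :: "int set \<Rightarrow> int set \<Rightarrow> int set" where
  "translates A F = (\<Union>b\<in>F. shift b A)"

definition reps :: "int \<Rightarrow> int set \<Rightarrow> int set \<Rightarrow> int \<Rightarrow> nat" where
  "reps p A B x = pcard p {b \<in> B. x - b \<in> A}"

lemma mem_shift [simp]: "z \<in> shift x A \<longleftrightarrow> z - x \<in> A"
  by (simp add: shift_def)

lemma shift_shift [simp]: "shift x (shift y A) = shift (x + y) A"
  by (auto simp: algebra_simps)

lemma shift_0 [simp]: "shift 0 A = A"
  by auto

lemma shift_Int: "shift x (A \<inter> B) = shift x A \<inter> shift x B"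
  and shift_Diff: "shift x (A - B) = shift x A - shift x B"
  by auto

lemma periodic_add_mult:
  assumes "periodic p A" shows "x + k * p \<in> A \<longleftrightarrow> x \<in> A"
proof (induction k rule: int_induct[where k = 0])
  case base then show ?case by simp
next
  case (step1 i)
  have "x + (i + 1) * p = (x + i * p) + p" by (simp add: algebra_simps)
  then show ?case using assms step1 unfolding periodic_def by metis
next
  case (step2 i)
  have "x + i * p = (x + (i - 1) * p) + p" by (simp add: algebra_simps)
  then show ?case using assms step2 unfolding periodic_def by metis
qed

lemma periodic_mod: 
  assumes "periodic p A" shows "x mod p \<in> A \<longleftrightarrow> x \<in> A"
  using periodic_add_mult[OF assms, of "x mod p" "x div p"] by simp

lemma periodic_cong:
  assumes "periodic p A" "[x = y] (mod p)" shows "x \<in> A \<longleftrightarrow> y \<in> A"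
  using assms periodic_mod unfolding cong_def by metis

lemma periodic_shift [intro]: "periodic p A \<Longrightarrow> periodic p (shift x A)"
  unfolding periodic_def mem_shift by (metis add_diff_eq add.commute)

lemma periodic_Int [intro]: "periodic p A \<Longrightarrow> periodic p B \<Longrightarrow> periodic p (A \<inter> B)"
  and periodic_Un [intro]: "periodic p A \<Longrightarrow> periodic p B \<Longrightarrow> periodic p (A \<union> B)"
  and periodic_Diff [intro]: "periodic p A \<Longrightarrow> periodic p B \<Longrightarrow> periodic p (A - B)"
  and periodic_UNIV [intro]: "periodic p UNIV"
  by (auto simp: periodic_def)

lemma periodic_translates [intro]: "periodic p A \<Longrightarrow> periodic p (translates A F)"
  using periodic_shift unfolding translates_def periodic_def by blast

lemma periodic_residue: "periodic p {z. P ((z - u) mod p)}"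
proof -
  have "(z + p - u) mod p = (z - u) mod p" for z by (metis add_diff_eq diff_add_eq mod_add_self2)
  then show ?thesis by (simp add: periodic_def)
qed

lemma shift_cong:
  assumes "periodic p A" "[x = y] (mod p)" shows "shift x A = shift y A"
proof -
  have "[z - x = z - y] (mod p)" for z
    using assms(2) by (simp add: cong_diff)
  from periodic_cong[OF assms(1) this] show ?thesis by auto
qed

section \<open>Affine substitutions and counting modulo p\<close>

lemma bij_betw_affine_mod:
  fixes p :: int assumes "p > 0" "coprime u p"
  shows "bij_betw (\<lambda>z. (u * z + v) mod p) {0..<p} {0..<p}"
proof -
  have "inj_on (\<lambda>z. (u * z + v) mod p) {0..<p}"
  proof (rule inj_onI)
    fix x y assume xy: "x \<in> {0..<p}" "y \<in> {0..<p}" "(u * x + v) mod p = (u * y + v) mod p"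
    then have "[u * x + v = u * y + v] (mod p)" by (simp add: cong_def)
    then have "[u * x = u * y] (mod p)" by (simp add: cong_add_rcancel)
    then have "[x = y] (mod p)" using assms(2) by (simp add: cong_mult_lcancel)
    then show "x = y" using xy by (simp add: cong_def)
  qed
  moreover have "(\<lambda>z. (u * z + v) mod p) ` {0..<p} \<subseteq> {0..<p}" using assms(1) by auto
  ultimately show ?thesis
    by (simp add: bij_betw_def endo_inj_surj)
qed

lemma sum_affine_mod:
  fixes p :: int assumes "p > 0" "coprime u p"
  shows "(\<Sum>z\<in>{0..<p}. f ((u * z + v) mod p)) = (\<Sum>z\<in>{0..<p}. f z)"
  using sum.reindex_bij_betw[OF bij_betw_affine_mod[OF assms]] .

lemma pcard_eq_sum: "pcard p A = (\<Sum>z\<in>{0..<p}. of_bool (z \<in> A))"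
  by (simp add: pcard_def Int_commute)

lemma sum_restrict_periodic: "(\<Sum>z\<in>A \<inter> {0..<p}. f z) = (\<Sum>z\<in>{0..<p}. if z \<in> A then f z else 0)"
  for p :: int
  by (subst Int_commute) (simp add: sum.inter_restrict)

lemma pcard_affine:
  assumes "p > 0" "coprime u p" "periodic p A"
  shows "pcard p {x. u * x + v \<in> A} = pcard p A"
proof -
  have "pcard p {x. u * x + v \<in> A} = (\<Sum>z\<in>{0..<p}. of_bool ((u * z + v) mod p \<in> A))"
    by (simp add: pcard_eq_sum periodic_mod[OF assms(3)])
  also have "\<dots> = (\<Sum>z\<in>{0..<p}. of_bool (z \<in> A))"
    by (rule sum_affine_mod[OF assms(1,2)])
  finally show ?thesis by (simp add: pcard_eq_sum)
qed

lemma pcard_shift [simp]: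
  assumes "p > 0" "periodic p A" shows "pcard p (shift x A) = pcard p A"
  using pcard_affine[OF assms(1) _ assms(2), of 1 "- x"] by (simp add: shift_def)

lemma pcard_reflect:
  assumes "p > 0" "periodic p A" shows "pcard p {b. x - b \<in> A} = pcard p A"
  using pcard_affine[OF assms(1) _ assms(2), of "-1" x] by (simp add: add.commute)

lemma pcard_mono: "A \<subseteq> B \<Longrightarrow> pcard p A \<le> pcard p B"
  unfolding pcard_def by (rule card_mono) auto

lemma pcard_Un_Int: "pcard p (A \<union> B) + pcard p (A \<inter> B) = pcard p A + pcard p B"
  using card_Un_Int[of "A \<inter> {0..<p}" "B \<inter> {0..<p}"]
  by (simp add: pcard_def Int_Un_distrib2 Int_assoc Int_left_commute)

lemma pcard_Un_disjoint: "A \<inter> B = {} \<Longrightarrow> pcard p (A \<union> B) = pcard p A + pcard p B"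
  using pcard_Un_Int[of p A B] by (simp add: pcard_def)

lemma pcard_Un_le: "pcard p (A \<union> B) \<le> pcard p A + pcard p B"
  using pcard_Un_Int[of p A B] by simp

lemma pcard_Diff_Int: "pcard p (A - B) + pcard p (A \<inter> B) = pcard p A"
  by (subst pcard_Un_disjoint[symmetric]) (auto simp: Un_Diff_Int)

lemma pcard_Diff_Un: "pcard p (A - B) + pcard p B = pcard p (A \<union> B)"
  by (subst pcard_Un_disjoint[symmetric]) auto

lemma pcard_empty [simp]: "pcard p {} = 0"
  by (simp add: pcard_def)

lemma pcard_UNIV [simp]: "pcard p UNIV = nat p"
  by (simp add: pcard_def)

lemma pcard_le: "pcard p A \<le> nat p"
  using pcard_mono[of A UNIV p] by simp

lemma pcard_pos_iff:
  assumes "p > 0" "periodic p A" shows "pcard p A > 0 \<longleftrightarrow> A \<noteq> {}"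
proof
  assume "A \<noteq> {}"
  then obtain x where "x \<in> A" by auto
  then have "x mod p \<in> A \<inter> {0..<p}" using assms periodic_mod by auto
  then show "pcard p A > 0" unfolding pcard_def by (metis card_gt_0_iff empty_iff finite_Int finite_atLeastLessThan_int)
qed (auto simp: pcard_def)

lemma periodic_subset_iff:
  assumes "p > 0" "periodic p A" "periodic p B"
  shows "A \<subseteq> B \<longleftrightarrow> A \<inter> {0..<p} \<subseteq> B"
proof
  assume *: "A \<inter> {0..<p} \<subseteq> B"
  show "A \<subseteq> B"
  proof
    fix x assume "x \<in> A"
    then have "x mod p \<in> A \<inter> {0..<p}" using assms periodic_mod by auto
    with * show "x \<in> B" using assms periodic_mod by blast
  qed
qed auto

lemma pcard_eqD:
  assumes "p > 0" "periodic p A" "periodic p B" "A \<subseteq> B" "pcard p B \<le> pcard p A"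
  shows "A = B"
proof -
  have "A \<inter> {0..<p} = B \<inter> {0..<p}"
    using assms(4,5) by (intro card_seteq) (auto simp: pcard_def)
  then show ?thesis using periodic_subset_iff[OF assms(1,3,2)] assms(4) by auto
qed

lemma ex_periodic_subset:
  assumes "p > 0" "periodic p A" "k \<le> pcard p A"
  obtains W where "W \<subseteq> A" "periodic p W" "pcard p W = k"
proof -
  obtain W0 where W0: "W0 \<subseteq> A \<inter> {0..<p}" "card W0 = k"
    using assms(3) unfolding pcard_def by (meson obtain_subset_with_card_n)
  let ?W = "{x. x mod p \<in> W0}"
  have "?W \<inter> {0..<p} = W0" using W0(1) by auto
  then have "pcard p ?W = k" using W0(2) by (simp add: pcard_def)
  moreover have "?W \<subseteq> A" using W0(1) periodic_mod[OF assms(2)] by auto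
  moreover have "periodic p ?W" by (simp add: periodic_def)
  ultimately show ?thesis using that by blast
qed

lemma coprime_prime_int:
  fixes p :: int assumes "prime p" "\<not> p dvd d" shows "coprime d p"
  using assms prime_imp_coprime coprime_commute by blast

text \<open>For prime p the multiples of d reach every residue. Invariance is assumed in one
  direction only, so the multiplier is reduced modulo p to a natural number.\<close>

lemma periodic_invariant_UNIV:
  assumes "prime p" "periodic p A" "A \<noteq> {}" "\<not> p dvd d" "\<And>a. a \<in> A \<Longrightarrow> a + d \<in> A"
  shows "A = UNIV"
proof -
  obtain a where a: "a \<in> A" using assms(3) by auto
  have *: "a + int k * d \<in> A" for k
  proof (induction k)
    case (Suc k)
    from assms(5)[OF this] show ?case by (simp add: algebra_simps)
  qed (use a in simp)
  have "x \<in> A" for x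
  proof -
    obtain j where "[d * j = 1] (mod p)"
      using cong_solve_coprime_int[OF coprime_prime_int[OF assms(1,4)]] by blast
    from cong_scalar_right[OF this, of "x - a"]
    obtain k where k: "[d * k = x - a] (mod p)" by (auto simp: mult.assoc)
    have p: "p > 0" using assms(1) prime_gt_0_int by blast
    let ?k = "nat (k mod p)"
    have "int ?k = k mod p" using p by simp
    then have "[int ?k * d = x - a] (mod p)"
      using k by (metis cong_def mod_mult_left_eq mult.commute)
    then have "[a + int ?k * d = a + (x - a)] (mod p)" by (simp only: cong_add_lcancel)
    then show ?thesis using *[of ?k] periodic_cong[OF assms(2)] by auto
  qed
  then show ?thesis by auto
qed

section \<open>Representation counts and the Dyson transform\<close>

lemma reps_le: "reps p A B x \<le> pcard p B"
  unfolding reps_def by (rule pcard_mono) auto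

lemma reps_cong:
  assumes "periodic p A" "[x = y] (mod p)" shows "reps p A B x = reps p A B y"
proof -
  have "x - b \<in> A \<longleftrightarrow> y - b \<in> A" for b
    by (rule periodic_cong[OF assms(1)]) (simp add: assms(2) cong_diff)
  then show ?thesis by (simp add: reps_def)
qed

text \<open>Both sides count the pairs (b, x) with b in B, x in S and x - b in A. Applied to the
  complement of a set, this is how approximate containment of translates enters Pollard's
  theorem.\<close>

lemma sum_reps_Int:
  assumes "p > 0" "periodic p A" 
  shows "(\<Sum>x\<in>S \<inter> {0..<p}. reps p A B x) = (\<Sum>b\<in>B \<inter> {0..<p}. pcard p (shift b A \<inter> S))"
proof -
  have "reps p A B x = (\<Sum>b\<in>B \<inter> {0..<p}. of_bool (x - b \<in> A))" for x
    unfolding reps_def pcard_eq_sum sum_restrict_periodic by (intro sum.cong) auto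
  then have "(\<Sum>x\<in>S \<inter> {0..<p}. reps p A B x)
     = (\<Sum>b\<in>B \<inter> {0..<p}. \<Sum>x\<in>S \<inter> {0..<p}. of_bool (x - b \<in> A))"
    by (simp only:) (rule sum.swap)
  also have "\<dots> = (\<Sum>b\<in>B \<inter> {0..<p}. pcard p (shift b A \<inter> S))"
    unfolding pcard_eq_sum sum_restrict_periodic[of _ S] by (intro sum.cong refl) simp
  finally show ?thesis .
qed

lemma sum_reps:
  assumes "p > 0" "periodic p A" 
  shows "(\<Sum>x\<in>{0..<p}. reps p A B x) = pcard p A * pcard p B"
  using sum_reps_Int[OF assms, where S = UNIV and B = B] assms by (simp add: pcard_def[of p B])

lemma reps_shift: "reps p (shift e A) B x = reps p A B (x - e)"
  by (simp add: reps_def algebra_simps)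

lemma sum_reps_shift:
  assumes "p > 0" "periodic p A" 
  shows "(\<Sum>x\<in>{0..<p}. f (reps p (shift e A) B x)) = (\<Sum>x\<in>{0..<p}. f (reps p A B x))"
proof -
  have "reps p (shift e A) B x = reps p A B ((1 * x + - e) mod p)" for x
    unfolding reps_shift by (rule reps_cong[OF assms(2)]) (simp add: cong_def)
  then show ?thesis using sum_affine_mod[OF assms(1), of 1 "\<lambda>x. f (reps p A B x)" "-e"] by simp
qed

lemma reps_commute:
  assumes "p > 0" "periodic p X" "periodic p Y"
  shows "reps p X Y x = reps p Y X x"
proof -
  have "periodic p {b \<in> Y. x - b \<in> X}"
    using assms unfolding periodic_def
    by (simp add: diff_diff_eq[symmetric]) (metis diff_add_cancel)
  from pcard_reflect[OF assms(1) this, of x] show ?thesis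
    unfolding reps_def by (simp add: conj_commute)
qed

text \<open>Split A and B along A \<inter> B. Of the four resulting counts, the one of A \<inter> B
  with B - A is symmetric in its arguments, so it joins the two others that have A \<inter> B as
  second set; only the count for A - B and B - A remains.\<close>

lemma reps_Dyson_transform:
  assumes "p > 0" "periodic p A" "periodic p B"
  shows "reps p A B x = reps p (A \<union> B) (A \<inter> B) x + reps p (A - B) (B - A) x"
proof -
  define f where "f X Y = reps p X Y x" for X Y
  have addL: "f (X \<union> X') Y = f X Y + f X' Y" if "X \<inter> X' = {}" for X X' Y
    unfolding f_def reps_def using that
    by (subst pcard_Un_disjoint[symmetric]) (auto intro!: arg_cong[where f = "pcard p"])
  have addR: "f X (Y \<union> Y') = f X Y + f X Y'" if "Y \<inter> Y' = {}" for X Y Y'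
    unfolding f_def reps_def using that
    by (subst pcard_Un_disjoint[symmetric]) (auto intro!: arg_cong[where f = "pcard p"])
  have comm: "f X Y = f Y X" if "periodic p X" "periodic p Y" for X Y
    unfolding f_def by (rule reps_commute[OF assms(1) that])
  have "(A \<inter> B) \<union> (A - B) = A" "(A \<inter> B) \<union> (B - A) = B" by auto
  then have "f A B = f ((A \<inter> B) \<union> (A - B)) ((A \<inter> B) \<union> (B - A))" by simp
  also have "\<dots> = f (A \<inter> B) (A \<inter> B) + f (A - B) (A \<inter> B) + f (A \<inter> B) (B - A) + f (A - B) (B - A)"
  proof -
    have "(A \<inter> B) \<inter> (A - B) = {}" "(A \<inter> B) \<inter> (B - A) = {}" by auto
    then show ?thesis by (simp only: addL addR add.assoc)
  qed
  also have "f (A \<inter> B) (B - A) = f (B - A) (A \<inter> B)" using assms by (intro comm) auto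
  also have "f (A \<inter> B) (A \<inter> B) + f (A - B) (A \<inter> B) + f (B - A) (A \<inter> B) 
     = f ((A \<inter> B) \<union> (A - B) \<union> (B - A)) (A \<inter> B)"
  proof -
    have "(A \<inter> B) \<inter> (A - B) = {}" "((A \<inter> B) \<union> (A - B)) \<inter> (B - A) = {}" by auto
    then show ?thesis by (simp only: addL)
  qed
  also have "(A \<inter> B) \<union> (A - B) \<union> (B - A) = A \<union> B" by auto
  finally show ?thesis by (simp add: f_def)
qed

subsection \<open>Pollard's theorem\<close>

text \<open>The Dyson transform replaces $(A, B)$ by $(A \<union> B, A \<inter> B)$. If $A \<inter> B$ has fewer than
  $t$ elements, its representation function never reaches $t$, and the remaining multiplicity is
  supplied by the induction hypothesis for $(A - B, B - A)$.\<close>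

theorem pollard:
  assumes "prime p" "periodic p A" "periodic p B" "t \<le> pcard p A" "t \<le> pcard p B"
    "pcard p A + pcard p B \<le> nat p + t"
  shows "t * (pcard p A + pcard p B) \<le> (\<Sum>x\<in>{0..<p}. min t (reps p A B x)) + t * t"
  using assms(2-)
proof (induction "pcard p B" arbitrary: A B t rule: less_induct)
  case less
  have p: "p > 0" using assms(1) prime_gt_0_int by blast
  note perA = \<open>periodic p A\<close> and perB = \<open>periodic p B\<close>
  consider "t = 0" | "t = pcard p B" | "0 < t" "t < pcard p B" using less.prems by linarith
  then show ?case
  proof cases
    case 1 then show ?thesis by simp
  next
    case 2
    then have "min t (reps p A B x) = reps p A B x" for x using reps_le by simp
    then show ?thesis using 2 sum_reps[OF p perA] by (simp add: algebra_simps)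
  next
    case 3
    \<comment> \<open>The second set has to become smaller without becoming empty. If this were
      impossible, every translate of A that meets B would contain B; then the difference of two
      elements of B would be a period of A, and A would be everything, which the bound on the sizes
      excludes.\<close>
    have "\<exists>e. shift e A \<inter> B \<noteq> {} \<and> pcard p (shift e A \<inter> B) < pcard p B"
    proof (rule ccontr)
      assume no: "\<not> ?thesis"
      have "\<not> card (B \<inter> {0..<p}) \<le> Suc 0" using 3 by (simp add: pcard_def)
      then obtain b1 b2 where b: "b1 \<in> B \<inter> {0..<p}" "b2 \<in> B \<inter> {0..<p}" "b1 \<noteq> b2"
        using card_le_Suc0_iff_eq[of "B \<inter> {0..<p}"] by (metis finite_Int finite_atLeastLessThan_int)
      have "\<bar>b2 - b1\<bar> < p" "b2 - b1 \<noteq> 0" using b by auto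
      then have ndvd: "\<not> p dvd b2 - b1" using zdvd_not_zless
        by (metis abs_dvd_iff dvd_abs_iff zdvd_imp_le linorder_not_le zero_less_abs_iff)
      have "a + (b2 - b1) \<in> A" if "a \<in> A" for a
      proof -
        have "b1 \<in> shift (b1 - a) A \<inter> B" using b that by simp
        then have "pcard p B \<le> pcard p (shift (b1 - a) A \<inter> B)" using no by (metis empty_iff not_less)
        then have "shift (b1 - a) A \<inter> B = B" using p perA perB by (intro pcard_eqD) auto
        then have "b2 \<in> shift (b1 - a) A" using b by auto
        then show ?thesis by (simp add: algebra_simps)
      qed
      moreover have "A \<noteq> {}" using less.prems 3 by auto
      ultimately have "A = UNIV" using periodic_invariant_UNIV[OF assms(1) perA _ ndvd] by blast
      then show False using less.prems 3 by auto
    qed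
    then obtain e where e: "shift e A \<inter> B \<noteq> {}" "pcard p (shift e A \<inter> B) < pcard p B" by blast
    define A' where "A' = shift e A"
    have perA': "periodic p A'" using perA A'_def by auto
    have cA': "pcard p A' = pcard p A" using p perA A'_def by auto
    define i where "i = pcard p (A' \<inter> B)"
    have i: "0 < i" "i < pcard p B"
      using e pcard_pos_iff[OF p periodic_Int[OF perA' perB]] by (simp_all add: i_def A'_def)
    have sums: "pcard p (A' \<union> B) + i = pcard p A + pcard p B"
      using pcard_Un_Int[of p A' B] cA' by (simp add: i_def)
    have d1: "pcard p (A' - B) + i = pcard p A" using pcard_Diff_Int[of p A' B] cA' i_def by simp
    have d2: "pcard p (B - A') + i = pcard p B" using pcard_Diff_Int[of p B A'] i_def by (simp add: Int_commute)
    have eq: "(\<Sum>x\<in>{0..<p}. min t (reps p A B x)) = (\<Sum>x\<in>{0..<p}. min t (reps p A' B x))"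
      unfolding A'_def by (rule sum_reps_shift[OF p perA, symmetric])
    show ?thesis
    proof (cases "t \<le> i")
      case True
      have "t * (pcard p (A' \<union> B) + pcard p (A' \<inter> B)) \<le> (\<Sum>x\<in>{0..<p}. min t (reps p (A' \<union> B) (A' \<inter> B) x)) + t * t"
      proof (rule less.hyps)
        show "pcard p (A' \<inter> B) < pcard p B" using i i_def by simp
        show "t \<le> pcard p (A' \<union> B)" using less.prems(4) pcard_mono[of B "A' \<union> B"] by (meson Un_upper2 order_trans)
      qed (use perA' perB True sums less.prems i_def in auto)
      also have "(\<Sum>x\<in>{0..<p}. min t (reps p (A' \<union> B) (A' \<inter> B) x)) \<le> (\<Sum>x\<in>{0..<p}. min t (reps p A' B x))"
        by (intro sum_mono) (simp add: reps_Dyson_transform[OF p perA' perB])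
      finally show ?thesis using sums eq i_def by simp
    next
      case False
      have "(t - i) * (pcard p (A' - B) + pcard p (B - A')) \<le> (\<Sum>x\<in>{0..<p}. min (t - i) (reps p (A' - B) (B - A') x)) + (t - i) * (t - i)"
      proof (rule less.hyps)
        show "pcard p (B - A') < pcard p B" using i d2 by simp
        show "pcard p (A' - B) + pcard p (B - A') \<le> nat p + (t - i)" using d1 d2 less.prems(5) False by simp
      qed (use perA' perB d1 d2 less.prems in auto)
      moreover have "(\<Sum>x\<in>{0..<p}. reps p (A' \<union> B) (A' \<inter> B) x) + (\<Sum>x\<in>{0..<p}. min (t - i) (reps p (A' - B) (B - A') x))
         \<le> (\<Sum>x\<in>{0..<p}. min t (reps p A' B x))"
      proof -
        have "reps p (A' \<union> B) (A' \<inter> B) x + min (t - i) (reps p (A' - B) (B - A') x) \<le> min t (reps p A' B x)" for x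
          using reps_Dyson_transform[OF p perA' perB, of x] reps_le[of p "A' \<union> B" "A' \<inter> B" x] False i_def by simp
        then show ?thesis by (simp add: sum.distrib[symmetric] sum_mono)
      qed
      moreover have "(\<Sum>x\<in>{0..<p}. reps p (A' \<union> B) (A' \<inter> B) x) = pcard p (A' \<union> B) * i"
        using sum_reps[OF p, of "A' \<union> B"] perA' perB i_def by auto
      \<comment> \<open>With t = i + s the two sides are equal.\<close>
      moreover have "t * (pcard p A + pcard p B) + (t - i) * (t - i) \<le> pcard p (A' \<union> B) * i + (t - i) * (pcard p (A' - B) + pcard p (B - A')) + t * t"
      proof -
        obtain s where s: "t = i + s" using False by (metis add.commute le_Suc_ex nat_le_linear)
        obtain a where a: "a = pcard p (A' - B)" by simp
        obtain b where b: "b = pcard p (B - A')" by simp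
        have "pcard p A = a + i" "pcard p B = b + i" "pcard p (A' \<union> B) = a + b + i" using a b d1 d2 sums by auto
        then show ?thesis unfolding a[symmetric] b[symmetric] s by (simp add: algebra_simps)
      qed
      ultimately show ?thesis using eq by linarith
    qed
  qed
qed

section \<open>Cauchy-Davenport bounds with errors\<close>

text \<open>The truncated count is at most t on S and at most the full count off S, and the latter
  counts sum to the total error of the translates. For t = 1 and no errors this is the
  Cauchy-Davenport theorem.\<close>

lemma pollard_robust:
  assumes "prime p" "periodic p A" "periodic p W" "t \<le> pcard p A" "t \<le> pcard p W"
    "pcard p A + pcard p W \<le> nat p + t"
  shows "t * (pcard p A + pcard p W) \<le> t * pcard p S + t * t + (\<Sum>w\<in>W \<inter> {0..<p}. pcard p (shift w A - S))"
proof -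
  have p: "p > 0" using assms(1) prime_gt_0_int by blast
  have "(\<Sum>x\<in>{0..<p}. min t (reps p A W x))
     \<le> (\<Sum>x\<in>{0..<p}. (if x \<in> S then t else 0) + (if x \<in> -S then reps p A W x else 0))"
    by (intro sum_mono) auto
  also have "\<dots> = (\<Sum>x\<in>S \<inter> {0..<p}. t) + (\<Sum>x\<in>(-S) \<inter> {0..<p}. reps p A W x)"
    unfolding sum.distrib sum_restrict_periodic ..
  also have "\<dots> = t * pcard p S + (\<Sum>w\<in>W \<inter> {0..<p}. pcard p (shift w A - S))"
    unfolding sum_reps_Int[OF p assms(2)] by (simp add: pcard_def[of p S] Diff_eq)
  finally show ?thesis using pollard[OF assms] by linarith
qed

text \<open>Taking t about \<epsilon> n balances the two losses: t itself, and the total error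
  divided by t, which is at most |W| \<epsilon>^2 n / t \<le> K \<epsilon> n.\<close>

lemma robust_lower:
  fixes \<epsilon> K :: real
  assumes "prime p" "periodic p A" "periodic p W" "W \<noteq> {}" "A \<noteq> {}"
    "\<And>w. w \<in> W \<Longrightarrow> real (pcard p (shift w A - S)) \<le> \<epsilon>\<^sup>2 * pcard p A"
    "real (pcard p W) \<le> K * pcard p A" "0 < \<epsilon>" "\<epsilon> \<le> 1" "1 \<le> K" "pcard p A + pcard p W \<le> nat p"
  shows "real (pcard p A + pcard p W) \<le> pcard p S + (1 + K) * \<epsilon> * pcard p A + 1"
proof -
  have p: "p > 0" using assms(1) prime_gt_0_int by blast
  define n where "n = pcard p A"
  define t where "t = nat \<lceil>\<epsilon> * n\<rceil>"
  have n: "n > 0" using pcard_pos_iff[OF p assms(2)] assms(5) n_def by simp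
  have tl: "\<epsilon> * n \<le> t" "real t \<le> \<epsilon> * n + 1" unfolding t_def using assms(8) by (auto simp: real_nat_ceiling_ge) linarith?
  have en: "\<epsilon> * n > 0" using n assms by simp
  have e2: "\<epsilon>\<^sup>2 * n \<le> \<epsilon> * n" using assms(8,9) by (intro mult_right_mono) (auto simp: power2_eq_square mult_left_le)
  have tn: "t \<le> n" unfolding t_def using assms(8,9) n by (simp add: nat_le_iff ceiling_le_iff mult_left_le_one_le)
  have K: "\<epsilon> * n \<le> K * (\<epsilon> * n)" using mult_right_mono[OF assms(10), of "\<epsilon> * n"] en by simp
  show ?thesis
  proof (cases "t \<le> pcard p W")
    case True
    have "t * (n + pcard p W) \<le> t * pcard p S + t * t + (\<Sum>w\<in>W \<inter> {0..<p}. pcard p (shift w A - S))"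
      using pollard_robust[OF assms(1-3) _ True] tn assms(11) by (simp add: n_def)
    then have "real (t * (n + pcard p W)) \<le> real (t * pcard p S + t * t + (\<Sum>w\<in>W \<inter> {0..<p}. pcard p (shift w A - S)))"
      by (simp only: of_nat_le_iff)
    also have "\<dots> = t * pcard p S + t * t + (\<Sum>w\<in>W \<inter> {0..<p}. real (pcard p (shift w A - S)))" by simp
    also have "(\<Sum>w\<in>W \<inter> {0..<p}. real (pcard p (shift w A - S))) \<le> (\<Sum>w\<in>W \<inter> {0..<p}. \<epsilon>\<^sup>2 * n)"
      using assms(6) by (intro sum_mono) (auto simp: n_def)
    also have "\<dots> = real (pcard p W) * (\<epsilon>\<^sup>2 * n)" by (simp add: pcard_def)
    also have "\<dots> \<le> (K * n) * (\<epsilon>\<^sup>2 * n)" using assms(7) by (intro mult_right_mono) (auto simp: n_def)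
    also have "\<dots> = (K * \<epsilon> * n) * (\<epsilon> * n)" by (simp add: power2_eq_square)
    also have "\<dots> \<le> (K * \<epsilon> * n) * t" using tl assms(8,10) by (intro mult_left_mono) auto
    finally have "real t * real (n + pcard p W) \<le> real t * (pcard p S + t + K * \<epsilon> * n)" by (simp add: algebra_simps)
    then have "real (n + pcard p W) \<le> pcard p S + t + K * \<epsilon> * n" using tl en by simp
    then show ?thesis using tl by (simp add: algebra_simps n_def)
  next
    case False
    \<comment> \<open>For |W| < t the set W is negligible, and a single translate of A
      suffices.\<close>
    obtain w where w: "w \<in> W" using assms(4) by auto
    have "pcard p (shift w A) \<le> pcard p (shift w A - S) + pcard p S"
      using pcard_Diff_Un[of p "shift w A" S] pcard_mono[of "shift w A" "shift w A \<union> S" p] by simp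
    then have "n \<le> pcard p (shift w A - S) + pcard p S" using p assms(2) by (simp add: n_def)
    then have "real n \<le> \<epsilon>\<^sup>2 * n + pcard p S" using assms(6)[OF w] by (simp add: n_def)
    then show ?thesis using False tl e2 K by (simp add: algebra_simps n_def)
  qed
qed

text \<open>If W were larger, a subset of \<lfloor>m + E\<rfloor> + 1 elements would contradict
  \<open>robust_lower\<close>. Cutting W down first makes the size conditions of that lemma
  independent of how large W is.\<close>

lemma robust_upper:
  fixes \<epsilon> K m E :: real
  assumes "prime p" "periodic p A" "periodic p W" "A \<noteq> {}"
    "\<And>w. w \<in> W \<Longrightarrow> real (pcard p (shift w A - S)) \<le> \<epsilon>\<^sup>2 * pcard p A"
    "0 < \<epsilon>" "\<epsilon> \<le> 1" "1 \<le> K" "0 \<le> m" "real (pcard p S) \<le> pcard p A + m"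
    "E = (1 + K) * \<epsilon> * pcard p A + 1"
    "m + E + 1 \<le> K * pcard p A" "pcard p A + m + E + 1 \<le> p"
  shows "real (pcard p W) \<le> m + E"
proof (rule ccontr)
  assume *: "\<not> ?thesis"
  have p: "p > 0" using assms(1) prime_gt_0_int by blast
  define k where "k = nat \<lfloor>m + E\<rfloor> + 1"
  have E: "E > 0" using assms(6,8,11) by (simp add: add_nonneg_pos)
  have k: "m + E < real k" "real k \<le> m + E + 1" using E assms(9) unfolding k_def by linarith+
  have "k \<le> pcard p W" using * E assms(9) unfolding k_def by linarith
  then obtain V where V: "V \<subseteq> W" "periodic p V" "pcard p V = k" using ex_periodic_subset[OF p assms(3)] by blast
  have "V \<noteq> {}" using V(3) k E assms(9) by auto
  moreover have "pcard p A + pcard p V \<le> nat p" using V k assms(13) p by linarith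
  ultimately have "real (pcard p A + pcard p V) \<le> pcard p S + (1 + K) * \<epsilon> * pcard p A + 1"
    using assms V k by (intro robust_lower) auto
  then show False using V assms(10,11) k by simp
qed

lemma periodic_translates_mem_cong:
  assumes "periodic p A" shows "periodic p {x. P (pcard p (shift x A - T))}"
  unfolding periodic_def
proof (intro allI)
  fix x
  have "shift (x + p) A = shift x A" by (rule shift_cong[OF assms]) (simp add: cong_def)
  then show "(x + p \<in> {x. P (pcard p (shift x A - T))}) = (x \<in> {x. P (pcard p (shift x A - T))})" by simp
qed

lemma translates_insert: "translates A (insert b F) = shift b A \<union> translates A F"
  by (auto simp: translates_def)

text \<open>As long as some translate has more than h points outside the union so far, adding it
  gains more than h; k such gains contradict the hypothesis.\<close>

lemma greedy_cover:
  fixes h :: real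
  assumes "\<And>F. finite F \<Longrightarrow> F \<subseteq> B \<Longrightarrow> card F \<le> k \<Longrightarrow> real (pcard p (translates A F)) < k * h"
  obtains F where "finite F" "F \<subseteq> B" "card F \<le> k" "\<And>b. b \<in> B \<Longrightarrow> real (pcard p (shift b A - translates A F)) \<le> h"
proof -
  have "\<exists>F. finite F \<and> F \<subseteq> B \<and> card F \<le> k \<and> (\<forall>b\<in>B. real (pcard p (shift b A - translates A F)) \<le> h)"
  proof (rule ccontr)
    assume no: "\<not> ?thesis"
    have "\<exists>F. finite F \<and> F \<subseteq> B \<and> card F \<le> j \<and> j * h \<le> pcard p (translates A F)" if "j \<le> k" for j
      using that
    proof (induction j)
      case 0 then show ?case by (intro exI[of _ "{}"]) auto
    next
      case (Suc j)
      then obtain F where F: "finite F" "F \<subseteq> B" "card F \<le> j" "j * h \<le> pcard p (translates A F)" by auto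
      with no Suc.prems obtain b where b: "b \<in> B" "h < pcard p (shift b A - translates A F)"
        by (metis Suc_leD not_le order_trans)
      have "pcard p (translates A (insert b F)) = pcard p (shift b A - translates A F) + pcard p (translates A F)"
        by (simp add: translates_insert pcard_Diff_Un)
      then show ?case using F b by (intro exI[of _ "insert b F"]) (auto simp: algebra_simps card_insert_if)
    qed
    from this[of k] assms show False by fastforce
  qed
  then show ?thesis using that by blast
qed

subsection \<open>An almost invariant translation\<close>

text \<open>Build the tuple entry by entry. If it is not good yet, more than \<kappa> |B| choices of
  the next entry enlarge the union by more than h; if it is good, it stays good for every choice.
  Either way at least \<kappa> |B| extensions preserve the alternative.\<close>

lemma card_good_tuples_ge:
  fixes h \<kappa> :: real and p :: int and A B :: "int set"
  assumes "\<kappa> \<le> 1" "0 \<le> \<kappa>"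
  defines "q \<equiv> B \<inter> {0..<p}"
  defines "good \<equiv> \<lambda>bs. real (card {b \<in> q. h < pcard p (shift b A - translates A (set bs))}) \<le> \<kappa> * pcard p B"
  shows "(\<kappa> * pcard p B) ^ k \<le> card {bs. length bs = k \<and> set bs \<subseteq> q \<and> (good bs \<or> k * h \<le> pcard p (translates A (set bs)))}"
proof (induction k)
  case 0
  have "{bs. length bs = 0 \<and> set bs \<subseteq> q \<and> (good bs \<or> real 0 * h \<le> pcard p (translates A (set bs)))} = {[]}" by auto
  then show ?case by simp
next
  case (Suc k)
  define L where "L k = {bs. length bs = k \<and> set bs \<subseteq> q \<and> (good bs \<or> real k * h \<le> pcard p (translates A (set bs)))}" for k
  define E where "E bs = (if good bs then q else {b \<in> q. h < pcard p (shift b A - translates A (set bs))})" for bs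
  have fq: "finite q" by (simp add: q_def)
  have fL: "finite (L k)" for k
    by (rule finite_subset[OF _ finite_lists_length_eq[OF fq, of k]]) (auto simp: L_def)
  have fE: "finite (E bs)" for bs using fq by (simp add: E_def)
  have cE: "\<kappa> * pcard p B \<le> card (E bs)" for bs
  proof (cases "good bs")
    case True
    have "\<kappa> * pcard p B \<le> 1 * real (pcard p B)" using assms by (intro mult_right_mono) auto
    then show ?thesis using True by (simp add: E_def q_def pcard_def)
  next
    case False
    then show ?thesis by (simp add: E_def) (simp add: good_def)
  qed
  have sub: "(\<lambda>(bs, b). b # bs) ` (SIGMA bs:L k. E bs) \<subseteq> L (Suc k)"
  proof clarify
    fix bs b assume bs: "bs \<in> L k" and b: "b \<in> E bs"
    let ?T = "translates A (set bs)" and ?T' = "translates A (set (b # bs))"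
    have T': "?T' = shift b A \<union> ?T" by (simp add: translates_insert)
    have bq: "b \<in> q" using b by (auto simp: E_def split: if_splits)
    show "b # bs \<in> L (Suc k)"
    proof (cases "good bs")
      case True
      have "card {b' \<in> q. h < pcard p (shift b' A - ?T')} \<le> card {b' \<in> q. h < pcard p (shift b' A - ?T)}"
      proof (rule card_mono)
        show "{b' \<in> q. h < pcard p (shift b' A - ?T')} \<subseteq> {b' \<in> q. h < pcard p (shift b' A - ?T)}"
        proof clarify
          fix b' assume "h < pcard p (shift b' A - ?T')"
          moreover have "pcard p (shift b' A - ?T') \<le> pcard p (shift b' A - ?T)"
            unfolding T' by (rule pcard_mono) auto
          ultimately show "h < pcard p (shift b' A - ?T)" by linarith
        qed
      qed (use fq in auto)
      then have "good (b # bs)" using True unfolding good_def by linarith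
      then show ?thesis using bs bq by (auto simp: L_def)
    next
      case False
      then have "h < pcard p (shift b A - ?T)" "k * h \<le> pcard p ?T" using b bs by (auto simp: E_def L_def)
      moreover have "pcard p ?T' = pcard p (shift b A - ?T) + pcard p ?T"
        unfolding T' by (rule pcard_Diff_Un[symmetric])
      ultimately have "Suc k * h \<le> pcard p ?T'" by (simp add: algebra_simps)
      then show ?thesis using bs bq by (auto simp: L_def)
    qed
  qed
  have "(\<kappa> * pcard p B) ^ Suc k \<le> (\<kappa> * pcard p B) * card (L k)"
    using Suc.IH assms(2) by (simp add: L_def mult_left_mono)
  also have "\<dots> = (\<Sum>bs\<in>L k. \<kappa> * pcard p B)" by simp
  also have "\<dots> \<le> (\<Sum>bs\<in>L k. real (card (E bs)))" by (intro sum_mono cE)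
  also have "\<dots> = card (SIGMA bs:L k. E bs)" using fL fE by simp
  also have "\<dots> = card ((\<lambda>(bs, b). b # bs) ` (SIGMA bs:L k. E bs))"
    by (subst card_image) (auto simp: inj_on_def)
  also have "\<dots> \<le> card (L (Suc k))" using sub fL by (simp add: card_mono)
  finally show ?case by (simp add: L_def)
qed

text \<open>A positive proportion of the $c$-tuples $b$ from $B$ are good: $A + b$ almost contains most
  translates of $A$ by elements of $B$, and hence determines $B$ up to a small error. Since
  $a + b$ stays inside a set of size $O(n)$ for most pairs $(a, b)$, the pigeonhole principle
  provides two good tuples that are translates of each other.\<close>

lemma almost_invariant_translation:
  fixes \<epsilon> \<kappa> K E :: real
  assumes "prime p" "periodic p A" "periodic p B" "A \<noteq> {}" "0 < \<kappa>" "\<kappa> \<le> 1" "0 < \<epsilon>" "\<epsilon> \<le> 1" "1 \<le> K" "0 < c"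
    and nm: "n = pcard p A" "m = pcard p B"
    and NB: "\<And>F. finite F \<Longrightarrow> F \<subseteq> B \<Longrightarrow> card F \<le> max c c' \<Longrightarrow> pcard p (translates A F) < n + m"
    and c: "n + m \<le> c * (\<epsilon>\<^sup>2 * n)" and c': "2 * c * (n + m) \<le> c' * n"
    and E: "E = (1 + K) * \<epsilon> * n + 1" "m + E + 1 \<le> K * n" "n + m + E + 1 \<le> p"
    and big: "real (n + m) ^ c < (\<kappa> * m) ^ c * (n / 2)"
  obtains t where "\<not> p dvd t" "real (pcard p (shift t B - B)) \<le> 2 * \<kappa> * m + E"
proof -
  have p: "p > 0" using assms(1) prime_gt_0_int by blast
  define T where "T bs = translates A (set bs)" for bs
  define h where "h = \<epsilon>\<^sup>2 * n"
  define q where "q = B \<inter> {0..<p}"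
  define good where "good bs \<longleftrightarrow> real (card {b \<in> q. h < pcard p (shift b A - T bs)}) \<le> \<kappa> * m" for bs
  define L where "L = {bs. length bs = c \<and> set bs \<subseteq> q \<and> good bs}"
  have n0: "n > 0" using pcard_pos_iff[OF p assms(2)] assms(4) nm by simp
  have h0: "h > 0" using n0 assms by (simp add: h_def)
  have fq: "finite q" by (simp add: q_def)
  have fL: "finite L"
    by (rule finite_subset[OF _ finite_lists_length_eq[OF fq, of c]]) (auto simp: L_def)
  have small: "pcard p (T bs) < n + m" if "length bs = c" "set bs \<subseteq> q" for bs
    unfolding T_def using that card_length[of bs] by (intro NB) (auto simp: q_def)
  \<comment> \<open>A union of c translates has fewer than n + m \<le> c h elements, so the second
    alternative of the tuple count never occurs.\<close>
  have "{bs. length bs = c \<and> set bs \<subseteq> q \<and> (good bs \<or> c * h \<le> pcard p (T bs))} = L"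
  proof -
    have "\<not> c * h \<le> pcard p (T bs)" if "length bs = c" "set bs \<subseteq> q" for bs
      using small[OF that] c unfolding h_def by linarith
    then show ?thesis by (auto simp: L_def)
  qed
  then have cL: "(\<kappa> * m) ^ c \<le> card L"
    using card_good_tuples_ge[where \<kappa> = \<kappa> and B = B and p = p and h = h and A = A and k = c] assms(5,6) by (simp add: good_def[abs_def] q_def T_def nm)
  \<comment> \<open>One b is bad for at most n / (2 c) elements of A, so for each tuple at least
    half of the a in A satisfy a + b \<in> S for all c entries b.\<close>
  obtain F where F: "finite F" "F \<subseteq> B" "card F \<le> c'" "\<And>b. b \<in> B \<Longrightarrow> real (pcard p (shift b A - translates A F)) \<le> n / (2 * c)"
  proof (rule greedy_cover[of B c' p A "n / (2 * c)"])
    fix F assume "finite F" "F \<subseteq> B" "card F \<le> c'"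
    then have "pcard p (translates A F) < n + m" by (intro NB) auto
    then have "real (pcard p (translates A F)) < real (n + m)" by (simp only: of_nat_less_iff)
    also have "real (n + m) \<le> c' * (n / (2 * c))"
    proof -
      have "real (2 * c * (n + m)) \<le> real (c' * n)" using c' by (simp only: of_nat_le_iff)
      then show ?thesis using assms(10) by (simp add: field_simps)
    qed
    finally show "real (pcard p (translates A F)) < c' * (n / (2 * c))" .
  qed blast
  define S where "S = translates A F"
  have perS: "periodic p S" using assms(2) S_def by auto
  have cS: "pcard p S < n + m" unfolding S_def using F by (intro NB) auto
  define G where "G bs = {a \<in> A \<inter> {0..<p}. \<forall>b\<in>set bs. a + b \<in> S}" for bs
  have cG: "real n / 2 \<le> card (G bs)" if "bs \<in> L" for bs
  proof -
    have bad: "real (card {a \<in> A \<inter> {0..<p}. a + b \<notin> S}) \<le> n / (2 * c)" if "b \<in> set bs" for b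
    proof -
      have "b \<in> B" using that \<open>bs \<in> L\<close> by (auto simp: L_def q_def)
      have "{a \<in> A \<inter> {0..<p}. a + b \<notin> S} = shift (- b) (shift b A - S) \<inter> {0..<p}" by auto
      then have "card {a \<in> A \<inter> {0..<p}. a + b \<notin> S} = pcard p (shift (- b) (shift b A - S))"
        by (simp add: pcard_def)
      also have "\<dots> = pcard p (shift b A - S)" using p assms(2) perS by (intro pcard_shift) auto
      finally show ?thesis using F(4)[OF \<open>b \<in> B\<close>] by (simp add: S_def)
    qed
    have "A \<inter> {0..<p} = G bs \<union> (\<Union>b\<in>set bs. {a \<in> A \<inter> {0..<p}. a + b \<notin> S})" by (auto simp: G_def)
    then have "n = card (G bs \<union> (\<Union>b\<in>set bs. {a \<in> A \<inter> {0..<p}. a + b \<notin> S}))"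
      unfolding nm pcard_def by (rule arg_cong)
    also have "\<dots> \<le> card (G bs) + card (\<Union>b\<in>set bs. {a \<in> A \<inter> {0..<p}. a + b \<notin> S})" by (rule card_Un_le)
    also have "card (\<Union>b\<in>set bs. {a \<in> A \<inter> {0..<p}. a + b \<notin> S}) \<le> (\<Sum>b\<in>set bs. card {a \<in> A \<inter> {0..<p}. a + b \<notin> S})"
      by (rule card_UN_le) simp
    finally have "real n \<le> card (G bs) + (\<Sum>b\<in>set bs. real (card {a \<in> A \<inter> {0..<p}. a + b \<notin> S}))"
      by (simp flip: of_nat_sum of_nat_add)
    also have "(\<Sum>b\<in>set bs. real (card {a \<in> A \<inter> {0..<p}. a + b \<notin> S})) \<le> (\<Sum>b\<in>set bs. n / (2 * c))"
      by (intro sum_mono bad)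
    also have "\<dots> = card (set bs) * (n / (2 * c))" by simp
    also have "\<dots> \<le> c * (n / (2 * c))"
      using that card_length[of bs] by (intro mult_right_mono) (auto simp: L_def)
    also have "\<dots> = n / 2" using assms(10) by simp
    finally show ?thesis by simp
  qed
  define X where "X = (SIGMA bs:L. G bs)"
  have fG: "finite (G bs)" for bs by (rule finite_subset[of _ "{0..<p}"]) (auto simp: G_def)
  \<comment> \<open>A collision means that two tuples, moved by a and a', agree modulo p. There are
    at least (\<kappa> m)^c n/2 pairs and at most (n + m)^c images; the factor n/2 outweighs the
    ratio of the two powers, which is bounded in terms of the parameters.\<close>
  define g where "g = (\<lambda>(bs, a). map (\<lambda>b. (a + b) mod p) bs)"
  have "\<not> inj_on g X"
  proof
    assume "inj_on g X"
    moreover have "g ` X \<subseteq> {xs. set xs \<subseteq> S \<inter> {0..<p} \<and> length xs = c}"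
      using p by (auto simp: g_def X_def G_def L_def periodic_mod[OF perS])
    ultimately have "card X \<le> card {xs. set xs \<subseteq> S \<inter> {0..<p} \<and> length xs = c}"
      by (intro card_inj_on_le finite_lists_length_eq) auto
    also have "\<dots> = pcard p S ^ c" unfolding pcard_def by (rule card_lists_length_eq) simp
    also have "\<dots> \<le> (n + m) ^ c" using cS by (intro power_mono) auto
    finally have "real (card X) \<le> real (n + m) ^ c" by (metis of_nat_le_iff of_nat_power)
    moreover have "(\<kappa> * m) ^ c * (n / 2) \<le> card X"
    proof -
      have "(\<kappa> * m) ^ c * (n / 2) \<le> card L * (n / 2)" using cL by (intro mult_right_mono) auto
      also have "\<dots> = (\<Sum>bs\<in>L. n / 2)" by simp
      also have "\<dots> \<le> (\<Sum>bs\<in>L. real (card (G bs)))" by (intro sum_mono cG)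
      also have "\<dots> = card X" using fL fG by (simp add: X_def)
      finally show ?thesis .
    qed
    ultimately show False using big by linarith
  qed
  then obtain bs a bs' a' where *: "bs \<in> L" "a \<in> G bs" "bs' \<in> L" "a' \<in> G bs'"
      "g (bs, a) = g (bs', a')" "(bs, a) \<noteq> (bs', a')"
    unfolding inj_on_def X_def by auto
  have len: "length bs = c" "length bs' = c" using * by (auto simp: L_def)
  have ge: "[a + bs ! i = a' + bs' ! i] (mod p)" if "i < c" for i
    using arg_cong[OF *(5), of "\<lambda>xs. xs ! i"] that len by (simp add: g_def cong_def)
  have "a \<noteq> a'"
  proof
    assume "a = a'"
    have "bs = bs'"
    proof (rule nth_equalityI)
      fix i assume i: "i < length bs"
      have "[bs ! i = bs' ! i] (mod p)" using ge[of i] i len \<open>a = a'\<close> by (simp add: cong_add_lcancel)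
      moreover have "bs ! i \<in> {0..<p}" "bs' ! i \<in> {0..<p}"
        using *(1,3) i len nth_mem[of i bs] nth_mem[of i bs'] unfolding L_def q_def by (metis (mono_tags, lifting) Int_iff mem_Collect_eq subsetD)+
      ultimately show "bs ! i = bs' ! i" by (simp add: cong_def)
    qed (use len in simp)
    with * \<open>a = a'\<close> show False by simp
  qed
  define t where "t = a - a'"
  have ndvd: "\<not> p dvd t"
  proof
    assume "p dvd t"
    then have "a mod p = a' mod p" by (simp add: t_def mod_eq_dvd_iff)
    moreover have "a \<in> {0..<p}" "a' \<in> {0..<p}" using * by (auto simp: G_def)
    ultimately show False using \<open>a \<noteq> a'\<close> by simp
  qed
  have Tn: "T xs = (\<Union>i<length xs. shift (xs ! i) A)" for xs
    by (auto simp: T_def translates_def set_conv_nth)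
  have T': "T bs' = shift t (T bs)"
  proof -
    have "shift (bs' ! i) A = shift t (shift (bs ! i) A)" if "i < c" for i
    proof -
      have "[t + bs ! i = bs' ! i] (mod p)"
        using ge[OF that] unfolding t_def by (simp add: cong_iff_dvd_diff algebra_simps)
      then show ?thesis using shift_cong[OF assms(2)] by (metis shift_shift)
    qed
    then show ?thesis unfolding Tn len by (auto simp del: shift_shift)
  qed
  \<comment> \<open>The union \<open>T bs\<close> recovers B approximately: \<open>\<Psi> bs\<close>
    misses at most \<kappa> m elements of B and, by \<open>robust_upper\<close>, has at most m + E
    elements. Since \<open>T bs'\<close> is \<open>T bs\<close> moved by t, translation by t carries
    one approximation of B to another.\<close>
  define \<Psi> where "\<Psi> bs = {x. real (pcard p (shift x A - T bs)) \<le> h}" for bs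
  have per\<Psi>: "periodic p (\<Psi> bs)" for bs unfolding \<Psi>_def by (rule periodic_translates_mem_cong[OF assms(2)])
  have \<Psi>': "\<Psi> bs' = shift t (\<Psi> bs)"
  proof -
    have "pcard p (shift x A - T bs') = pcard p (shift (x - t) A - T bs)" for x
    proof -
      have "shift x A - T bs' = shift t (shift (x - t) A - T bs)" by (simp add: T' shift_Diff)
      moreover have "periodic p (shift (x - t) A - T bs)" using assms(2) by (auto simp: T_def)
      ultimately show ?thesis using p by simp
    qed
    then show ?thesis by (auto simp: \<Psi>_def)
  qed
  have cB: "pcard p (B - \<Psi> xs) \<le> \<kappa> * m" if "xs \<in> L" for xs
  proof -
    have "(B - \<Psi> xs) \<inter> {0..<p} = {b \<in> q. h < pcard p (shift b A - T xs)}" by (auto simp: \<Psi>_def q_def)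
    then show ?thesis using that by (simp add: L_def good_def pcard_def)
  qed
  have "real (pcard p (\<Psi> bs')) \<le> m + E"
  proof (rule robust_upper[OF assms(1,2) per\<Psi> assms(4)])
    show "real (pcard p (shift w A - T bs')) \<le> \<epsilon>\<^sup>2 * pcard p A" if "w \<in> \<Psi> bs'" for w
      using that by (simp add: \<Psi>_def h_def nm)
    have "pcard p (T bs') < n + m" using * by (intro small) (auto simp: L_def)
    then show "real (pcard p (T bs')) \<le> pcard p A + real m" by (simp add: nm)
  qed (use assms in auto)
  moreover have "pcard p (\<Psi> bs' - B) + pcard p B = pcard p (\<Psi> bs') + pcard p (B - \<Psi> bs')"
    using pcard_Diff_Un[of p "\<Psi> bs'" B] pcard_Diff_Un[of p B "\<Psi> bs'"] by (simp add: Un_commute)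
  moreover have "pcard p (shift t B - B) \<le> pcard p (shift t (B - \<Psi> bs)) + pcard p (\<Psi> bs' - B)"
  proof -
    have "shift t B - B \<subseteq> shift t (B - \<Psi> bs) \<union> (\<Psi> bs' - B)" by (auto simp: \<Psi>')
    then show ?thesis using pcard_mono pcard_Un_le order_trans by metis
  qed
  moreover have "pcard p (shift t (B - \<Psi> bs)) = pcard p (B - \<Psi> bs)" using p assms(3) per\<Psi> by (intro pcard_shift) auto
  ultimately have "real (pcard p (shift t B - B)) \<le> 2 * \<kappa> * m + E"
    using cB[OF *(1)] cB[OF *(3)] nm by (simp add: algebra_simps)
  then show ?thesis using that ndvd by blast
qed

subsection \<open>Shrinking a near-extremal set\<close>

text \<open>Near equality in the Cauchy-Davenport theorem for $(A, Y)$, witnessed by $S$.\<close>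

definition tight :: "int \<Rightarrow> int set \<Rightarrow> real \<Rightarrow> int set \<Rightarrow> bool" where
  "tight p A \<epsilon> Y \<longleftrightarrow> (\<exists>S. periodic p S \<and> (\<forall>b\<in>Y. real (pcard p (shift b A - S)) \<le> \<epsilon> * real (pcard p A)) \<and>
     real (pcard p S) \<le> real (pcard p A) + real (pcard p Y) + \<epsilon> * real (pcard p A))"

lemma tight_mono:
  fixes \<epsilon> \<delta> :: real
  assumes "tight p A \<epsilon> Y" "\<epsilon> \<le> \<delta>" shows "tight p A \<delta> Y"
proof -
  have "\<epsilon> * real (pcard p A) \<le> \<delta> * real (pcard p A)" using assms(2) by (intro mult_right_mono) auto
  then show ?thesis
    using assms(1) unfolding tight_def by (elim exE) (rule exI, fastforce)
qed

lemma tightE: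
  fixes \<epsilon> :: real
  assumes "tight p A \<epsilon> Y"
  obtains S where "periodic p S" "\<And>b. b \<in> Y \<Longrightarrow> real (pcard p (shift b A - S)) \<le> \<epsilon> * pcard p A"
    "real (pcard p S) \<le> pcard p A + pcard p Y + \<epsilon> * pcard p A"
proof -
  from assms[unfolded tight_def] obtain S where
    "periodic p S \<and> (\<forall>b\<in>Y. real (pcard p (shift b A - S)) \<le> \<epsilon> * real (pcard p A)) \<and>
     real (pcard p S) \<le> real (pcard p A) + real (pcard p Y) + \<epsilon> * real (pcard p A)" ..
  then show ?thesis by (intro that[of S]) auto
qed

text \<open>Submodularity: the sizes of intersection and union add up, and the union already satisfies the
  Cauchy-Davenport lower bound.\<close>

lemma tight_Int_shift:
  fixes \<epsilon> \<delta> \<epsilon>' K :: real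
  assumes "prime p" "periodic p A" "periodic p Y" "A \<noteq> {}" "Y \<noteq> {}" "tight p A \<epsilon> Y"
    "0 < \<delta>" "\<delta> \<le> 1" "1 \<le> K" "\<epsilon> \<le> \<delta>\<^sup>2"
    "real (pcard p (Y \<union> shift y Y)) \<le> K * pcard p A" "pcard p A + pcard p (Y \<union> shift y Y) \<le> nat p"
    "2 * \<epsilon> * pcard p A + (1 + K) * \<delta> * pcard p A + 1 \<le> \<epsilon>' * pcard p A"
  shows "tight p A \<epsilon>' (Y \<inter> shift y Y)"
proof -
  have p: "p > 0" using assms(1) prime_gt_0_int by blast
  obtain S where S: "periodic p S" "\<And>b. b \<in> Y \<Longrightarrow> real (pcard p (shift b A - S)) \<le> \<epsilon> * pcard p A"
     "real (pcard p S) \<le> pcard p A + pcard p Y + \<epsilon> * pcard p A" using tightE[OF assms(6)] by metis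
  let ?S1 = "S \<inter> shift y S" and ?S2 = "S \<union> shift y S"
  let ?Y1 = "Y \<inter> shift y Y" and ?Y2 = "Y \<union> shift y Y"
  have e: "\<epsilon> * pcard p A \<le> \<delta>\<^sup>2 * pcard p A" using assms(10) by (intro mult_right_mono) auto
  have sh: "real (pcard p (shift b A - shift y S)) \<le> \<epsilon> * pcard p A" if "b - y \<in> Y" for b
  proof -
    have "shift b A - shift y S = shift y (shift (b - y) A - S)" by (auto simp: shift_Diff)
    moreover have "periodic p (shift (b - y) A - S)" using assms S by auto
    ultimately show ?thesis using S(2)[OF that] p by simp
  qed
  have "real (pcard p A + pcard p ?Y2) \<le> pcard p ?S2 + (1 + K) * \<delta> * pcard p A + 1"
  proof (rule robust_lower[OF assms(1,2)])
    fix w assume "w \<in> ?Y2"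
    then consider "w \<in> Y" | "w - y \<in> Y" by auto
    then show "real (pcard p (shift w A - ?S2)) \<le> \<delta>\<^sup>2 * pcard p A"
    proof cases
      case 1
      have "pcard p (shift w A - ?S2) \<le> pcard p (shift w A - S)" by (rule pcard_mono) auto
      then show ?thesis using S(2)[OF 1] e by linarith
    next
      case 2
      have "pcard p (shift w A - ?S2) \<le> pcard p (shift w A - shift y S)" by (rule pcard_mono) auto
      then show ?thesis using sh[OF 2] e by linarith
    qed
  qed (use assms in auto)
  moreover have "pcard p ?S1 + pcard p ?S2 = 2 * pcard p S" "pcard p ?Y1 + pcard p ?Y2 = 2 * pcard p Y"
    using pcard_Un_Int[of p S "shift y S"] pcard_Un_Int[of p Y "shift y Y"] p S(1) assms(3) by auto
  ultimately have "real (pcard p ?S1) \<le> pcard p A + pcard p ?Y1 + \<epsilon>' * pcard p A"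
    using S(3) assms(13) by linarith
  moreover have "real (pcard p (shift b A - ?S1)) \<le> \<epsilon>' * pcard p A" if "b \<in> ?Y1" for b
  proof -
    have "shift b A - ?S1 = (shift b A - S) \<union> (shift b A - shift y S)" by auto
    then have "pcard p (shift b A - ?S1) \<le> pcard p (shift b A - S) + pcard p (shift b A - shift y S)"
      by (metis pcard_Un_le)
    moreover have "0 \<le> (1 + K) * \<delta> * pcard p A" using assms by simp
    ultimately show ?thesis using S(2)[of b] sh[of b] that assms(13) by auto
  qed
  moreover have "periodic p ?S1" using S by auto
  ultimately show ?thesis unfolding tight_def by (intro exI[of _ ?S1]) simp
qed

lemma sum_overlap:
  assumes "p > 0" "periodic p Y"
  shows "(\<Sum>y\<in>{0..<p}. pcard p (Y \<inter> shift y Y)) = pcard p Y ^ 2"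
proof -
  have "(\<Sum>y\<in>UNIV \<inter> {0..<p}. pcard p (shift y Y \<inter> Y)) = (\<Sum>x\<in>Y \<inter> {0..<p}. reps p Y UNIV x)"
    by (rule sum_reps_Int[OF assms, symmetric])
  also have "\<dots> = (\<Sum>x\<in>Y \<inter> {0..<p}. pcard p Y)"
    by (simp add: reps_def pcard_reflect[OF assms])
  also have "\<dots> = pcard p Y ^ 2" by (simp add: pcard_def power2_eq_square)
  finally show ?thesis by (simp add: Int_commute)
qed

lemma pcard_shift_Diff_sym:
  assumes "p > 0" "periodic p Y"
  shows "pcard p (Y - shift y Y) = pcard p (shift y Y - Y)"
  using pcard_Diff_Int[of p Y "shift y Y"] pcard_Diff_Int[of p "shift y Y" Y] assms
  by (simp add: Int_commute)

text \<open>The average of |Y \<inter> (Y + y)| over y is |Y|^2 / p, so some y has overlap at most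
  r. Write y as a multiple of d and walk there from 0, where the overlap is |Y| \<ge> r. Each step
  lowers it by at most |(Y + d) - Y|, so the first multiple with overlap at most r is still close to
  r.\<close>

lemma ex_overlap_near:
  fixes r :: real
  assumes "prime p" "periodic p Y" "\<not> p dvd d" "r \<le> pcard p Y" "real (pcard p Y ^ 2) \<le> p * r"
  obtains y where "pcard p (Y \<inter> shift y Y) \<le> r" "r \<le> pcard p (Y \<inter> shift y Y) + real (pcard p (shift d Y - Y))"
proof -
  have p: "p > 0" using assms(1) prime_gt_0_int by blast
  define f where "f j = pcard p (Y \<inter> shift (int j * d) Y)" for j
  have "\<exists>y\<in>{0..<p}. real (pcard p (Y \<inter> shift y Y)) \<le> r"
  proof (rule ccontr)
    assume "\<not> ?thesis"
    then have "(\<Sum>y\<in>{0..<p}. r) < (\<Sum>y\<in>{0..<p}. real (pcard p (Y \<inter> shift y Y)))"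
      using p by (intro sum_strict_mono) (auto simp: not_le)
    then show False using sum_overlap[OF p assms(2)] assms(5) p by (simp flip: of_nat_sum)
  qed
  then obtain y where y: "real (pcard p (Y \<inter> shift y Y)) \<le> r" by blast
  obtain k where "[d * k = 1] (mod p)"
    using cong_solve_coprime_int[OF coprime_prime_int[OF assms(1,3)]] by blast
  from cong_scalar_right[OF this, of y] have "[d * (k * y) = y] (mod p)" by (simp add: mult.assoc)
  moreover have "[d * (k * y) = int (nat ((k * y) mod p)) * d] (mod p)"
    using p by (simp add: cong_def mod_mult_right_eq mult.commute[of _ d])
  ultimately have "[y = int (nat ((k * y) mod p)) * d] (mod p)" by (metis cong_sym cong_trans)
  then have "shift y Y = shift (int (nat ((k * y) mod p)) * d) Y" by (rule shift_cong[OF assms(2)])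
  then have ex: "\<exists>j. real (f j) \<le> r" using y unfolding f_def by metis
  define j where "j = (LEAST j. real (f j) \<le> r)"
  have j: "real (f j) \<le> r" unfolding j_def using ex by (rule LeastI_ex)
  have "r \<le> f j + real (pcard p (shift d Y - Y))"
  proof (cases j)
    case 0
    then show ?thesis using assms(4) by (simp add: f_def)
  next
    case (Suc i)
    then have "\<not> real (f i) \<le> r" unfolding j_def using not_less_Least[of i "\<lambda>j. real (f j) \<le> r"] by auto
    moreover have "f i \<le> f j + pcard p (shift d Y - Y)"
    proof -
      have "Y \<inter> shift (int i * d) Y \<subseteq> (Y \<inter> shift (int j * d) Y) \<union> shift (int i * d) (Y - shift d Y)"
        by (auto simp: Suc algebra_simps)
      then have "f i \<le> f j + pcard p (shift (int i * d) (Y - shift d Y))"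
        unfolding f_def using pcard_mono pcard_Un_le order_trans by metis
      also have "pcard p (shift (int i * d) (Y - shift d Y)) = pcard p (Y - shift d Y)"
        using assms(2) p by (intro pcard_shift) auto
      finally show ?thesis using pcard_shift_Diff_sym[OF p assms(2)] by simp
    qed
    ultimately show ?thesis by linarith
  qed
  then show ?thesis using that j unfolding f_def by blast
qed

definition setting :: "real \<Rightarrow> real \<Rightarrow> int \<Rightarrow> int set \<Rightarrow> int set \<Rightarrow> bool" where
  "setting \<beta> K p A B \<longleftrightarrow> prime p \<and> periodic p A \<and> periodic p B \<and> A \<noteq> {} \<and> B \<noteq> {} \<and>
     real (pcard p A) \<le> K * pcard p B \<and> real (pcard p B) \<le> K * pcard p A \<and>
     real (pcard p A) + real (pcard p B) \<le> (1 - \<beta>) * p"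

text \<open>One intersection Y \<inter> (Y + y) can steer the size anywhere down to about (1 -
  \<beta>/2) |Y|, because |Y| \<le> (1 - \<beta>) p keeps the average overlap below that; hence k
  rounds for a target above (1 - \<beta>/2)^k |B|. Each round worsens the accuracy, so k is fixed
  before \<epsilon>0 and the induction passes the accuracy demanded at the end back to B.\<close>

lemma ex_tight_subset:
  fixes \<beta> K \<epsilon> :: real
  assumes "0 < \<beta>" "\<beta> \<le> 1" "1 \<le> K" "0 < \<epsilon>"
  shows "\<exists>\<epsilon>0::real. 0 < \<epsilon>0 \<and> (\<forall>p A B d (r::real). setting \<beta> K p A B \<longrightarrow> 1 \<le> \<epsilon>0 * pcard p A \<longrightarrow> tight p A \<epsilon>0 B \<longrightarrow> \<not> p dvd d \<longrightarrow>
     real (pcard p (shift d B - B)) \<le> \<epsilon>0 * pcard p A \<longrightarrow>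
     (1 - \<beta> / 2) ^ k * pcard p B \<le> r \<longrightarrow> r \<le> pcard p B \<longrightarrow>
     (\<exists>Y. periodic p Y \<and> Y \<subseteq> B \<and> r - \<epsilon> * pcard p A \<le> pcard p Y \<and> pcard p Y \<le> r \<and> tight p A \<epsilon> Y \<and>
       real (pcard p (shift d Y - Y)) \<le> \<epsilon> * pcard p A))"
  using assms(4)
proof (induction k arbitrary: \<epsilon>)
  case 0
  show ?case
  proof (intro exI[of _ \<epsilon>] conjI allI impI)
    fix p A B d and r :: real
    assume *: "setting \<beta> K p A B" "tight p A \<epsilon> B" "real (pcard p (shift d B - B)) \<le> \<epsilon> * pcard p A"
      "(1 - \<beta> / 2) ^ 0 * pcard p B \<le> r" "r \<le> pcard p B"
    have "0 \<le> \<epsilon> * pcard p A" using 0 by simp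
    then show "\<exists>Y. periodic p Y \<and> Y \<subseteq> B \<and> r - \<epsilon> * pcard p A \<le> pcard p Y \<and> pcard p Y \<le> r \<and> tight p A \<epsilon> Y \<and>
       real (pcard p (shift d Y - Y)) \<le> \<epsilon> * pcard p A"
      using * by (intro exI[of _ B]) (auto simp: setting_def)
  qed (use 0 in auto)
next
  case (Suc k)
  \<comment> \<open>\<open>robust_lower\<close> turns an error of \<delta>^2 n per translate into a
    loss of order \<delta> n, so the preceding rounds must be accurate to about the square of what
    this round has to deliver.\<close>
  define \<delta> where "\<delta> = min 1 (\<epsilon> / (4 * (1 + 2 * K)))"
  define \<epsilon>' where "\<epsilon>' = min (\<delta>\<^sup>2) (min (\<epsilon> / 8) (\<beta> / 4))"
  have d0: "0 < \<delta>" "\<delta> \<le> 1" "\<delta> \<le> \<epsilon> / (4 * (1 + 2 * K))" using Suc.prems assms by (auto simp: \<delta>_def)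
  have e0: "0 < \<epsilon>'" "\<epsilon>' \<le> \<delta>\<^sup>2" "\<epsilon>' \<le> \<epsilon> / 8" "\<epsilon>' \<le> \<beta> / 4" using Suc.prems assms d0 by (auto simp: \<epsilon>'_def)
  from Suc.IH[OF e0(1)] obtain \<epsilon>1 :: real where \<epsilon>1: "0 < \<epsilon>1" and IH: "\<And>p A B d (r::real). setting \<beta> K p A B \<Longrightarrow> 1 \<le> \<epsilon>1 * pcard p A \<Longrightarrow> tight p A \<epsilon>1 B \<Longrightarrow> \<not> p dvd d \<Longrightarrow>
     real (pcard p (shift d B - B)) \<le> \<epsilon>1 * pcard p A \<Longrightarrow>
     (1 - \<beta> / 2) ^ k * pcard p B \<le> r \<Longrightarrow> r \<le> pcard p B \<Longrightarrow>
     (\<exists>Y. periodic p Y \<and> Y \<subseteq> B \<and> r - \<epsilon>' * pcard p A \<le> pcard p Y \<and> pcard p Y \<le> r \<and> tight p A \<epsilon>' Y \<and>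
       real (pcard p (shift d Y - Y)) \<le> \<epsilon>' * pcard p A)" by meson
  define \<epsilon>0 where "\<epsilon>0 = min \<epsilon>1 (\<epsilon> / 8)"
  show ?case
  proof (intro exI[of _ \<epsilon>0] conjI allI impI)
    show "0 < \<epsilon>0" using \<epsilon>1 Suc.prems by (simp add: \<epsilon>0_def)
    fix p A B d and r :: real
    assume st: "setting \<beta> K p A B" and n1: "1 \<le> \<epsilon>0 * pcard p A" and ti: "tight p A \<epsilon>0 B" and dd: "\<not> p dvd d"
      and inv: "real (pcard p (shift d B - B)) \<le> \<epsilon>0 * pcard p A"
      and r: "(1 - \<beta> / 2) ^ Suc k * pcard p B \<le> r" "r \<le> pcard p B"
    have pr: "prime p" and perA: "periodic p A" and perB: "periodic p B" and A0: "A \<noteq> {}" and B0: "B \<noteq> {}"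
      and mn: "real (pcard p B) \<le> K * pcard p A" and nmp: "real (pcard p A) + real (pcard p B) \<le> (1 - \<beta>) * p"
      using st by (auto simp: setting_def)
    have p: "p > 0" using pr prime_gt_0_int by blast
    define n where "n = pcard p A"
    define m where "m = pcard p B"
    have le0: "\<epsilon>0 * n \<le> \<epsilon>1 * n" "\<epsilon>0 * n \<le> \<epsilon> / 8 * n" "\<epsilon>' * n \<le> \<epsilon> / 8 * n" "\<epsilon>' * n \<le> \<beta> / 4 * n"
      by (rule mult_right_mono; use e0 in \<open>simp add: \<epsilon>0_def\<close>)+
    have q: "0 < 1 - \<beta> / 2" using assms by simp
    \<comment> \<open>The target for the preceding rounds, from which one more intersection reaches
      r; the cap keeps it at most |B|.\<close>
    define r' where "r' = min m (r / (1 - \<beta> / 2))"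
    have r0: "0 \<le> r" using r q by (meson order_trans zero_le_mult_iff zero_le_power of_nat_0_le_iff less_imp_le)
    have r'1: "r' \<le> m" by (simp add: r'_def)
    have r'2: "(1 - \<beta> / 2) * r' \<le> r" using q by (simp add: r'_def min_def field_simps)
    have r'3: "r \<le> r'"
    proof -
      have "r * (1 - \<beta> / 2) \<le> r" using r0 assms by (intro mult_left_le) auto
      then show ?thesis using q r by (simp add: r'_def m_def field_simps)
    qed
    have r'4: "(1 - \<beta> / 2) ^ k * m \<le> r'"
    proof -
      have "(1 - \<beta> / 2) ^ k \<le> 1" using assms by (intro power_le_one) auto
      then have "(1 - \<beta> / 2) ^ k * m \<le> m" by (intro mult_left_le_one_le) (use q in auto)
      then show ?thesis using q r by (simp add: r'_def m_def field_simps)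
    qed
    obtain Y where Y: "periodic p Y" "Y \<subseteq> B" "r' - \<epsilon>' * n \<le> pcard p Y" "pcard p Y \<le> r'" "tight p A \<epsilon>' Y"
        "real (pcard p (shift d Y - Y)) \<le> \<epsilon>' * n"
      using IH[OF st _ tight_mono[OF ti] dd, of r'] n1 inv le0 r'1 r'4 unfolding n_def m_def
      by (auto simp: \<epsilon>0_def)
    show "\<exists>Y. periodic p Y \<and> Y \<subseteq> B \<and> r - \<epsilon> * pcard p A \<le> pcard p Y \<and> pcard p Y \<le> r \<and> tight p A \<epsilon> Y \<and>
       real (pcard p (shift d Y - Y)) \<le> \<epsilon> * pcard p A"
    proof (cases "pcard p Y \<le> r")
      case True
      have "tight p A \<epsilon> Y" using Y(5) by (rule tight_mono) (use e0 Suc.prems in auto)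
      moreover have "\<epsilon> / 8 * n \<le> \<epsilon> * n" using Suc.prems by (intro mult_right_mono) auto
      ultimately show ?thesis using Y True le0 r'3 unfolding n_def[symmetric]
        by (intro exI[of _ Y]) (auto simp: algebra_simps)
    next
      case False
      have "real (pcard p Y ^ 2) \<le> p * r"
      proof -
        have "real (pcard p Y) \<le> (1 - \<beta>) * p" using pcard_mono[OF Y(2), of p] nmp by linarith
        then have "real (pcard p Y ^ 2) \<le> ((1 - \<beta>) * p) * r'"
          unfolding power2_eq_square of_nat_mult using Y(4) assms p by (intro mult_mono) auto
        also have "\<dots> \<le> p * ((1 - \<beta> / 2) * r')"
          using assms p r0 r'3 by (simp add: algebra_simps)
        also have "\<dots> \<le> p * r" using r'2 p by (intro mult_left_mono) auto
        finally show ?thesis .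
      qed
      with False obtain y where y: "pcard p (Y \<inter> shift y Y) \<le> r" "r \<le> pcard p (Y \<inter> shift y Y) + real (pcard p (shift d Y - Y))"
        using ex_overlap_near[OF pr Y(1) dd, of r] by (metis less_imp_le not_le)
      have un: "pcard p (Y \<union> shift y Y) + pcard p (Y \<inter> shift y Y) = 2 * pcard p Y"
        using pcard_Un_Int[of p Y "shift y Y"] p Y(1) by simp
      have "Y \<noteq> {}" using False r0 by auto
      have ti1: "tight p A \<epsilon> (Y \<inter> shift y Y)"
      proof (rule tight_Int_shift[OF pr perA Y(1) A0 \<open>Y \<noteq> {}\<close> Y(5) d0(1,2)])
        show "1 \<le> 2 * K" "\<epsilon>' \<le> \<delta>\<^sup>2" using assms e0 by auto
        have "real (pcard p (Y \<union> shift y Y)) \<le> 2 * real (pcard p Y)" using un by simp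
        also have "\<dots> \<le> 2 * m" using Y r'1 by simp
        finally show "real (pcard p (Y \<union> shift y Y)) \<le> 2 * K * pcard p A" using mn m_def by simp
        \<comment> \<open>The union of Y and Y + y has to leave room next to A. It exceeds m by at
          most r' - r \<le> \<beta>/2 m and a small error, which the free room \<beta> p
          absorbs.\<close>
        have "real (pcard p (Y \<union> shift y Y)) \<le> m + (r' - r) + \<epsilon>' * n" using un y Y r'1 by linarith
        moreover have "r' - r \<le> \<beta> / 2 * m"
        proof -
          have "r' - r \<le> \<beta> / 2 * r'" using r'2 by (simp add: algebra_simps)
          also have "\<dots> \<le> \<beta> / 2 * m" using r'1 assms by (intro mult_left_mono) auto
          finally show ?thesis .
        qed
        moreover have "\<beta> / 2 * m \<le> \<beta> / 2 * p" "\<beta> / 4 * n \<le> \<beta> / 4 * p"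
          using assms p pcard_le[of p A] pcard_le[of p B] unfolding n_def m_def by (intro mult_left_mono; linarith)+
        moreover have "0 \<le> \<beta> * p" using assms p by simp
        ultimately have "real (n + pcard p (Y \<union> shift y Y)) \<le> p"
          using nmp le0 unfolding n_def[symmetric] m_def[symmetric] by (simp add: algebra_simps)
        then show "pcard p A + pcard p (Y \<union> shift y Y) \<le> nat p" using p n_def by linarith
        have "(1 + 2 * K) * \<delta> * n \<le> \<epsilon> / 4 * n"
          using d0 assms by (intro mult_right_mono) (auto simp: field_simps)
        moreover have "1 \<le> \<epsilon> / 8 * n" using n1 le0 n_def by simp
        moreover have "2 * \<epsilon>' * n \<le> \<epsilon> / 4 * n" using le0 by simp
        moreover have "0 \<le> \<epsilon> * n" using Suc.prems by simp
        ultimately show "2 * \<epsilon>' * pcard p A + (1 + 2 * K) * \<delta> * pcard p A + 1 \<le> \<epsilon> * pcard p A"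
          unfolding n_def[symmetric] by (simp add: algebra_simps)
      qed
      have "pcard p (shift d (Y \<inter> shift y Y) - (Y \<inter> shift y Y)) \<le> pcard p (shift d Y - Y) + pcard p (shift d Y - Y)"
      proof -
        have "shift d (Y \<inter> shift y Y) - (Y \<inter> shift y Y) \<subseteq> (shift d Y - Y) \<union> shift y (shift d Y - Y)"
          by (auto simp: algebra_simps)
        moreover have "pcard p (shift y (shift d Y - Y)) = pcard p (shift d Y - Y)"
          using p Y(1) by (intro pcard_shift) auto
        ultimately show ?thesis using pcard_mono pcard_Un_le order_trans by metis
      qed
      moreover have "0 \<le> \<epsilon> * n" using Suc.prems by simp
      ultimately show ?thesis using ti1 y Y le0 unfolding n_def[symmetric]
        by (intro exI[of _ "Y \<inter> shift y Y"]) (auto simp: algebra_simps)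
    qed
  qed
qed

text \<open>Take Y of size about s from \<open>ex_tight_subset\<close>, with its witness S. For b,
  b' in Y the translates A + b and A + b' both almost lie in S, so their union has at most about n +
  |Y| elements, and the difference b - b' moves at most s elements of A. By Cauchy-Davenport there
  are at least 2 |Y| - 1 such differences.\<close>

lemma defect_balls_large:
  fixes \<beta> K \<epsilon> :: real
  assumes "0 < \<beta>" "\<beta> \<le> 1" "1 \<le> K" "0 < \<epsilon>"
  shows "\<exists>\<epsilon>0::real. 0 < \<epsilon>0 \<and> (\<forall>p A B d (s::real). setting \<beta> K p A B \<longrightarrow> 1 \<le> \<epsilon>0 * pcard p A \<longrightarrow> tight p A \<epsilon>0 B \<longrightarrow> \<not> p dvd d \<longrightarrow>
     real (pcard p (shift d B - B)) \<le> \<epsilon>0 * pcard p A \<longrightarrow> s \<le> pcard p B \<longrightarrow> 2 * s \<le> pcard p A \<longrightarrow>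
     2 * s - \<epsilon> * pcard p A \<le> pcard p {x. pcard p (shift x A - A) \<le> s})"
proof -
  define \<epsilon>1 where "\<epsilon>1 = \<epsilon> / 16"
  have \<epsilon>1: "\<epsilon>1 > 0" using assms by (simp add: \<epsilon>1_def)
  have "0 < \<epsilon> / (4 * K)" using assms by simp
  \<comment> \<open>Enough rounds to reach sizes of \<epsilon>/4 n; for s \<le> \<epsilon>/2 n the
    claimed lower bound is not positive.\<close>
  then obtain k where k: "(1 - \<beta> / 2) ^ k < \<epsilon> / (4 * K)" using real_arch_pow_inv[of "\<epsilon> / (4 * K)" "1 - \<beta> / 2"] assms by auto
  obtain \<epsilon>2 :: real where \<epsilon>2: "0 < \<epsilon>2" and sh: "\<And>p A B d (r::real). setting \<beta> K p A B \<Longrightarrow> 1 \<le> \<epsilon>2 * pcard p A \<Longrightarrow> tight p A \<epsilon>2 B \<Longrightarrow> \<not> p dvd d \<Longrightarrow>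
     real (pcard p (shift d B - B)) \<le> \<epsilon>2 * pcard p A \<Longrightarrow>
     (1 - \<beta> / 2) ^ k * pcard p B \<le> r \<Longrightarrow> r \<le> pcard p B \<Longrightarrow>
     (\<exists>Y. periodic p Y \<and> Y \<subseteq> B \<and> r - \<epsilon>1 * pcard p A \<le> pcard p Y \<and> pcard p Y \<le> r \<and> tight p A \<epsilon>1 Y \<and>
       real (pcard p (shift d Y - Y)) \<le> \<epsilon>1 * pcard p A)" using ex_tight_subset[OF assms(1-3) \<epsilon>1, of k] by meson
  define \<epsilon>0 where "\<epsilon>0 = min \<epsilon>1 \<epsilon>2"
  show ?thesis
  proof (intro exI[of _ \<epsilon>0] conjI allI impI)
    show "0 < \<epsilon>0" using \<epsilon>1 \<epsilon>2 by (simp add: \<epsilon>0_def)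
    fix p A B d and s :: real
    assume st: "setting \<beta> K p A B" and n1: "1 \<le> \<epsilon>0 * pcard p A" and ti: "tight p A \<epsilon>0 B" and dd: "\<not> p dvd d"
      and inv: "real (pcard p (shift d B - B)) \<le> \<epsilon>0 * pcard p A"
      and s: "s \<le> pcard p B" "2 * s \<le> pcard p A"
    have pr: "prime p" and perA: "periodic p A" and perB: "periodic p B" and A0: "A \<noteq> {}" and B0: "B \<noteq> {}"
      and mn: "real (pcard p B) \<le> K * pcard p A" and nmp: "real (pcard p A) + real (pcard p B) \<le> (1 - \<beta>) * p"
      using st by (auto simp: setting_def)
    have p: "p > 0" using pr prime_gt_0_int by blast
    define n where "n = pcard p A"
    define m where "m = pcard p B"
    have le0: "\<epsilon>0 * n \<le> \<epsilon>1 * n" "\<epsilon>0 * n \<le> \<epsilon>2 * n" by (auto simp: \<epsilon>0_def intro!: mult_right_mono)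
    show "2 * s - \<epsilon> * pcard p A \<le> pcard p {x. pcard p (shift x A - A) \<le> s}"
    proof (cases "s \<le> \<epsilon> / 2 * n")
      case True
      then have "2 * s - \<epsilon> * n \<le> 0" by simp
      then show ?thesis unfolding n_def by linarith
    next
      case False
      \<comment> \<open>Three errors \<epsilon>1 n enter for a difference: one from each of the two
        translates and one from the size of S.\<close>
      define r where "r = s - 3 * \<epsilon>1 * n"
      have "(1 - \<beta> / 2) ^ k * m \<le> \<epsilon> / (4 * K) * m" using k by (intro mult_right_mono) auto
      also have "\<dots> \<le> \<epsilon> / (4 * K) * (K * n)" using mn assms by (intro mult_left_mono) (auto simp: n_def m_def)
      also have "\<dots> = \<epsilon> / 4 * n" using assms by simp
      also have "\<dots> \<le> r"
      proof -
        have "0 \<le> \<epsilon> * n" using assms by simp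
        then show ?thesis using False unfolding r_def \<epsilon>1_def by (simp add: algebra_simps)
      qed
      finally have r1: "(1 - \<beta> / 2) ^ k * m \<le> r" .
      have e1n: "0 \<le> \<epsilon>1 * n" using \<epsilon>1 by simp
      have r2: "r \<le> m" using s e1n unfolding r_def m_def by linarith
      obtain Y where Y: "periodic p Y" "r - \<epsilon>1 * n \<le> pcard p Y" "pcard p Y \<le> r" "tight p A \<epsilon>1 Y"
        using sh[OF st _ tight_mono[OF ti] dd, of r] n1 inv le0 r1 r2 unfolding n_def m_def by (auto simp: \<epsilon>0_def)
      obtain S where S: "periodic p S" "\<And>b. b \<in> Y \<Longrightarrow> real (pcard p (shift b A - S)) \<le> \<epsilon>1 * n"
        "real (pcard p S) \<le> n + pcard p Y + \<epsilon>1 * n" using tightE[OF Y(4)] unfolding n_def by metis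
      define D where "D = {x. \<exists>b\<in>Y. x - b \<in> {z. - z \<in> Y}}"
      have "D \<subseteq> {x. pcard p (shift x A - A) \<le> s}"
      proof
        fix x assume "x \<in> D"
        then obtain b b' where b: "b \<in> Y" "b' \<in> Y" "x = b - b'" unfolding D_def by (auto intro: that[of _ "_ - x"])
        have "shift b' (shift x A - A) = shift b A - shift b' A" by (simp add: shift_Diff b)
        moreover have "pcard p (shift b' (shift x A - A)) = pcard p (shift x A - A)" using p perA by (intro pcard_shift) auto
        ultimately have "pcard p (shift x A - A) = pcard p (shift b A - shift b' A)" by simp
        moreover have "pcard p (shift b A - shift b' A) + n = pcard p (shift b A \<union> shift b' A)"
          using pcard_Diff_Un[of p "shift b A" "shift b' A"] p perA n_def by simp
        moreover have "shift b A \<union> shift b' A \<subseteq> S \<union> ((shift b A - S) \<union> (shift b' A - S))" by auto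
        then have "pcard p (shift b A \<union> shift b' A) \<le> pcard p S + (pcard p (shift b A - S) + pcard p (shift b' A - S))"
          by (meson pcard_mono pcard_Un_le order_trans add_left_mono)
        ultimately have "real (pcard p (shift x A - A)) \<le> pcard p Y + 3 * (\<epsilon>1 * n)"
          using S(2)[OF b(1)] S(2)[OF b(2)] S(3) by linarith
        then show "x \<in> {x. pcard p (shift x A - A) \<le> s}" using Y(3) by (simp add: r_def)
      qed
      then have "pcard p D \<le> pcard p {x. pcard p (shift x A - A) \<le> s}" by (rule pcard_mono)
      moreover have "2 * pcard p Y \<le> pcard p D + 1"
      proof -
        have Y0: "pcard p Y \<ge> 1 \<or> pcard p Y = 0" by linarith
        have perY: "periodic p {z. - z \<in> Y}"
          unfolding periodic_def using Y(1) unfolding periodic_def by (metis (no_types, lifting) add.inverse_inverse diff_add_cancel mem_Collect_eq minus_add_distrib uminus_add_conv_diff add.commute)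
        have cY: "pcard p {z. - z \<in> Y} = pcard p Y" using pcard_reflect[OF p Y(1), of 0] by simp
        have "2 * real (pcard p Y) \<le> n" using Y(3) s e1n unfolding r_def n_def by linarith
        then have "pcard p Y + pcard p Y \<le> nat p + 1" using pcard_le[of p A] n_def by linarith
        moreover have "pcard p (shift w {z. - z \<in> Y} - D) = 0" if "w \<in> Y" for w
        proof -
          have "shift w {z. - z \<in> Y} - D = {}" using that by (auto simp: D_def)
          then show ?thesis by (simp only: pcard_empty)
        qed
        ultimately show ?thesis using pollard_robust[OF pr perY Y(1), of 1 D] cY Y0 by auto
      qed
      moreover have "\<epsilon> * n = 16 * (\<epsilon>1 * n)" by (simp add: \<epsilon>1_def)
      moreover have "1 \<le> \<epsilon>1 * n" using n1 le0 n_def by simp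
      ultimately show ?thesis using Y(2) unfolding r_def n_def[symmetric] by linarith
    qed
  qed
qed

subsection \<open>Translations that almost fix A\<close>

text \<open>For periodic A this is half the size of the symmetric difference of A and A + x, hence a
  symmetric and subadditive length on translations.\<close>

definition defect :: "int \<Rightarrow> int set \<Rightarrow> int \<Rightarrow> nat" where
  "defect p A x = pcard p (shift x A - A)"

definition defect_ball :: "int \<Rightarrow> int set \<Rightarrow> nat \<Rightarrow> int set" where
  "defect_ball p A r = {x. defect p A x \<le> r}"

lemma periodic_defect_ball: "periodic p A \<Longrightarrow> periodic p (defect_ball p A r)"
  unfolding defect_ball_def defect_def by (rule periodic_translates_mem_cong)

lemma defect_0 [simp]: "defect p A 0 = 0"
  by (simp add: defect_def)

lemma defect_minus:
  assumes "p > 0" "periodic p A" shows "defect p A (- x) = defect p A x"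
proof -
  have "pcard p (shift (- x) A - A) = pcard p (shift x (shift (- x) A - A))"
    using assms by (intro pcard_shift[symmetric]) auto
  also have "shift x (shift (- x) A - A) = A - shift x A" by (simp add: shift_Diff)
  finally show ?thesis unfolding defect_def using pcard_shift_Diff_sym[OF assms] by simp
qed

lemma defect_add_le:
  assumes "p > 0" "periodic p A" shows "defect p A (x + y) \<le> defect p A x + defect p A y"
proof -
  have "shift (x + y) A - A \<subseteq> (shift x A - A) \<union> shift x (shift y A - A)" by (auto simp: algebra_simps)
  moreover have "pcard p (shift x (shift y A - A)) = pcard p (shift y A - A)"
    using assms by (intro pcard_shift) auto
  ultimately show ?thesis unfolding defect_def using pcard_mono pcard_Un_le order_trans by metis
qed

lemma defect_Int:
  assumes "p > 0" "periodic p A"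
  shows "defect p A x + pcard p (A \<inter> shift x A) = pcard p A"
  using pcard_Diff_Int[of p "shift x A" A] assms by (simp add: defect_def Int_commute)

text \<open>Pollard's theorem for $A$ and a ball $U$ of size $u$ bounds the sum of the defects over $U$
  from below by about $u^2/4$; the lower bounds on the smaller balls bound it from above.\<close>

lemma defect_ball_upper:
  fixes e :: real
  assumes "prime p" "periodic p A" "\<And>k. k < r \<Longrightarrow> 2 * real k - e \<le> pcard p (defect_ball p A k)" "0 \<le> e"
    "4 * r + 2 \<le> pcard p A" "pcard p A + (4 * r + 2) \<le> nat p"
  shows "(real (pcard p (defect_ball p A r)) / 2 - r)\<^sup>2 \<le> r * (1 + e) + 1"
proof -
  have p: "p > 0" using assms(1) prime_gt_0_int by blast
  define n where "n = pcard p A"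
  \<comment> \<open>Pollard's theorem for A and W with t about |W|/2, measured against A itself, so
    that the errors are exactly the defects.\<close>
  have key: "t * (pcard p W - t) \<le> (\<Sum>w\<in>W \<inter> {0..<p}. defect p A w)"
    if W: "periodic p W" "pcard p W \<le> 4 * r + 2" and t: "t = pcard p W div 2" for W t
  proof -
    have "t * (n + pcard p W) \<le> t * n + t * t + (\<Sum>w\<in>W \<inter> {0..<p}. defect p A w)"
      using pollard_robust[OF assms(1,2) W(1), of t A] t W(2) assms(5,6) by (simp add: n_def defect_def)
    then show ?thesis using t by (simp add: algebra_simps diff_mult_distrib2)
  qed
  define U where "U = defect_ball p A r"
  have perU: "periodic p U" unfolding U_def by (rule periodic_defect_ball[OF assms(2)])
  \<comment> \<open>A first crude bound, so that \<open>key\<close> applies to the whole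
    ball.\<close>
  have u: "pcard p U \<le> 4 * r + 1"
  proof (rule ccontr)
    assume "\<not> ?thesis"
    then obtain W where W: "W \<subseteq> U" "periodic p W" "pcard p W = 4 * r + 2"
      using ex_periodic_subset[OF p perU, of "4 * r + 2"] by auto
    have "(2 * r + 1) * (2 * r + 1) \<le> (\<Sum>w\<in>W \<inter> {0..<p}. defect p A w)"
      using key[OF W(2), of "2 * r + 1"] W(3) by simp
    also have "\<dots> \<le> (\<Sum>w\<in>W \<inter> {0..<p}. r)"
      using W(1) by (intro sum_mono) (auto simp: U_def defect_ball_def)
    also have "\<dots> = (4 * r + 2) * r" using W(3) by (simp add: pcard_def)
    finally show False by (simp add: algebra_simps)
  qed
  define u where "u = pcard p U"
  define t where "t = u div 2"
  have "t * (u - t) \<le> (\<Sum>w\<in>U \<inter> {0..<p}. defect p A w)"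
    using key[OF perU _ t_def[unfolded u_def]] u by (simp add: u_def)
  \<comment> \<open>Each defect is the number of k below it; exchanging the sums turns their total
    into the sum over k < r of u minus the size of the ball of radius k, where the lower bounds
    enter.\<close>
  also have "(\<Sum>w\<in>U \<inter> {0..<p}. defect p A w) = (\<Sum>w\<in>U \<inter> {0..<p}. \<Sum>k<r. of_bool (k < defect p A w))"
  proof (intro sum.cong refl)
    fix w assume "w \<in> U \<inter> {0..<p}"
    then have "defect p A w \<le> r" by (simp add: U_def defect_ball_def)
    then have "{..<r} \<inter> {k. k < defect p A w} = {..<defect p A w}" by auto
    then show "defect p A w = (\<Sum>k<r. of_bool (k < defect p A w))" by simp
  qed
  also have "\<dots> = (\<Sum>k<r. \<Sum>w\<in>U \<inter> {0..<p}. of_bool (k < defect p A w))" by (rule sum.swap)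
  also have "\<dots> = (\<Sum>k<r. u - pcard p (defect_ball p A k))"
  proof (intro sum.cong refl)
    fix k assume "k \<in> {..<r}"
    then have "defect_ball p A k \<subseteq> U" by (auto simp: U_def defect_ball_def)
    then have "defect_ball p A k = U \<inter> defect_ball p A k" by auto
    then have "u - pcard p (defect_ball p A k) = pcard p (U - defect_ball p A k)"
      using pcard_Diff_Int[of p U "defect_ball p A k"] u_def by simp
    also have "\<dots> = (\<Sum>w\<in>U \<inter> {0..<p}. of_bool (k < defect p A w))"
      by (auto simp: pcard_def defect_ball_def not_le intro!: arg_cong[where f = card])
    finally show "(\<Sum>w\<in>U \<inter> {0..<p}. of_bool (k < defect p A w)) = u - pcard p (defect_ball p A k)" ..
  qed
  finally have "real (t * (u - t)) \<le> (\<Sum>k<r. real (u - pcard p (defect_ball p A k)))"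
    by (simp only: of_nat_le_iff flip: of_nat_sum)
  also have "\<dots> \<le> (\<Sum>k<r. real u - 2 * real k + e)"
  proof (intro sum_mono)
    fix k assume "k \<in> {..<r}"
    then have "defect_ball p A k \<subseteq> U" by (auto simp: U_def defect_ball_def)
    then have "pcard p (defect_ball p A k) \<le> u" unfolding u_def by (rule pcard_mono)
    then show "real (u - pcard p (defect_ball p A k)) \<le> real u - 2 * real k + e"
      using assms(3)[of k] \<open>k \<in> {..<r}\<close> by (simp add: of_nat_diff)
  qed
  also have "\<dots> = r * real u - r * (real r - 1) + r * e"
    by (induction r) (auto simp: algebra_simps)
  finally have "real t * (real u - real t) \<le> r * real u - r * (real r - 1) + r * e"
    by (simp add: t_def of_nat_diff)
  moreover have "(real u * real u - 1) / 4 \<le> real t * (real u - real t)"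
  proof -
    consider "u = 2 * t" | "u = 2 * t + 1" unfolding t_def by linarith
    then show ?thesis by cases (auto simp: algebra_simps)
  qed
  ultimately have *: "(real u * real u - 1) / 4 \<le> r * real u - r * (real r - 1) + r * e" by linarith
  \<comment> \<open>Completing the square shows that u exceeds 2 r at most by an amount of order
    sqrt (r (1 + e) + 1).\<close>
  have "(real u / 2 - r)\<^sup>2 = (real u * real u - 1) / 4 + 1 / 4 - r * real u + real r * real r"
    by (simp add: power2_eq_square field_simps)
  also have "\<dots> \<le> r * (1 + e) + 1" using * by (simp add: algebra_simps)
  finally show ?thesis by (simp add: u_def U_def)
qed

subsection \<open>A frequency concentrating a ball\<close>

text \<open>\<open>cosp\<close> and \<open>sinp\<close> are the real and imaginary part of the
  additive character exp(2 \<pi> i x / p). Real arithmetic suffices, since only squared moduli of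
  Fourier coefficients occur.\<close>

definition cosp :: "int \<Rightarrow> int \<Rightarrow> real" where "cosp p x = cos (2 * pi * x / p)"
definition sinp :: "int \<Rightarrow> int \<Rightarrow> real" where "sinp p x = sin (2 * pi * x / p)"

lemma cosp_sinp_add_mult:
  assumes "p > 0" shows "cosp p (x + k * p) = cosp p x" "sinp p (x + k * p) = sinp p x"
proof -
  have "2 * pi * real_of_int (x + k * p) / p = 2 * pi * x / p + of_int k * (2 * pi)"
    using assms by (simp add: field_simps)
  then show "cosp p (x + k * p) = cosp p x" "sinp p (x + k * p) = sinp p x"
    unfolding cosp_def sinp_def using cos_int_2pin[of k] sin_int_2pin[of k]
    by (simp_all add: cos_add sin_add mult_ac)
qed

lemma cosp_cong: assumes "p > 0" "[x = y] (mod p)" shows "cosp p x = cosp p y"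
  and sinp_cong: "sinp p x = sinp p y"
proof -
  obtain k where "x = y + k * p" using assms(2) by (auto simp: cong_iff_dvd_diff dvd_def algebra_simps)
  then show "cosp p x = cosp p y" "sinp p x = sinp p y" using cosp_sinp_add_mult[OF assms(1)] by simp_all
qed

text \<open>Increasing the summation variable by one permutes the residues but rotates the vector of
  the cosine and sine sums by the angle 2 \<pi> k / p. If p does not divide k, this rotation is not
  the identity and fixes only the zero vector.\<close>

lemma sum_cosp:
  assumes "prime p"
  shows "(\<Sum>z\<in>{0..<p}. cosp p (z * k)) = (if p dvd k then of_int p else 0)"
proof -
  have p: "p > 0" using assms prime_gt_0_int by blast
  show ?thesis
  proof (cases "p dvd k")
    case True
    then have "cosp p (z * k) = 1" for z
      using cosp_cong[OF p, of "z * k" 0] by (simp add: cong_0_iff) (simp add: cosp_def)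
    then show ?thesis using True p by simp
  next
    case False
    define S where "S = (\<Sum>z\<in>{0..<p}. cosp p (z * k))"
    define T where "T = (\<Sum>z\<in>{0..<p}. sinp p (z * k))"
    define c where "c = cosp p k"
    define s where "s = sinp p k"
    have add: "cosp p (z * k + k) = cosp p (z * k) * c - sinp p (z * k) * s"
       "sinp p (z * k + k) = sinp p (z * k) * c + cosp p (z * k) * s" for z
      unfolding cosp_def sinp_def c_def s_def by (simp_all add: add_divide_distrib distrib_left cos_add sin_add)
    have "S = (\<Sum>z\<in>{0..<p}. cosp p (((1 * z + 1) mod p) * k))"
      unfolding S_def by (rule sum_affine_mod[OF p, symmetric]) simp
    also have "\<dots> = (\<Sum>z\<in>{0..<p}. cosp p (z * k + k))"
      by (intro sum.cong refl cosp_cong[OF p]) (simp add: cong_def mod_mult_left_eq distrib_right)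
    also have "\<dots> = S * c - T * s" by (simp add: add sum_subtractf sum_distrib_right S_def T_def)
    finally have 1: "S = S * c - T * s" .
    have "T = (\<Sum>z\<in>{0..<p}. sinp p (((1 * z + 1) mod p) * k))"
      unfolding T_def by (rule sum_affine_mod[OF p, symmetric]) simp
    also have "\<dots> = (\<Sum>z\<in>{0..<p}. sinp p (z * k + k))"
      by (intro sum.cong refl sinp_cong[OF p]) (simp add: cong_def mod_mult_left_eq distrib_right)
    also have "\<dots> = T * c + S * s" by (simp add: add sum.distrib sum_distrib_right S_def T_def)
    finally have 2: "T = T * c + S * s" .
    have cs: "c\<^sup>2 + s\<^sup>2 = 1" by (simp add: c_def s_def cosp_def sinp_def)
    have "c \<noteq> 1"
    proof
      assume "c = 1"
      then obtain j :: int where "2 * pi * k / p = j * 2 * pi"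
        unfolding c_def cosp_def cos_one_2pi_int by auto
      then have "real_of_int k = real_of_int (j * p)" using p by (simp add: field_simps)
      then have "k = j * p" by (simp only: of_int_eq_iff)
      then show False using False by simp
    qed
    have "S * (1 - c) = - T * s" using 1 by (simp add: algebra_simps)
    then have "S * (1 - c) * (1 - c) = - (T * (1 - c)) * s" by simp
    also have "T * (1 - c) = S * s" using 2 by (simp add: algebra_simps)
    finally have "S * (1 - c) * (1 - c) + S * s * s = 0" by simp
    then have "S * ((1 - c)\<^sup>2 + s\<^sup>2) = 0" by (simp only: power2_eq_square distrib_left mult.assoc)
    moreover have "(1 - c)\<^sup>2 + s\<^sup>2 = 2 * (1 - c)" using cs by (simp add: power2_eq_square algebra_simps)
    ultimately have "S = 0" using \<open>c \<noteq> 1\<close> by simp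
    then show ?thesis using False by (simp add: S_def)
  qed
qed

text \<open>The squared modulus of the Fourier coefficient of A at the frequency z.\<close>

definition spec :: "int \<Rightarrow> int set \<Rightarrow> int \<Rightarrow> real" where
  "spec p A z = (\<Sum>a\<in>A \<inter> {0..<p}. cosp p (z * a))\<^sup>2 + (\<Sum>a\<in>A \<inter> {0..<p}. sinp p (z * a))\<^sup>2"

lemma spec_nonneg: "0 \<le> spec p A z"
  by (simp add: spec_def)

lemma spec_0: "spec p A 0 = (real (pcard p A))\<^sup>2"
  by (simp add: spec_def cosp_def sinp_def pcard_def)

lemma sum_cong_reps:
  assumes "p > 0" "periodic p A"
  shows "(\<Sum>a\<in>A \<inter> {0..<p}. \<Sum>b\<in>A \<inter> {0..<p}. of_bool (p dvd a - b - x)) = real (pcard p (A \<inter> shift x A))"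
proof -
  have "(\<Sum>b\<in>A \<inter> {0..<p}. of_bool (p dvd a - b - x)) = (of_bool (a - x \<in> A) :: real)" for a
  proof -
    have "{b \<in> A \<inter> {0..<p}. p dvd a - b - x} = (if a - x \<in> A then {(a - x) mod p} else {})"
    proof -
      have "p dvd a - b - x \<longleftrightarrow> b = (a - x) mod p" if "b \<in> {0..<p}" for b
      proof -
        have "p dvd a - b - x \<longleftrightarrow> (a - x) mod p = b mod p" by (simp add: mod_eq_dvd_iff algebra_simps)
        then show ?thesis using that by auto
      qed
      moreover have "(a - x) mod p \<in> {0..<p}" using assms(1) by simp
      moreover have "(a - x) mod p \<in> A \<longleftrightarrow> a - x \<in> A" by (rule periodic_mod[OF assms(2)])
      ultimately show ?thesis by (auto split: if_splits)
    qed
    then show ?thesis by (simp add: Collect_conj_eq[symmetric] Int_def)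
  qed
  then show ?thesis
    by (simp add: pcard_def) (auto intro!: arg_cong[where f = card])
qed

text \<open>The Fourier transform of the squared moduli is the autocorrelation of A: expand the
  square and apply the orthogonality \<open>sum_cosp\<close>. The product of two cosines produces
  the differences x and -x, which contribute equally.\<close>

lemma sum_spec_cosp:
  assumes "prime p" "periodic p A"
  shows "(\<Sum>z\<in>{0..<p}. spec p A z * cosp p (z * x)) = p * real (pcard p (A \<inter> shift x A))"
proof -
  have p: "p > 0" using assms prime_gt_0_int by blast
  let ?A = "A \<inter> {0..<p}"
  have sp: "spec p A z = (\<Sum>a\<in>?A. \<Sum>b\<in>?A. cosp p (z * (a - b)))" for z
  proof -
    have "cosp p (z * (a - b)) = cosp p (z * a) * cosp p (z * b) + sinp p (z * a) * sinp p (z * b)" for a b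
      unfolding cosp_def sinp_def by (simp add: right_diff_distrib diff_divide_distrib cos_diff)
    then show ?thesis by (simp add: spec_def power2_eq_square sum_product sum.distrib)
  qed
  have prod: "cosp p (z * (a - b)) * cosp p (z * x) = (cosp p (z * (a - b - x)) + cosp p (z * (b - a - x))) / 2" for a b z
  proof -
    have *: "cosp p u * cosp p v = (cosp p (u - v) + cosp p (u + v)) / 2" for u v
      unfolding cosp_def by (simp add: cos_times_cos diff_divide_distrib add_divide_distrib distrib_left right_diff_distrib)
    have "cosp p (z * (b - a - x)) = cosp p (z * (a - b) + z * x)"
    proof -
      have "2 * pi * real_of_int (z * (b - a - x)) / p = - (2 * pi * real_of_int (z * (a - b) + z * x) / p)"
        using p by (simp add: field_simps)
      then show ?thesis unfolding cosp_def by simp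
    qed
    then show ?thesis using *[of "z * (a - b)" "z * x"] by (simp add: right_diff_distrib)
  qed
  have "(\<Sum>z\<in>{0..<p}. spec p A z * cosp p (z * x))
     = (\<Sum>z\<in>{0..<p}. \<Sum>a\<in>?A. \<Sum>b\<in>?A. (cosp p (z * (a - b - x)) + cosp p (z * (b - a - x))) / 2)"
    by (simp only: sp sum_distrib_right prod)
  also have "\<dots> = (\<Sum>a\<in>?A. \<Sum>b\<in>?A. \<Sum>z\<in>{0..<p}. (cosp p (z * (a - b - x)) + cosp p (z * (b - a - x))) / 2)"
    by (subst sum.swap[of _ "{0..<p}"]) (intro sum.cong refl sum.swap)
  also have "\<dots> = (\<Sum>a\<in>?A. \<Sum>b\<in>?A. p / 2 * (of_bool (p dvd a - b - x) + of_bool (p dvd b - a - x)))"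
    by (intro sum.cong refl) (simp add: sum_cosp[OF assms(1)] sum.distrib flip: sum_divide_distrib)
  also have "\<dots> = p / 2 * ((\<Sum>a\<in>?A. \<Sum>b\<in>?A. of_bool (p dvd a - b - x)) + (\<Sum>a\<in>?A. \<Sum>b\<in>?A. of_bool (p dvd b - a - x)))"
    by (simp only: sum_distrib_left sum.distrib distrib_left)
  also have "(\<Sum>a\<in>?A. \<Sum>b\<in>?A. of_bool (p dvd b - a - x)) = (\<Sum>b\<in>?A. \<Sum>a\<in>?A. (of_bool (p dvd b - a - x) :: real))"
    by (rule sum.swap)
  finally show ?thesis using sum_cong_reps[OF p assms(2), of x] by simp
qed

text \<open>The defect of $x$ is the average of $1 - \cos(2 \pi z x / p)$ over the frequencies $z$, weighted by
  the squared Fourier coefficients of $A$; the weight of $z = 0$ is bounded away from 1.\<close>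

lemma ex_small_frequency:
  fixes R :: real
  assumes "prime p" "periodic p A" "A \<noteq> {}" "pcard p A < nat p" "\<And>x. x \<in> V \<Longrightarrow> real (defect p A x) \<le> R"
  obtains z where "z \<in> {1..<p}"
    "(real_of_int p - pcard p A) * pcard p A * (\<Sum>x\<in>V \<inter> {0..<p}. 1 - cosp p (z * x)) \<le> p * R * pcard p V"
proof -
  have p: "p > 0" using assms prime_gt_0_int by blast
  define n where "n = real (pcard p A)"
  have n: "0 < n" "n < p" using pcard_pos_iff[OF p assms(2)] assms(3,4) p by (auto simp: n_def)
  have split: "(\<Sum>z\<in>{0..<p}. f z) = f 0 + (\<Sum>z\<in>{1..<p}. f z)" for f :: "int \<Rightarrow> real"
  proof -
    have "{0..<p} = insert 0 {1..<p}" using p by auto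
    then show ?thesis by simp
  qed
  have tot: "(\<Sum>z\<in>{0..<p}. spec p A z) = p * n"
    using sum_spec_cosp[OF assms(1,2), of 0] by (simp add: n_def cosp_def)
  \<comment> \<open>The frequency 0 carries the weight n^2 out of p n and contributes nothing to the
    defects; the others share (p - n) n, so one of them does at least as well as the weighted
    average.\<close>
  have W1: "(\<Sum>z\<in>{1..<p}. spec p A z) = (p - n) * n"
    using tot split[of "spec p A"] spec_0[of p A] by (simp add: n_def power2_eq_square algebra_simps)
  define D where "D z = (\<Sum>x\<in>V \<inter> {0..<p}. 1 - cosp p (z * x))" for z
  have "(\<Sum>z\<in>{1..<p}. spec p A z * D z) = (\<Sum>z\<in>{0..<p}. spec p A z * D z)"
    unfolding split[of "\<lambda>z. spec p A z * D z"] by (simp add: D_def cosp_def)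
  also have "\<dots> = (\<Sum>x\<in>V \<inter> {0..<p}. \<Sum>z\<in>{0..<p}. spec p A z * (1 - cosp p (z * x)))"
    unfolding D_def sum_distrib_left by (rule sum.swap)
  also have "\<dots> = (\<Sum>x\<in>V \<inter> {0..<p}. p * real (defect p A x))"
  proof (intro sum.cong refl)
    fix x
    have "real (defect p A x) = n - pcard p (A \<inter> shift x A)" using defect_Int[OF p assms(2), of x] by (simp add: n_def)
    then show "(\<Sum>z\<in>{0..<p}. spec p A z * (1 - cosp p (z * x))) = p * real (defect p A x)"
      by (simp add: right_diff_distrib sum_subtractf tot sum_spec_cosp[OF assms(1,2)])
  qed
  also have "\<dots> \<le> (\<Sum>x\<in>V \<inter> {0..<p}. p * R)"
    using assms(5) p by (intro sum_mono mult_left_mono) auto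
  also have "\<dots> = p * R * pcard p V" by (simp add: pcard_def)
  finally have le: "(\<Sum>z\<in>{1..<p}. spec p A z * D z) \<le> p * R * pcard p V" .
  have "\<exists>z\<in>{1..<p}. (p - n) * n * D z \<le> p * R * pcard p V"
  proof (rule ccontr)
    assume no: "\<not> ?thesis"
    have pn: "(p - n) * n > 0" using n by simp
    have W1': "(\<Sum>z\<in>{1..<p}. spec p A z) > 0" using W1 pn by simp
    then obtain z0 where z0: "z0 \<in> {1..<p}" "spec p A z0 > 0"
      by (metis (no_types, lifting) sum_nonpos not_le)
    have "(\<Sum>z\<in>{1..<p}. spec p A z * (p * R * pcard p V)) < (\<Sum>z\<in>{1..<p}. spec p A z * ((p - n) * n * D z))"
    proof (rule sum_strict_mono_ex1)
      show "\<forall>z\<in>{1..<p}. spec p A z * (p * R * pcard p V) \<le> spec p A z * ((p - n) * n * D z)"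
        using no spec_nonneg by (auto intro!: mult_left_mono simp: not_le less_imp_le)
      show "\<exists>z\<in>{1..<p}. spec p A z * (p * R * pcard p V) < spec p A z * ((p - n) * n * D z)"
        using z0 no by (intro bexI[of _ z0] mult_strict_left_mono) (auto simp only: not_le bex_simps ball_simps)
    qed simp
    also have "\<dots> = (p - n) * n * (\<Sum>z\<in>{1..<p}. spec p A z * D z)" by (simp add: sum_distrib_left mult_ac)
    also have "\<dots> \<le> (p - n) * n * (p * R * pcard p V)" using le pn by (intro mult_left_mono) auto
    also have "\<dots> = (\<Sum>z\<in>{1..<p}. spec p A z * (p * R * pcard p V))"
      unfolding W1[symmetric] sum_distrib_right ..
    finally show False by simp
  qed
  then show ?thesis using that unfolding D_def n_def by blast
qed

lemma cosp_le_of_far: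
  assumes "p > 0" "\<nexists>k. [x = k] (mod p) \<and> 16 * \<bar>k\<bar> \<le> p"
  shows "cosp p x \<le> cos (pi / 8)"
proof -
  define h where "h = p div 2"
  \<comment> \<open>A representative of x with 2 |k| \<le> p. As x has none with 16 |k| \<le> p, the
    angle 2 \<pi> |k| / p lies between \<pi>/8 and \<pi>.\<close>
  define k where "k = (x + h) mod p - h"
  have k: "[x = k] (mod p)" unfolding k_def by (simp add: cong_def mod_diff_left_eq)
  have "(x + h) mod p \<in> {0..<p}" using assms(1) by simp
  moreover have "2 * h \<le> p" "p \<le> 2 * h + 1" unfolding h_def by linarith+
  ultimately have "- p \<le> 2 * k" "2 * k \<le> p" unfolding k_def by auto
  then have kh: "2 * \<bar>k\<bar> \<le> p" by linarith
  have kl: "p < 16 * \<bar>k\<bar>" using assms(2) k by auto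
  have "cosp p x = cosp p k" by (rule cosp_cong[OF assms(1) k])
  also have "\<dots> = cos (2 * pi * \<bar>k\<bar> / p)"
    unfolding cosp_def by (cases "k \<ge> 0") (simp_all add: abs_if flip: minus_divide_left)
  also have "\<dots> \<le> cos (pi / 8)"
  proof (rule cos_monotone_0_pi_le)
    have "real_of_int p \<le> real_of_int (16 * \<bar>k\<bar>)" using kl by (simp only: of_int_le_iff)
    then show "pi / 8 \<le> 2 * pi * \<bar>k\<bar> / p" using assms(1) by (simp add: field_simps)
    have "real_of_int (2 * \<bar>k\<bar>) \<le> real_of_int p" using kh by (simp only: of_int_le_iff)
    then show "2 * pi * \<bar>k\<bar> / p \<le> pi" using assms(1) by (simp add: field_simps)
  qed simp
  finally show ?thesis .
qed

text \<open>A frequency brings z u within p/16 of 0 only for most u, and two radii turn this into a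
  statement about all x. The bad elements of the ball of radius 2R number less than half of the ball
  of radius R. So for x in the small ball some u in it has both u and u + x good, and z x = z (u +
  x) - z u is within p/8 of 0.\<close>

lemma defect_ball_rectifiable:
  fixes \<beta> :: real
  assumes "prime p" "periodic p A" "A \<noteq> {}" "0 < \<beta>" "real (pcard p A) \<le> (1 - \<beta>) * p"
    "4 * real R * pcard p (defect_ball p A (2 * R)) < \<beta> * (1 - cos (pi / 8)) * pcard p A * pcard p (defect_ball p A R)"
  obtains z where "\<not> p dvd z" "\<And>x. x \<in> defect_ball p A R \<Longrightarrow> \<exists>k. [z * x = k] (mod p) \<and> 8 * \<bar>k\<bar> \<le> p"
proof -
  have p: "p > 0" using assms prime_gt_0_int by blast
  define \<theta> where "\<theta> = 1 - cos (pi / 8)"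
  have "cos (pi / 8) < cos 0" by (rule cos_monotone_0_pi) auto
  then have \<theta>: "\<theta> > 0" by (simp add: \<theta>_def)
  define n where "n = real (pcard p A)"
  have bp: "0 < \<beta> * p" using assms(4) p by simp
  have n: "0 < n" "n < p" using pcard_pos_iff[OF p assms(2)] assms(3,5) bp by (auto simp: n_def algebra_simps)
  define V where "V = defect_ball p A (2 * R)"
  obtain z where z: "z \<in> {1..<p}" "(p - n) * n * (\<Sum>x\<in>V \<inter> {0..<p}. 1 - cosp p (z * x)) \<le> p * real (2 * R) * pcard p V"
  proof (rule ex_small_frequency[OF assms(1-3), of V "real (2 * R)"])
    show "pcard p A < nat p" using n(2) p by (simp add: n_def)
    show "real (defect p A x) \<le> real (2 * R)" if "x \<in> V" for x
      using that unfolding V_def defect_ball_def by (simp only: mem_Collect_eq of_nat_le_iff)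
  qed (simp add: n_def)
  define D where "D = (\<Sum>x\<in>V \<inter> {0..<p}. 1 - cosp p (z * x))"
  have D0: "0 \<le> D" unfolding D_def by (intro sum_nonneg) (simp add: cosp_def)
  have "\<beta> * p * n * D \<le> (p - n) * n * D"
    using assms(5) n D0 by (intro mult_right_mono) (auto simp: n_def algebra_simps)
  also have "\<dots> \<le> p * real (2 * R) * pcard p V" using z(2) D_def by simp
  finally have "p * (\<beta> * n * D) \<le> p * (2 * R * pcard p V)" by (simp add: mult_ac)
  then have Dle: "\<beta> * n * D \<le> 2 * R * pcard p V" using p by simp
  define near where "near x \<longleftrightarrow> (\<exists>k. [z * x = k] (mod p) \<and> 16 * \<bar>k\<bar> \<le> p)" for x
  define bad where "bad = {x \<in> V. \<not> near x}"
  have perV: "periodic p V" unfolding V_def by (rule periodic_defect_ball[OF assms(2)])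
  have near_cong: "near (x + p) \<longleftrightarrow> near x" for x
  proof -
    have "[z * (x + p) = k] (mod p) \<longleftrightarrow> [z * x = k] (mod p)" for k by (simp add: cong_def distrib_left)
    then show ?thesis by (simp add: near_def)
  qed
  have perbad: "periodic p bad" using perV near_cong by (auto simp: periodic_def bad_def)
  have "\<theta> * pcard p bad \<le> D"
  proof -
    have "\<theta> * pcard p bad = (\<Sum>x\<in>bad \<inter> {0..<p}. \<theta>)" by (simp add: pcard_def)
    also have "\<dots> \<le> (\<Sum>x\<in>bad \<inter> {0..<p}. 1 - cosp p (z * x))"
      using cosp_le_of_far[OF p] by (intro sum_mono) (auto simp: \<theta>_def bad_def near_def)
    also have "\<dots> \<le> D" unfolding D_def by (intro sum_mono2) (auto simp: bad_def cosp_def)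
    finally show ?thesis .
  qed
  then have "\<beta> * n * (\<theta> * pcard p bad) \<le> \<beta> * n * D" using assms(4) n by (intro mult_left_mono) auto
  with Dle have "\<beta> * n * (\<theta> * pcard p bad) \<le> 2 * R * pcard p V" by linarith
  then have "2 * (\<beta> * n * (\<theta> * pcard p bad)) \<le> 2 * (2 * R * pcard p V)" by linarith
  then have "\<beta> * n * \<theta> * (2 * pcard p bad) \<le> 4 * real R * pcard p V" by (simp add: mult_ac)
  also have "\<dots> < \<beta> * n * \<theta> * pcard p (defect_ball p A R)" using assms(6) by (simp add: V_def \<theta>_def n_def mult_ac)
  finally have bad: "2 * pcard p bad < pcard p (defect_ball p A R)"
    using assms(4) n \<theta> by simp
  have "\<exists>k. [z * x = k] (mod p) \<and> 8 * \<bar>k\<bar> \<le> p" if x: "x \<in> defect_ball p A R" for x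
  proof -
    have "\<not> defect_ball p A R \<subseteq> bad \<union> shift (- x) bad"
    proof
      assume "defect_ball p A R \<subseteq> bad \<union> shift (- x) bad"
      then have "pcard p (defect_ball p A R) \<le> pcard p bad + pcard p (shift (- x) bad)"
        using pcard_mono pcard_Un_le order_trans by metis
      then show False using bad pcard_shift[OF p perbad] by simp
    qed
    then obtain u where "u \<in> defect_ball p A R" "u \<notin> bad \<union> shift (- x) bad" by blast
    then have u: "u \<in> defect_ball p A R" "u \<notin> bad" "u + x \<notin> bad" by simp_all
    have "u \<in> V" "u + x \<in> V" using u(1) x defect_add_le[OF p assms(2), of u x] by (auto simp: V_def defect_ball_def)
    then have "near u" "near (u + x)" using u by (auto simp: bad_def)
    then obtain k1 k2 where k: "[z * u = k1] (mod p)" "16 * \<bar>k1\<bar> \<le> p" "[z * (u + x) = k2] (mod p)" "16 * \<bar>k2\<bar> \<le> p"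
      unfolding near_def by blast
    have "[z * (u + x) - z * u = k2 - k1] (mod p)" using k by (intro cong_diff) auto
    moreover have "z * (u + x) - z * u = z * x" by (simp add: algebra_simps)
    moreover have "8 * c \<le> p" if "16 * a \<le> p" "16 * b \<le> p" "c \<le> b + a" for a b c
      using that by linarith
    from this[OF k(2,4) abs_triangle_ineq4] have "8 * \<bar>k2 - k1\<bar> \<le> p" .
    ultimately show ?thesis by (intro exI[of _ "k2 - k1"]) simp
  qed
  moreover have "\<not> p dvd z" using z(1) zdvd_not_zless[of z p] by auto
  ultimately show ?thesis using that by blast
qed

subsection \<open>Small doubling in the integers\<close>

text \<open>Freiman's argument: modulo twice its largest element, $U$ becomes a set $V$ with
  $|V + V| < 3/2 |V|$, so that $V - V$ is a subgroup.\<close>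

lemma small_doubling_progression:
  fixes U :: "int set"
  assumes "finite U" "0 \<in> U" "\<And>u. u \<in> U \<Longrightarrow> - u \<in> U" "2 \<le> card U"
    and T: "T = (\<lambda>(u, v). u + v) ` (U \<times> U)" "card T + 1 \<le> card U + t" "2 * t + 3 < 3 * card U"
  obtains g where "g > 0" "\<And>u. u \<in> U \<Longrightarrow> g dvd u" "\<And>u. u \<in> U \<Longrightarrow> 2 * \<bar>u\<bar> \<le> g * int t"
proof -
  define h where "h = Max U"
  have hU: "h \<in> U" unfolding h_def using assms by (intro Max_in) auto
  have le: "u \<le> h" "- h \<le> u" if "u \<in> U" for u
  proof -
    show "u \<le> h" unfolding h_def using that assms(1) by (intro Max_ge)
    have "- u \<le> h" unfolding h_def using assms(1) assms(3)[OF that] by (intro Max_ge)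
    then show "- h \<le> u" by simp
  qed
  have h0: "h > 0"
  proof (rule ccontr)
    assume "\<not> ?thesis"
    then have "U \<subseteq> {0}" using le by force
    then have "card U \<le> card {0 :: int}" by (intro card_mono) auto
    then show False using assms(4) by simp
  qed
  \<comment> \<open>By symmetry -h is the least element. Modulo 2 h only h and -h are identified
    within U, whereas every sum u + h falls onto the sum u - h.\<close>
  define l where "l = 2 * h"
  have l: "l > 0" using h0 by (simp add: l_def)
  define V where "V = {z. \<exists>u\<in>U. [z = u] (mod l)}"
  define W where "W = {z. \<exists>w\<in>T. [z = w] (mod l)}"
  have perV: "periodic l V" and perW: "periodic l W"
    by (auto simp: periodic_def V_def W_def cong_def)
  have UV: "u \<in> V" if "u \<in> U" for u unfolding V_def using that cong_refl[of u l] by blast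
  note V0 = UV[OF assms(2)]
  have VW: "a + b \<in> W" if ab: "a \<in> V" "b \<in> V" for a b
  proof -
    obtain u v where "u \<in> U" "v \<in> U" "[a = u] (mod l)" "[b = v] (mod l)" using ab unfolding V_def by blast
    then have "u + v \<in> T" "[a + b = u + v] (mod l)" using T(1) by (auto intro: cong_add)
    then show ?thesis unfolding W_def by blast
  qed
  have cV: "card U - 1 \<le> pcard l V"
  proof -
    have "card (U - {h}) \<le> card (V \<inter> {0..<l})"
    proof (rule card_inj_on_le[of "\<lambda>u. u mod l"])
      show "inj_on (\<lambda>u. u mod l) (U - {h})"
      proof (rule inj_onI)
        fix u v assume *: "u \<in> U - {h}" "v \<in> U - {h}" "u mod l = v mod l"
        then have "- h \<le> u" "u < h" "- h \<le> v" "v < h" using le by force+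
        then have "(u + h) mod l = u + h" "(v + h) mod l = v + h" by (auto simp: l_def)
        then show "u = v" using *(3) by (metis add_right_cancel mod_add_left_eq)
      qed
      show "(\<lambda>u. u mod l) ` (U - {h}) \<subseteq> V \<inter> {0..<l}"
        using l unfolding V_def by (auto simp: cong_def)
    qed simp
    then show ?thesis using hU by (simp add: pcard_def)
  qed
  have finT: "finite T" using T(1) assms(1) by simp
  have cW: "pcard l W \<le> t"
  proof -
    \<comment> \<open>The card U - 1 sums in X are redundant modulo l, which leaves at most t
      residues. The sum -h + h is left out of X, because it must represent the class of 2 h.\<close>
    define X where "X = (\<lambda>u. u + h) ` (U - {- h})"
    have XT: "X \<subseteq> T" unfolding X_def T(1) using hU by force
    have "card X = card U - 1" unfolding X_def using assms(3)[OF hU] by (subst card_image) auto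
    then have cTX: "card (T - X) \<le> t" using XT finT T(2) by (simp add: card_Diff_subset finite_subset)
    have "W \<inter> {0..<l} \<subseteq> (\<lambda>w. w mod l) ` (T - X)"
    proof
      fix z assume z: "z \<in> W \<inter> {0..<l}"
      then obtain w where w: "w \<in> T" "[z = w] (mod l)" by (auto simp: W_def)
      then have zw: "z = w mod l" using z by (simp add: cong_def)
      show "z \<in> (\<lambda>w. w mod l) ` (T - X)"
      proof (cases "w \<in> X")
        case False
        then show ?thesis using w zw by auto
      next
        case True
        then obtain u where u: "u \<in> U" "u \<noteq> - h" "w = u + h" by (auto simp: X_def)
        have "u - h \<in> T" using u assms(3)[OF hU] unfolding T(1) by force
        moreover have "u - h \<notin> X"
        proof
          assume "u - h \<in> X"
          then obtain v where v: "v \<in> U" "v \<noteq> - h" "u - h = v + h" unfolding X_def by blast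
          then have "u > h" using le[OF v(1)] by force
          then show False using le[OF u(1)] by simp
        qed
        moreover have "(u - h) mod l = z"
        proof -
          have "w = (u - h) + l" using u by (simp add: l_def)
          then show ?thesis using zw by simp
        qed
        ultimately show ?thesis by blast
      qed
    qed
    then have "pcard l W \<le> card ((\<lambda>w. w mod l) ` (T - X))" unfolding pcard_def using finT by (intro card_mono) auto
    also have "\<dots> \<le> card (T - X)" using finT by (intro card_image_le) auto
    finally show ?thesis using cTX by simp
  qed
  define v where "v = pcard l V"
  have WV: "2 * pcard l W < 3 * v" using cV cW T(3) by (simp add: v_def)
  have v0: "v > 0" using WV by simp
  \<comment> \<open>The difference set of V. If z and z - x are in V, then V + z and V + (z - x)
    both lie in W, which has fewer than 3/2 v elements, so they overlap in more than v/2. Two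
    subsets of V of that size meet, and thus D is closed under addition.\<close>
  define D where "D = {x. V \<inter> shift x V \<noteq> {}}"
  have DE: "\<exists>z. z \<in> V \<and> z - x \<in> V" if "x \<in> D" for x
  proof -
    have "V \<inter> shift x V \<noteq> {}" using that by (simp add: D_def)
    then obtain z where "z \<in> V \<inter> shift x V" by blast
    then show ?thesis by auto
  qed
  have big: "v < 2 * pcard l (V \<inter> shift x V)" if x: "x \<in> D" for x
  proof -
    obtain z where z: "z \<in> V" "z - x \<in> V" using DE[OF x] by blast
    have "shift (z - x) V \<subseteq> W" "shift z V \<subseteq> W" using VW z by (force simp: shift_def)+
    then have "pcard l (shift (z - x) V \<union> shift z V) \<le> pcard l W" by (intro pcard_mono) auto
    moreover have "shift (z - x) V \<inter> shift z V = shift (z - x) (V \<inter> shift x V)" by (simp add: shift_Int)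
    then have "pcard l (shift (z - x) V \<inter> shift z V) = pcard l (V \<inter> shift x V)"
      using pcard_shift[OF l] perV by (metis periodic_Int periodic_shift)
    ultimately have "2 * v \<le> pcard l W + pcard l (V \<inter> shift x V)"
      using pcard_Un_Int[of l "shift (z - x) V" "shift z V"] pcard_shift[OF l perV] by (simp add: v_def)
    then show ?thesis using WV by simp
  qed
  have Dneg: "- x \<in> D" if xD: "x \<in> D" for x
  proof -
    obtain z where z: "z \<in> V" "z - x \<in> V" using DE[OF xD] by blast
    then have "z - x \<in> V \<inter> shift (- x) V" by simp
    then show ?thesis unfolding D_def by blast
  qed
  have meet: "X \<inter> Y \<noteq> {}" if "X \<subseteq> Z" "Y \<subseteq> Z" "pcard l Z < pcard l X + pcard l Y" for X Y Z
  proof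
    assume "X \<inter> Y = {}"
    then have "pcard l (X \<union> Y) = pcard l X + pcard l Y" by (rule pcard_Un_disjoint)
    moreover have "pcard l (X \<union> Y) \<le> pcard l Z" using that by (intro pcard_mono) auto
    ultimately show False using that by simp
  qed
  have Dadd: "x + y \<in> D" if xy: "x \<in> D" "y \<in> D" for x y
  proof -
    have "(V \<inter> shift x V) \<inter> (V \<inter> shift (- y) V) \<noteq> {}"
      using big[OF xy(1)] big[OF Dneg[OF xy(2)]] by (intro meet[of _ V]) (auto simp: v_def)
    then obtain z where "z \<in> V" "z - x \<in> V" "z + y \<in> V" by auto
    then have "z + y \<in> V \<inter> shift (x + y) V" by simp
    then show ?thesis unfolding D_def by blast
  qed
  have D0: "0 \<in> D" using V0 by (auto simp: D_def)
  have perD: "periodic l D"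
  proof -
    have "shift (x + l) V = shift x V" for x by (rule shift_cong[OF perV]) (simp add: cong_def)
    then show ?thesis by (simp add: periodic_def D_def)
  qed
  have lD: "l \<in> D" using perD D0 unfolding periodic_def by (metis add_0)
  define g where "g = (LEAST k::nat. 0 < k \<and> int k \<in> D)"
  have "\<exists>k::nat. 0 < k \<and> int k \<in> D" using lD l by (intro exI[of _ "nat l"]) auto
  then have g: "0 < g" "int g \<in> D" unfolding g_def by (metis (mono_tags, lifting) LeastI_ex)+
  have perDg: "periodic (int g) D"
    unfolding periodic_def using Dadd g(2) Dneg[OF g(2)] by (metis add.assoc add.right_inverse add_0_right)
  have Dg: "x \<in> D \<longleftrightarrow> int g dvd x" for x
  proof
    assume "x \<in> D"
    then have "x mod int g \<in> D" using periodic_mod[OF perDg] by simp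
    then have "\<not> 0 < nat (x mod int g)"
      using not_less_Least[of "nat (x mod int g)" "\<lambda>k. 0 < k \<and> int k \<in> D"] g(1)
      unfolding g_def[symmetric] by (auto simp: nat_less_iff)
    moreover have "0 \<le> x mod int g" using g(1) by simp
    ultimately have "x mod int g = 0" by linarith
    then show "int g dvd x" by auto
  next
    assume "int g dvd x"
    then show "x \<in> D" using periodic_mod[OF perDg, of x] D0 by auto
  qed
  have VD: "V \<subseteq> D"
  proof
    fix x assume "x \<in> V"
    then have "x \<in> V \<inter> shift x V" using V0 by simp
    then show "x \<in> D" unfolding D_def by blast
  qed
  \<comment> \<open>Each x in D accounts for more than v/2 of the v^2 pairs from V, so D has fewer
    than 2 v elements. Then V and x - V must meet inside D for every x in D, which puts D inside W
    and bounds its size by t.\<close>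
  have cD: "pcard l D < 2 * v"
  proof -
    have "pcard l D * (v + 1) = (\<Sum>x\<in>D \<inter> {0..<l}. v + 1)" by (simp add: pcard_def)
    also have "\<dots> \<le> (\<Sum>x\<in>D \<inter> {0..<l}. 2 * pcard l (V \<inter> shift x V))"
      using big by (intro sum_mono) (simp add: Suc_le_eq)
    also have "\<dots> \<le> (\<Sum>x\<in>{0..<l}. 2 * pcard l (V \<inter> shift x V))" by (intro sum_mono2) auto
    also have "\<dots> = 2 * v * v" using sum_overlap[OF l perV] by (simp add: v_def power2_eq_square flip: sum_distrib_left)
    finally have "pcard l D * (v + 1) < 2 * v * (v + 1)" using v0 by simp
    then show ?thesis by (metis mult_less_cancel2)
  qed
  have "D \<subseteq> W"
  proof
    fix x assume x: "x \<in> D"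
    have "V \<inter> {b. x - b \<in> V} \<noteq> {}"
    proof (rule meet[of _ D])
      show "{b. x - b \<in> V} \<subseteq> D"
      proof clarify
        fix b assume "x - b \<in> V"
        then have "x + (- (x - b)) \<in> D" using VD Dneg Dadd x by blast
        then show "b \<in> D" by simp
      qed
      show "pcard l D < pcard l V + pcard l {b. x - b \<in> V}" using cD pcard_reflect[OF l perV, of x] by (simp add: v_def)
    qed (rule VD)
    then obtain b where "b \<in> V" "x - b \<in> V" by auto
    from VW[OF this] show "x \<in> W" by simp
  qed
  then have "pcard l D \<le> t" using cW pcard_mono[of D W l] by simp
  moreover obtain q where q: "l = int g * q" using Dg lD by blast
  have "nat q \<le> pcard l D"
  proof -
    have "card {0..<q} \<le> card (D \<inter> {0..<l})"
    proof (rule card_inj_on_le[of "\<lambda>j. int g * j"])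
      show "inj_on (\<lambda>j. int g * j) {0..<q}" using g(1) by (auto simp: inj_on_def)
      show "(\<lambda>j. int g * j) ` {0..<q} \<subseteq> D \<inter> {0..<l}" using g(1) q by (auto simp: Dg)
    qed simp
    then show ?thesis by (simp add: pcard_def)
  qed
  ultimately have "q \<le> int t" by linarith
  then have lt: "l \<le> int g * int t" using q g(1) by simp
  have "int g dvd u" if "u \<in> U" for u
  proof -
    have "u \<in> V" by (rule UV[OF that])
    then show ?thesis using VD Dg by blast
  qed
  moreover have "2 * \<bar>u\<bar> \<le> int g * int t" if "u \<in> U" for u using le[OF that] lt by (simp add: l_def)
  ultimately show ?thesis using that[of "int g"] g(1) by simp
qed

text \<open>After dilation by z the ball of radius R becomes a set U of integers within p/8, so sums
  of two elements that differ as integers also differ modulo p, and U + U embeds into the ball of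
  radius 2R. The sizes are about 2R and at most about 4.2 R, so
  \<open>small_doubling_progression\<close> applies and U fills most of a progression.\<close>

lemma linear_structure:
  fixes \<beta> :: real
  assumes "prime p" "periodic p A" "A \<noteq> {}" "0 < \<beta>" "real (pcard p A) \<le> (1 - \<beta>) * p" "1000 \<le> R"
    and lower: "\<And>k. k \<le> 2 * R \<Longrightarrow> 2 * real k - R / 400 \<le> pcard p (defect_ball p A k)"
    and "8 * R + 2 \<le> pcard p A" "pcard p A + (8 * R + 2) \<le> nat p"
    and Rn: "10 * real R \<le> \<beta> * (1 - cos (pi / 8)) * pcard p A"
  obtains c w where "\<not> p dvd c" "0 < w" "w \<le> 2 * int R" "10 * int (defect p A (c * w)) \<le> 11 * w"
    "\<And>i. \<bar>i\<bar> \<le> w \<Longrightarrow> int (defect p A (c * i)) \<le> 3 * w"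
proof -
  have p: "p > 0" using assms(1) prime_gt_0_int by blast
  define u1 where "u1 = pcard p (defect_ball p A R)"
  define u2 where "u2 = pcard p (defect_ball p A (2 * R))"
  have u1: "(2 - 1 / 400) * R \<le> u1" using lower[of R] by (simp add: u1_def algebra_simps)
  have u2: "real u2 \<le> 21 / 5 * R"
  proof -
    \<comment> \<open>The bound at radius 2R with e = R/400; the square root of its right-hand side
      is at most R/10 once R \<ge> 1000.\<close>
    have "(real u2 / 2 - real (2 * R))\<^sup>2 \<le> real (2 * R) * (1 + R / 400) + 1"
      unfolding u2_def by (rule defect_ball_upper[OF assms(1,2)]) (use lower assms in auto)
    also have "\<dots> \<le> (R / 10)\<^sup>2"
    proof -
      have "1000 * real R \<le> real R * real R" using assms(6) by (intro mult_right_mono) auto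
      moreover have "real (2 * R) * (1 + R / 400) + 1 = 2 * real R + (real R * real R) / 200 + 1"
        by (simp add: field_simps)
      moreover have "(R / 10)\<^sup>2 = (real R * real R) / 100" by (simp add: power2_eq_square)
      moreover have "1000 \<le> real R" using assms(6) by simp
      ultimately show ?thesis by linarith
    qed
    finally have "real u2 / 2 - real (2 * R) \<le> R / 10" by (rule power2_le_imp_le) simp
    then show ?thesis by simp
  qed
  have "4 * real R * u2 < \<beta> * (1 - cos (pi / 8)) * pcard p A * u1"
  proof -
    have "4 * real R * u2 \<le> 4 * real R * (21 / 5 * R)" using u2 by (intro mult_left_mono) auto
    also have "\<dots> < 10 * real R * ((2 - 1 / 400) * R)" using assms(6) by simp
    also have "\<dots> \<le> (\<beta> * (1 - cos (pi / 8)) * pcard p A) * u1"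
      by (rule mult_mono[OF Rn u1]) (use order_trans[OF _ Rn] in simp_all)
    finally show ?thesis .
  qed
  then obtain z where z: "\<not> p dvd z" "\<And>x. x \<in> defect_ball p A R \<Longrightarrow> \<exists>k. [z * x = k] (mod p) \<and> 8 * \<bar>k\<bar> \<le> p"
    using defect_ball_rectifiable[OF assms(1-5), of R] unfolding u1_def u2_def by blast
  obtain \<zeta> where \<zeta>: "[z * \<zeta> = 1] (mod p)" using cong_solve_coprime_int[OF coprime_prime_int[OF assms(1) z(1)]] by blast
  have p\<zeta>: "\<not> p dvd \<zeta>"
  proof
    assume "p dvd \<zeta>"
    then have "p dvd z * \<zeta>" by simp
    then have "p dvd 1" using \<zeta> by (metis cong_dvd_iff)
    then show False using assms(1) by (simp add: not_prime_unit)
  qed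
  have perball: "periodic p (defect_ball p A r)" for r by (rule periodic_defect_ball[OF assms(2)])
  define U where "U = {k. 8 * \<bar>k\<bar> \<le> p \<and> \<zeta> * k \<in> defect_ball p A R}"
  have Ub: "U \<subseteq> {-p..p}" by (auto simp: U_def)
  have finU: "finite U" using Ub by (rule finite_subset) simp
  have U0: "0 \<in> U" using p by (simp add: U_def defect_ball_def)
  have Uneg: "- u \<in> U" if "u \<in> U" for u using that defect_minus[OF p assms(2), of "\<zeta> * u"] by (simp add: U_def defect_ball_def)
  have cU: "u1 \<le> card U"
  proof -
    define f where "f x = (SOME k. [z * x = k] (mod p) \<and> 8 * \<bar>k\<bar> \<le> p)" for x
    have f: "[z * x = f x] (mod p)" "8 * \<bar>f x\<bar> \<le> p" if "x \<in> defect_ball p A R" for x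
      using someI_ex[OF z(2)[OF that]] unfolding f_def by auto
    show ?thesis unfolding u1_def pcard_def
    proof (rule card_inj_on_le[of f])
      show "inj_on f (defect_ball p A R \<inter> {0..<p})"
      proof (rule inj_onI)
        fix x y assume *: "x \<in> defect_ball p A R \<inter> {0..<p}" "y \<in> defect_ball p A R \<inter> {0..<p}" "f x = f y"
        then have "[z * x = z * y] (mod p)" using f(1) by (metis Int_iff cong_sym cong_trans)
        then have "[x = y] (mod p)" using coprime_prime_int[OF assms(1) z(1)] by (simp add: cong_mult_lcancel)
        then show "x = y" using * by (simp add: cong_def)
      qed
      show "f ` (defect_ball p A R \<inter> {0..<p}) \<subseteq> U"
      proof clarify
        fix x assume x: "x \<in> defect_ball p A R"
        have "[\<zeta> * f x = \<zeta> * (z * x)] (mod p)" using f(1)[OF x] by (intro cong_scalar_left) (rule cong_sym)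
        moreover have "[\<zeta> * (z * x) = 1 * x] (mod p)" using cong_scalar_right[OF \<zeta>, of x] by (simp add: mult_ac)
        ultimately have "[\<zeta> * f x = x] (mod p)" by (metis cong_trans mult_1)
        then show "f x \<in> U" using periodic_cong[OF perball] x f(2)[OF x] by (auto simp: U_def)
      qed
    qed (rule finU)
  qed
  define T where "T = (\<lambda>(u, v). u + v) ` (U \<times> U)"
  have cT: "card T \<le> u2"
    unfolding u2_def pcard_def
  proof (rule card_inj_on_le[of "\<lambda>s. (\<zeta> * s) mod p"])
    have T4: "4 * \<bar>s\<bar> \<le> p" if s: "s \<in> T" for s
    proof -
      obtain u v where uv: "s = u + v" "8 * \<bar>u\<bar> \<le> p" "8 * \<bar>v\<bar> \<le> p" using s by (auto simp: T_def U_def)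
      have "4 * c \<le> p" if "8 * a \<le> p" "8 * b \<le> p" "c \<le> a + b" for a b c using that by linarith
      from this[OF uv(2,3) abs_triangle_ineq] show ?thesis by (simp only: uv(1))
    qed
    show "inj_on (\<lambda>s. (\<zeta> * s) mod p) T"
    proof (rule inj_onI)
      fix s s' assume *: "s \<in> T" "s' \<in> T" "(\<zeta> * s) mod p = (\<zeta> * s') mod p"
      then have "[s = s'] (mod p)" using coprime_prime_int[OF assms(1) p\<zeta>] by (metis cong_def cong_mult_lcancel)
      then have "p dvd s - s'" by (simp add: cong_iff_dvd_diff)
      moreover have "c < p" if "4 * a \<le> p" "4 * b \<le> p" "c \<le> a + b" for a b c using that p by linarith
      from this[OF T4[OF *(1)] T4[OF *(2)] abs_triangle_ineq4] have "\<bar>s - s'\<bar> < p" .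
      ultimately show "s = s'" using zdvd_imp_le[of p "\<bar>s - s'\<bar>"] by force
    qed
    show "(\<lambda>s. (\<zeta> * s) mod p) ` T \<subseteq> defect_ball p A (2 * R) \<inter> {0..<p}"
    proof clarify
      fix s assume "s \<in> T"
      then obtain u v where uv: "u \<in> U" "v \<in> U" "s = u + v" by (auto simp: T_def)
      have "\<zeta> * s = \<zeta> * u + \<zeta> * v" using uv by (simp add: algebra_simps)
      then have "\<zeta> * s \<in> defect_ball p A (2 * R)"
        using defect_add_le[OF p assms(2), of "\<zeta> * u" "\<zeta> * v"] uv by (auto simp: U_def defect_ball_def)
      then show "(\<zeta> * s) mod p \<in> defect_ball p A (2 * R) \<inter> {0..<p}" using periodic_mod[OF perball] p by auto
    qed
  qed simp
  define t where "t = card T + 1 - card U"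
  have cUr: "799 / 400 * R \<le> card U" using u1 cU by simp
  have t: "card T + 1 \<le> card U + t" by (simp add: t_def)
  have t2: "real t \<le> 881 / 400 * R + 1"
  proof (cases "card U \<le> card T + 1")
    case True
    then have "real t = real (card T) + 1 - real (card U)" by (simp add: t_def of_nat_diff)
    moreover have "real (card T) \<le> real u2" using cT by simp
    ultimately show ?thesis using u2 cUr by linarith
  qed (simp add: t_def)
  obtain g where g: "g > 0" "\<And>u. u \<in> U \<Longrightarrow> g dvd u" "\<And>u. u \<in> U \<Longrightarrow> 2 * \<bar>u\<bar> \<le> g * int t"
  proof (rule small_doubling_progression[OF finU U0 Uneg _ T_def t])
    show "2 \<le> card U" "2 * t + 3 < 3 * card U" using cUr t2 assms(6) by linarith+
  qed blast+
  \<comment> \<open>\<open>\<zeta>\<close> undoes the dilation by z, and g is the difference of the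
    progression: multiplication by c sends J into the ball of radius R.\<close>
  define c where "c = \<zeta> * g"
  have "\<not> p dvd g"
  proof
    assume "p dvd g"
    have "U \<subseteq> {0}"
    proof
      fix u assume u: "u \<in> U"
      then have "p dvd u" using g(2) \<open>p dvd g\<close> dvd_trans by blast
      moreover have "\<bar>u\<bar> < p" using u p by (auto simp: U_def)
      ultimately show "u \<in> {0}" using zdvd_imp_le[of p "\<bar>u\<bar>"] by force
    qed
    then have "card U \<le> card {0 :: int}" by (intro card_mono) auto
    then show False using cUr assms(6) by simp
  qed
  then have pc: "\<not> p dvd c" using p\<zeta> assms(1) unfolding c_def by (simp add: prime_dvd_mult_iff)
  define J where "J = {j. g * j \<in> U}"
  have UJ: "U = (\<lambda>j. g * j) ` J" using g(2) by (force simp: J_def dvd_def)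
  have finJ: "finite J" using finite_imageD[of "\<lambda>j. g * j" J] finU g(1) UJ by (auto simp: inj_on_def)
  have cJ: "card J = card U" unfolding UJ using g(1) by (subst card_image) (auto simp: inj_on_def)
  define w where "w = Max J"
  have J0: "0 \<in> J" using U0 by (simp add: J_def)
  have wJ: "w \<in> J" unfolding w_def using finJ J0 by (intro Max_in) auto
  have Jle: "j \<le> w" "- w \<le> j" if "j \<in> J" for j
  proof -
    show "j \<le> w" unfolding w_def using finJ that by (intro Max_ge)
    have "- j \<in> J" using that Uneg[of "g * j"] by (simp add: J_def)
    then have "- j \<le> w" unfolding w_def using finJ by (intro Max_ge)
    then show "- w \<le> j" by simp
  qed
  have "2 * \<bar>g * w\<bar> \<le> g * int t" using g(3) wJ by (simp add: J_def)
  then have "g * (2 * w) \<le> g * int t" using Jle(1)[OF J0] g(1) by (simp add: abs_mult)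
  then have wt: "2 * w \<le> int t" using g(1) by simp
  have "J \<subseteq> {- w..w}" using Jle by auto
  then have "card J \<le> card {- w..w}" by (intro card_mono) auto
  then have wlow: "real (card U) \<le> 2 * w + 1" using cJ Jle(1)[OF J0] by simp
  have wR: "99 / 100 * R \<le> w" "w \<le> 111 / 100 * R" using wlow cUr wt t2 assms(6) by linarith+
  have R_w: "real R \<le> 11 / 10 * w" "real (2 * R) \<le> 3 * w" "w > 0" using wR assms(6) by linarith+
  have "defect p A (c * w) \<le> R" using wJ by (simp add: J_def U_def defect_ball_def c_def mult_ac)
  then have "real (10 * defect p A (c * w)) \<le> 11 * w" using R_w(1) by simp
  then have 1: "10 * int (defect p A (c * w)) \<le> 11 * w" by linarith
  \<comment> \<open>J and J + i lie in an interval of at most 3 w + 1 integers and each fills more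
    than half of it, so i is a difference of two elements of J.\<close>
  have 2: "int (defect p A (c * i)) \<le> 3 * w" if i: "\<bar>i\<bar> \<le> w" for i
  proof -
    have "J \<inter> (\<lambda>j. j + i) ` J \<noteq> {}"
    proof
      assume "J \<inter> (\<lambda>j. j + i) ` J = {}"
      then have "card (J \<union> (\<lambda>j. j + i) ` J) = card J + card ((\<lambda>j. j + i) ` J)"
        using finJ by (intro card_Un_disjoint) auto
      also have "card ((\<lambda>j. j + i) ` J) = card J" by (rule card_image) (simp add: inj_on_def)
      finally have "2 * card U = card (J \<union> (\<lambda>j. j + i) ` J)" using cJ by simp
      also have "\<dots> \<le> card (if i \<ge> 0 then {- w..w + i} else {- w + i..w})"
        using Jle i by (intro card_mono) (auto split: if_splits; force)+
      also have "\<dots> \<le> nat (3 * w + 1)" using i by auto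
      finally have "real (2 * card U) \<le> 3 * w + 1" using R_w(3) by linarith
      then show False using wR cUr assms(6) by simp
    qed
    then obtain j where j: "j \<in> J" "j + i \<in> J" by auto
    have "c * i = c * (j + i) + - (c * j)" by (simp add: algebra_simps)
    then have "defect p A (c * i) \<le> defect p A (c * (j + i)) + defect p A (c * j)"
      using defect_add_le[OF p assms(2), of "c * (j + i)" "- (c * j)"] defect_minus[OF p assms(2)] by simp
    also have "\<dots> \<le> 2 * R" using j by (simp add: J_def U_def defect_ball_def c_def mult_ac)
    finally show ?thesis using R_w(2) by linarith
  qed
  have "w \<le> 2 * int R" using wR by linarith
  then show ?thesis using that[OF pc R_w(3) _ 1 2] by blast
qed

subsection \<open>A is close to an arc\<close>

definition window :: "int set \<Rightarrow> int \<Rightarrow> int \<Rightarrow> int" where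
  "window A w x = (\<Sum>z\<in>{x..<x + w}. of_bool (z \<in> A))"

lemma window_eq: "window A w x = (\<Sum>i\<in>{0..<w}. of_bool (x + i \<in> A))"
  unfolding window_def
  by (rule sum.reindex_bij_witness[of _ "\<lambda>i. x + i" "\<lambda>z. z - x"]) auto

lemma window_bounds: "0 \<le> w \<Longrightarrow> 0 \<le> window A w x \<and> window A w x \<le> w"
proof -
  assume w: "0 \<le> w"
  have "window A w x \<le> (\<Sum>i\<in>{0..<w}. 1)" unfolding window_eq by (intro sum_mono) simp
  moreover have "0 \<le> window A w x" unfolding window_eq by (intro sum_nonneg) simp
  ultimately show ?thesis using w by simp
qed

lemma window_compl: "0 \<le> w \<Longrightarrow> w - window A w x = (\<Sum>i\<in>{0..<w}. of_bool (x + i \<notin> A))"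
proof -
  assume w: "0 \<le> w"
  have "window A w x + (\<Sum>i\<in>{0..<w}. of_bool (x + i \<notin> A)) = (\<Sum>i\<in>{0..<w}. 1)"
    unfolding window_eq sum.distrib[symmetric] by (intro sum.cong) auto
  then show ?thesis using w by simp
qed

lemma window_step: "0 \<le> w \<Longrightarrow> window A w x - window A w (x + 1) = of_bool (x \<in> A) - of_bool (x + w \<in> A)"
proof -
  assume w: "0 \<le> w"
  have "{x..<x + w + 1} = insert (x + w) {x..<x + w}" "{x..<x + w + 1} = insert x {x + 1..<x + 1 + w}"
    using w by auto
  then have "insert (x + w) {x..<x + w} = insert x {x + 1..<x + 1 + w}" by simp
  then have "(\<Sum>z\<in>insert (x + w) {x..<x + w}. of_bool (z \<in> A)) = (\<Sum>z\<in>insert x {x + 1..<x + 1 + w}. (of_bool (z \<in> A) :: int))"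
    by simp
  moreover have "(\<Sum>z\<in>insert (x + w) {x..<x + w}. of_bool (z \<in> A)) = of_bool (x + w \<in> A) + window A w x"
    unfolding window_def by (rule sum.insert) auto
  moreover have "(\<Sum>z\<in>insert x {x + 1..<x + 1 + w}. of_bool (z \<in> A)) = of_bool (x \<in> A) + window A w (x + 1)"
    unfolding window_def by (rule sum.insert) auto
  ultimately show ?thesis by linarith
qed

lemma finite_segment [simp]: "finite {z::int. x \<le> z \<and> z < y \<and> Q z}" "finite {z::int. x \<le> z \<and> z \<le> y \<and> Q z}"
  by (rule finite_subset[of _ "{x..y}"]; auto)+

text \<open>A window count drops from z to z + 1 only if z is in A and z + w is not; such z are what
  the defect of w counts.\<close>

lemma window_telescope:
  assumes "0 \<le> w" "x \<le> y"
  shows "window A w x - window A w y \<le> int (card {z \<in> {x..<y}. z \<in> A \<and> z + w \<notin> A})"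
  using assms(2)
proof (induction y rule: int_ge_induct)
  case base then show ?case by simp
next
  case (step y)
  have "{z \<in> {x..<y + 1}. z \<in> A \<and> z + w \<notin> A} = {z \<in> {x..<y}. z \<in> A \<and> z + w \<notin> A} \<union> {z \<in> {y}. z \<in> A \<and> z + w \<notin> A}"
    using step.hyps by auto
  moreover have "{z \<in> {x..<y}. z \<in> A \<and> z + w \<notin> A} \<inter> {z \<in> {y}. z \<in> A \<and> z + w \<notin> A} = {}" by auto
  ultimately have "card {z \<in> {x..<y + 1}. z \<in> A \<and> z + w \<notin> A}
     = card {z \<in> {x..<y}. z \<in> A \<and> z + w \<notin> A} + card {z \<in> {y}. z \<in> A \<and> z + w \<notin> A}"
    by (simp only:) (rule card_Un_disjoint; simp)
  moreover have "of_bool (y \<in> A) - of_bool (y + w \<in> A) \<le> int (card {z \<in> {y}. z \<in> A \<and> z + w \<notin> A})"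
    by (cases "y \<in> A"; cases "y + w \<in> A") (auto simp: Collect_conv_if)
  ultimately show ?case using step.IH window_step[OF assms(1), of A y] by linarith
qed

lemma pcard_bool: "int (pcard p A) = (\<Sum>x\<in>{0..<p}. of_bool (x \<in> A))"
  by (simp add: pcard_def Int_commute)

lemma sum_window:
  assumes "p > 0" "periodic p A"
  shows "(\<Sum>x\<in>{0..<p}. window A w x) = (\<Sum>i\<in>{0..<w}. int (pcard p A))"
proof -
  have "(\<Sum>x\<in>{0..<p}. window A w x) = (\<Sum>i\<in>{0..<w}. \<Sum>x\<in>{0..<p}. of_bool (x + i \<in> A))"
    unfolding window_eq by (rule sum.swap)
  also have "\<dots> = (\<Sum>i\<in>{0..<w}. int (pcard p A))"
  proof (intro sum.cong refl)
    fix i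
    have "int (pcard p A) = int (pcard p (shift (- i) A))" using assms by simp
    also have "\<dots> = (\<Sum>x\<in>{0..<p}. of_bool (x + i \<in> A))" by (simp only: pcard_bool mem_shift) simp
    finally show "(\<Sum>x\<in>{0..<p}. of_bool (x + i \<in> A)) = int (pcard p A)" by simp
  qed
  finally show ?thesis .
qed

text \<open>The product counts the pairs (i, j) with x + i in A and x + j not in A; summed over x,
  each pair contributes the defect of j - i. As the bound does not grow with p, most windows are
  nearly full or nearly empty.\<close>

lemma sum_window_mult:
  assumes "p > 0" "periodic p A" "0 < w" "\<And>i. \<bar>i\<bar> \<le> w \<Longrightarrow> int (defect p A i) \<le> 3 * w"
  shows "(\<Sum>x\<in>{0..<p}. window A w x * (w - window A w x)) \<le> 3 * w * w * w"
proof -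
  have "(\<Sum>x\<in>{0..<p}. window A w x * (w - window A w x))
      = (\<Sum>x\<in>{0..<p}. \<Sum>i\<in>{0..<w}. \<Sum>j\<in>{0..<w}. of_bool (x + i \<in> A) * of_bool (x + j \<notin> A))"
    using assms(3) by (simp only: window_compl less_imp_le) (simp only: window_eq sum_product)
  also have "\<dots> = (\<Sum>i\<in>{0..<w}. \<Sum>j\<in>{0..<w}. \<Sum>x\<in>{0..<p}. of_bool (x + i \<in> A) * of_bool (x + j \<notin> A))"
    by (subst sum.swap[of _ "{0..<p}"]) (intro sum.cong refl sum.swap)
  also have "\<dots> \<le> (\<Sum>i\<in>{0..<w}. \<Sum>j\<in>{0..<w}. 3 * w)"
  proof (intro sum_mono)
    fix i j assume ij: "i \<in> {0..<w}" "j \<in> {0..<w}"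
    have "(\<Sum>x\<in>{0..<p}. of_bool (x + i \<in> A) * of_bool (x + j \<notin> A)) = int (pcard p (shift (- i) A - shift (- j) A))"
      unfolding pcard_bool by (intro sum.cong refl) simp
    also have "pcard p (shift (- i) A - shift (- j) A) = pcard p (shift j (shift (- i) A - shift (- j) A))"
      using assms(1,2) by (intro pcard_shift[symmetric]) auto
    also have "shift j (shift (- i) A - shift (- j) A) = shift (j - i) A - A" by (simp add: shift_Diff)
    also have "int (pcard p (shift (j - i) A - A)) \<le> 3 * w"
      using assms(4)[of "j - i"] ij by (auto simp: defect_def)
    finally show "(\<Sum>x\<in>{0..<p}. of_bool (x + i \<in> A) * of_bool (x + j \<notin> A)) \<le> 3 * w" .
  qed
  also have "\<dots> = 3 * w * w * w" using assms(3) by simp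
  finally show ?thesis .
qed

text \<open>A passage from a window of length $w$ with density at least $9/10$ to one with density at most
  $1/10$ contributes at least $8w/10$ to the defect of $w$, so there is only one such passage.\<close>

lemma near_arc:
  assumes p: "p > 0" and per: "periodic p A" and w: "0 < w"
    and one: "10 * int (defect p A w) \<le> 11 * w" and all: "\<And>i. \<bar>i\<bar> \<le> w \<Longrightarrow> int (defect p A i) \<le> 3 * w"
    and n: "n = int (pcard p A)" "40 * w < n" "40 * w < p - n"
  obtains a where "int (card ({a..<a + n} - A)) \<le> 75 * w"
proof -
  \<comment> \<open>The case of a sparse window at 0, and hence at p, so that a period can be
    treated as a segment; the general case follows by translation.\<close>
  have aux: "\<exists>a. int (card ({a..<a + n} - A)) \<le> 75 * w"
    if per: "periodic p A" and one: "10 * int (defect p A w) \<le> 11 * w"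
      and all: "\<And>i. \<bar>i\<bar> \<le> w \<Longrightarrow> int (defect p A i) \<le> 3 * w" and n1: "n = int (pcard p A)"
      and low0: "10 * window A w 0 \<le> w" for A
  proof -
    define g where "g = window A w"
    have g: "0 \<le> g x" "g x \<le> w" for x using window_bounds[of w A x] w by (auto simp: g_def)
    have gg: "0 \<le> g x * (w - g x)" for x using g by simp
    have tot: "(\<Sum>x\<in>{0..<p}. g x * (w - g x)) \<le> 3 * w * w * w"
      unfolding g_def by (rule sum_window_mult[OF p per w all])
    \<comment> \<open>Each use divides by w once more and yields a count of at most 36 w.\<close>
    have small: "(\<Sum>x\<in>X. f x) \<le> 36 * w * w"
      if "X \<subseteq> {0..<p}" "\<And>x. x \<in> X \<Longrightarrow> w * f x \<le> 12 * (g x * (w - g x))" for X f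
    proof -
      have "w * (\<Sum>x\<in>X. f x) \<le> (\<Sum>x\<in>X. 12 * (g x * (w - g x)))"
        unfolding sum_distrib_left by (intro sum_mono that)
      also have "\<dots> \<le> (\<Sum>x\<in>{0..<p}. 12 * (g x * (w - g x)))" using that(1) gg by (intro sum_mono2) auto
      also have "\<dots> = 12 * (\<Sum>x\<in>{0..<p}. g x * (w - g x))" by (simp add: sum_distrib_left)
      also have "\<dots> \<le> w * (36 * w * w)" using tot by (simp add: mult_ac)
      finally show ?thesis using w by simp
    qed
    have nonhigh: "w * g x \<le> 12 * (g x * (w - g x))" if "10 * g x < 9 * w" for x
    proof -
      have "g x * w \<le> g x * (12 * (w - g x))" using that g[of x] by (intro mult_left_mono) auto
      then show ?thesis by (simp add: mult_ac)
    qed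
    have nonlow: "w * (w - g x) \<le> 12 * (g x * (w - g x))" if "w < 10 * g x" for x
    proof -
      have "w * (w - g x) \<le> (12 * g x) * (w - g x)" using that g[of x] by (intro mult_right_mono) auto
      then show ?thesis by (simp add: mult_ac)
    qed
    define Hi where "Hi = {x \<in> {0..<p}. 9 * w \<le> 10 * g x}"
    have finHi: "finite Hi" by (rule finite_subset[of _ "{0..<p}"]) (auto simp: Hi_def)
    have "Hi \<noteq> {}"
    proof
      assume "Hi = {}"
      then have "(\<Sum>x\<in>{0..<p}. g x) \<le> 36 * w * w" by (intro small nonhigh) (auto simp: Hi_def)
      moreover have "(\<Sum>x\<in>{0..<p}. g x) = w * n" unfolding g_def sum_window[OF p per] using w n1 by simp
      ultimately have "w * n \<le> w * (36 * w)" by (simp add: mult_ac)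
      then show False using w n by simp
    qed
    define a where "a = Min Hi"
    define b where "b = Max Hi"
    have ab: "a \<in> Hi" "b \<in> Hi" "\<And>x. x \<in> Hi \<Longrightarrow> a \<le> x \<and> x \<le> b"
      unfolding a_def b_def using finHi \<open>Hi \<noteq> {}\<close> by auto
    have a: "0 \<le> a" "a \<le> b" "b < p" "9 * w \<le> 10 * g a" "9 * w \<le> 10 * g b" using ab(1,2) ab(3)[OF ab(1)] by (auto simp: Hi_def)
    have gp: "10 * g p \<le> w"
    proof -
      have "g p = g 0" unfolding g_def window_eq using per by (simp add: periodic_def add.commute)
      then show ?thesis using low0 by (simp add: g_def)
    qed
    \<comment> \<open>Otherwise there are two descents, from a to x and from b to p, where the
      window is sparse again.\<close>
    have mid: "w < 10 * g x" if x: "a \<le> x" "x \<le> b" for x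
    proof (rule ccontr)
      assume "\<not> ?thesis"
      then have lx: "10 * g x \<le> w" by simp
      define L where "L = {z \<in> {0..<p}. z \<in> A \<and> z + w \<notin> A}"
      have "int (card {z \<in> {a..<x}. z \<in> A \<and> z + w \<notin> A}) + int (card {z \<in> {b..<p}. z \<in> A \<and> z + w \<notin> A}) \<le> int (card L)"
      proof -
        have "card ({z \<in> {a..<x}. z \<in> A \<and> z + w \<notin> A} \<union> {z \<in> {b..<p}. z \<in> A \<and> z + w \<notin> A})
          = card {z \<in> {a..<x}. z \<in> A \<and> z + w \<notin> A} + card {z \<in> {b..<p}. z \<in> A \<and> z + w \<notin> A}"
          using x by (intro card_Un_disjoint) auto
        moreover have "card ({z \<in> {a..<x}. z \<in> A \<and> z + w \<notin> A} \<union> {z \<in> {b..<p}. z \<in> A \<and> z + w \<notin> A}) \<le> card L"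
          using x a by (intro card_mono) (auto simp: L_def)
        ultimately show ?thesis by linarith
      qed
      moreover have "g a - g x \<le> int (card {z \<in> {a..<x}. z \<in> A \<and> z + w \<notin> A})"
        "g b - g p \<le> int (card {z \<in> {b..<p}. z \<in> A \<and> z + w \<notin> A})"
        unfolding g_def using w x a by (intro window_telescope; simp)+
      moreover have "card L = defect p A w"
      proof -
        have "L = (A - shift (- w) A) \<inter> {0..<p}" by (auto simp: L_def)
        then have "card L = pcard p (A - shift (- w) A)" by (simp add: pcard_def)
        also have "\<dots> = pcard p (shift (- w) A - A)" by (rule pcard_shift_Diff_sym[OF p per])
        also have "\<dots> = defect p A w" using defect_minus[OF p per, of w] by (simp add: defect_def)
        finally show ?thesis .
      qed
      ultimately show False using one lx gp a w by linarith
    qed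
    \<comment> \<open>A hole in this range lies in w windows starting in [a, b], none of which is
      sparse.\<close>
    define H where "H = {a + w..b} - A"
    have "w * int (card H) \<le> (\<Sum>x\<in>{a..b}. w - g x)"
    proof -
      have "(\<Sum>x\<in>{a..b}. w - g x) = (\<Sum>i\<in>{0..<w}. \<Sum>x\<in>{a..b}. of_bool (x + i \<notin> A))"
        using w by (simp only: g_def window_compl less_imp_le) (rule sum.swap)
      also have "\<dots> \<ge> (\<Sum>i\<in>{0..<w}. int (card H))"
      proof (intro sum_mono)
        fix i assume i: "i \<in> {0..<w}"
        have "card H \<le> card {x \<in> {a..b}. x + i \<notin> A}"
          by (rule card_inj_on_le[of "\<lambda>y. y - i"]) (use i in \<open>auto simp: H_def inj_on_def\<close>)
        also have "int \<dots> = (\<Sum>x\<in>{a..b}. of_bool (x + i \<notin> A))" by (simp add: Int_def)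
        finally show "int (card H) \<le> (\<Sum>x\<in>{a..b}. of_bool (x + i \<notin> A))" by simp
      qed
      finally show ?thesis using w by simp
    qed
    also have "(\<Sum>x\<in>{a..b}. w - g x) \<le> 36 * w * w"
      using a mid by (intro small nonlow) auto
    finally have cH: "int (card H) \<le> 36 * w" using w by (simp add: mult_ac)
    \<comment> \<open>Dually, such an element lies in w windows that start outside [a, b] and are
      not dense. The first w positions are left out, since some of their windows start before
      0.\<close>
    define Out where "Out = A \<inter> ({w..<a} \<union> {b + w..<p})"
    define Z where "Z = {0..<a} \<union> {b + 1..<p}"
    have finZ: "finite Z" by (simp add: Z_def)
    have "w * int (card Out) \<le> (\<Sum>x\<in>Z. g x)"
    proof -
      have "(\<Sum>x\<in>Z. g x) = (\<Sum>i\<in>{0..<w}. \<Sum>x\<in>Z. of_bool (x + i \<in> A))"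
        unfolding g_def window_eq by (rule sum.swap)
      also have "\<dots> \<ge> (\<Sum>i\<in>{0..<w}. int (card Out))"
      proof (intro sum_mono)
        fix i assume i: "i \<in> {0..<w}"
        have "card Out \<le> card {x \<in> Z. x + i \<in> A}"
          by (rule card_inj_on_le[of "\<lambda>y. y - i"]) (use i a finZ in \<open>auto simp: Out_def Z_def inj_on_def\<close>)
        also have "int \<dots> = (\<Sum>x\<in>Z. of_bool (x + i \<in> A))" using finZ by (simp add: Int_def)
        finally show "int (card Out) \<le> (\<Sum>x\<in>Z. of_bool (x + i \<in> A))" by simp
      qed
      finally show ?thesis using w by simp
    qed
    also have "(\<Sum>x\<in>Z. g x) \<le> 36 * w * w"
    proof (intro small nonhigh)
      show "Z \<subseteq> {0..<p}" using a by (auto simp: Z_def)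
      fix x assume x: "x \<in> Z"
      have "x \<notin> Hi" using x ab(3)[of x] by (auto simp: Z_def)
      moreover have "x \<in> {0..<p}" using x a by (auto simp: Z_def)
      ultimately show "10 * g x < 9 * w" by (auto simp: Hi_def)
    qed
    finally have cOut: "int (card Out) \<le> 36 * w" using w by (simp add: mult_ac)
    have len: "n \<le> 38 * w + (b - a)"
    proof -
      have "A \<inter> {0..<p} \<subseteq> {0..<w} \<union> (Out \<union> {a..<b + w})" by (auto simp: Out_def)
      then have "card (A \<inter> {0..<p}) \<le> card ({0..<w} \<union> (Out \<union> {a..<b + w}))"
        by (intro card_mono) (auto simp: Out_def)
      also have "\<dots> \<le> card {0..<w} + (card Out + card {a..<b + w})"
        by (meson card_Un_le order_trans add_left_mono)
      finally have "int (card (A \<inter> {0..<p})) \<le> int (card {0..<w} + (card Out + card {a..<b + w}))"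
        by (simp only: of_nat_le_iff)
      then have "n \<le> int (card {0..<w} + (card Out + card {a..<b + w}))" by (simp only: n1 pcard_def)
      also have "\<dots> = w + (int (card Out) + (b + w - a))" using w a by simp
      finally show ?thesis using cOut by simp
    qed
    \<comment> \<open>75 = 1 + 36 + 38: the first w places, the holes in the middle, and the part of
      the arc beyond b.\<close>
    have "card ({a..<a + n} - A) \<le> card ({a..<a + w} \<union> (H \<union> {b + 1..<a + n}))"
      by (intro card_mono) (auto simp: H_def)
    also have "\<dots> \<le> card {a..<a + w} + (card H + card {b + 1..<a + n})"
      by (meson card_Un_le order_trans add_left_mono)
    finally have "int (card ({a..<a + n} - A)) \<le> int (card {a..<a + w} + (card H + card {b + 1..<a + n}))"
      by (simp only: of_nat_le_iff)
    also have "\<dots> = w + (int (card H) + int (nat (a + n - (b + 1))))" using w by simp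
    finally have "int (card ({a..<a + n} - A)) \<le> w + (int (card H) + int (nat (a + n - (b + 1))))" .
    moreover have "int (nat (a + n - (b + 1))) \<le> 38 * w" using len w by linarith
    ultimately show ?thesis using cH by (intro exI[of _ a]) linarith
  qed
  have "\<exists>x\<in>{0..<p}. 10 * window A w x \<le> w"
  proof (rule ccontr)
    assume no: "\<not> ?thesis"
    have "w * (\<Sum>x\<in>{0..<p}. w - window A w x) \<le> (\<Sum>x\<in>{0..<p}. 12 * (window A w x * (w - window A w x)))"
      unfolding sum_distrib_left
    proof (intro sum_mono)
      fix x assume "x \<in> {0..<p}"
      then have "w < 10 * window A w x" using no by (simp add: not_le)
      then have "w * (w - window A w x) \<le> (12 * window A w x) * (w - window A w x)"
        using window_bounds[of w A x] w by (intro mult_right_mono) auto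
      then show "w * (w - window A w x) \<le> 12 * (window A w x * (w - window A w x))" by (simp add: mult_ac)
    qed
    also have "\<dots> = 12 * (\<Sum>x\<in>{0..<p}. window A w x * (w - window A w x))" by (simp only: sum_distrib_left)
    also have "\<dots> \<le> w * (36 * w * w)" using sum_window_mult[OF p per w all] by (simp add: mult_ac)
    finally have "(\<Sum>x\<in>{0..<p}. w - window A w x) \<le> 36 * w * w" using w by simp
    moreover have "(\<Sum>x\<in>{0..<p}. w - window A w x) = w * (p - n)"
      unfolding sum_subtractf sum_window[OF p per] using w p n by (simp add: algebra_simps)
    ultimately have "w * (p - n) \<le> w * (36 * w)" by (simp add: mult_ac)
    then show False using w n by simp
  qed
  then obtain x where x: "10 * window A w x \<le> w" by blast
  define A' where "A' = shift (- x) A"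
  have def': "defect p A' i = defect p A i" for i
  proof -
    have "shift i A' - A' = shift (- x) (shift i A - A)" by (auto simp: A'_def algebra_simps)
    moreover have "periodic p (shift i A - A)" using per by auto
    ultimately show ?thesis using p by (simp add: defect_def)
  qed
  have "\<exists>a. int (card ({a..<a + n} - A')) \<le> 75 * w"
  proof (rule aux)
    show "n = int (pcard p A')" using p per n by (simp add: A'_def)
    have "window A' w 0 = window A w x" by (simp add: window_eq A'_def add.commute)
    then show "10 * window A' w 0 \<le> w" using x by simp
  qed (use per one all def' in \<open>auto simp: A'_def\<close>)
  then obtain a where a: "int (card ({a..<a + n} - A')) \<le> 75 * w" by blast
  have "card ({a + x..<a + x + n} - A) = card ({a..<a + n} - A')"
    by (rule bij_betw_same_card[of "\<lambda>z. z - x"], rule bij_betw_byWitness[of _ "\<lambda>z. z + x"]) (auto simp: A'_def)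
  then show ?thesis using that[of "a + x"] a by simp
qed

subsection \<open>B is contained in a short interval\<close>

definition arc :: "int \<Rightarrow> int \<Rightarrow> int set" where
  "arc p n = {z. z mod p < n}"

lemma periodic_arc [intro]: "periodic p (arc p n)"
  by (simp add: periodic_def arc_def)

lemma mem_arcI: "\<lbrakk>[z = k] (mod p); 0 \<le> k; k < n; n \<le> p\<rbrakk> \<Longrightarrow> z \<in> arc p n"
  by (simp add: arc_def cong_def)

lemma mem_arcE:
  assumes "z \<in> arc p n" "p > 0" obtains k where "[z = k] (mod p)" "0 \<le> k" "k < n"
  using that[of "z mod p"] assms by (simp add: arc_def cong_def)

lemma pcard_arc: "0 \<le> n \<Longrightarrow> n \<le> p \<Longrightarrow> pcard p (arc p n) = nat n"
proof -
  assume "0 \<le> n" "n \<le> p"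
  then have "arc p n \<inter> {0..<p} = {0..<n}" by (auto simp: arc_def)
  then show ?thesis by (simp add: pcard_def)
qed

text \<open>The arcs starting at b and b' leave nothing uncovered between them because b' \<le> b +
  n; hence only gaps of B longer than n matter.\<close>

lemma shift_arc_fill:
  assumes "p > 0" "n \<le> p" "b \<le> x" "x < b'" "b' \<le> b + n"
  shows "shift x (arc p n) \<subseteq> shift b (arc p n) \<union> shift b' (arc p n)"
proof
  fix z assume "z \<in> shift x (arc p n)"
  then have "z - x \<in> arc p n" by simp
  then obtain r where r: "[z - x = r] (mod p)" "0 \<le> r" "r < n" using mem_arcE assms(1) by blast
  have *: "[z - y = x + r - y] (mod p)" for y
    using r(1) by (simp add: cong_iff_dvd_diff algebra_simps)
  show "z \<in> shift b (arc p n) \<union> shift b' (arc p n)"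
  proof (cases "x + r < b + n")
    case True
    then have "z - b \<in> arc p n" using r assms by (intro mem_arcI[OF *[of b]]) auto
    then show ?thesis by simp
  next
    case False
    then have "z - b' \<in> arc p n" using r assms by (intro mem_arcI[OF *[of b']]) auto
    then show ?thesis by simp
  qed
qed

lemma periodic_predecessor:
  assumes "p > 0" "periodic p B" "B \<noteq> {}"
  obtains b where "b \<in> B" "b \<le> x" "\<And>c. c \<in> B \<Longrightarrow> c \<le> x \<Longrightarrow> c \<le> b"
proof -
  obtain b0 where "b0 \<in> B" using assms(3) by auto
  define y where "y = x - (x - b0) mod p"
  have "y - b0 = p * ((x - b0) div p)" unfolding y_def using minus_mod_eq_mult_div[of "x - b0" p] by linarith
  then have "[y = b0] (mod p)" by (simp add: cong_iff_dvd_diff)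
  then have "y \<in> B" using \<open>b0 \<in> B\<close> periodic_cong[OF assms(2)] by blast
  have xy: "x - p \<le> y" "y \<le> x" unfolding y_def using assms(1) pos_mod_bound[of p "x - b0"] by (auto simp: less_imp_le)
  define F where "F = B \<inter> {y..x}"
  have F: "finite F" "y \<in> F" using \<open>y \<in> B\<close> xy by (auto simp: F_def)
  have M: "Max F \<in> F" using F by (intro Max_in) auto
  show ?thesis
  proof (rule that[of "Max F"])
    fix c assume c: "c \<in> B" "c \<le> x"
    show "c \<le> Max F"
    proof (cases "y \<le> c")
      case True
      then show ?thesis using c F by (intro Max_ge) (auto simp: F_def)
    next
      case False
      then show ?thesis using M by (auto simp: F_def)
    qed
  qed (use M in \<open>auto simp: F_def\<close>)
qed

text \<open>The set $B$ has a gap longer than $n$, as otherwise the translates of the arc by $B$ cover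
  everything; it has no second one, as both parts of $B$ would contribute $n$ to the size of $S$.\<close>

lemma confined_to_interval:
  fixes \<epsilon> K E :: real and n :: int
  assumes pr: "prime p" and perB: "periodic p B" and perS: "periodic p S" and B0: "B \<noteq> {}" and n0: "0 < n"
    and small: "\<And>b. b \<in> B \<Longrightarrow> 2 * real (pcard p (shift b (arc p n) - S)) \<le> \<epsilon>\<^sup>2 * n"
    and S: "real (pcard p S) \<le> n + real (pcard p B)"
    and \<epsilon>: "0 < \<epsilon>" "\<epsilon> \<le> 1" "1 \<le> K" and E: "E = (1 + K) * \<epsilon> * n + 1"
    and EK: "pcard p B + E + 1 \<le> K * n" "n + pcard p B + E + 1 \<le> p" "2 * E < n"
  obtains x M where "x \<in> B" "x + M \<in> B" "0 \<le> M" "M + 1 \<le> pcard p B + E" "\<And>b. b \<in> B \<Longrightarrow> (b - x) mod p \<le> M"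
proof -
  have p: "p > 0" using pr prime_gt_0_int by blast
  define I where "I = arc p n"
  define m where "m = pcard p B"
  have E0: "E > 0" using \<epsilon> n0 E by (simp add: add_nonneg_pos)
  have np: "n \<le> p" using EK(2) E0 by linarith
  have perI: "periodic p I" by (auto simp: I_def)
  have cI: "real (pcard p I) = n" using n0 np by (simp add: I_def pcard_arc)
  have "I \<noteq> {}" using cI n0 by auto
  have fill: "real (pcard p (shift x I - S)) \<le> \<epsilon>\<^sup>2 * pcard p I" if "b \<in> B" "b' \<in> B" "b \<le> x" "x < b'" "b' \<le> b + n" for b b' x
  proof -
    have "shift x I - S \<subseteq> (shift b I - S) \<union> (shift b' I - S)"
      using shift_arc_fill[OF p np that(3-5)] by (auto simp: I_def)
    then have "pcard p (shift x I - S) \<le> pcard p (shift b I - S) + pcard p (shift b' I - S)"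
      using pcard_mono pcard_Un_le order_trans by metis
    then show ?thesis using small[OF that(1)] small[OF that(2)] by (simp add: cI I_def[symmetric])
  qed
  have single: "real (pcard p (shift b I - S)) \<le> \<epsilon>\<^sup>2 * pcard p I" if "b \<in> B" for b
    using small[OF that] by (simp add: cI I_def[symmetric])
  have upper: "real (pcard p W) \<le> m + E"
    if "periodic p W" "\<And>w. w \<in> W \<Longrightarrow> real (pcard p (shift w I - S)) \<le> \<epsilon>\<^sup>2 * pcard p I" for W
    by (rule robust_upper[OF pr perI that(1) \<open>I \<noteq> {}\<close> that(2) \<epsilon>]) (use S E EK in \<open>auto simp: cI m_def\<close>)
  \<comment> \<open>Without a gap longer than n, every x lies between two elements of B at distance
    at most n. All translates of the arc would then almost lie in S, against
    \<open>upper\<close>.\<close>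
  have "\<exists>b\<in>B. \<forall>b'\<in>B. b < b' \<longrightarrow> b + n < b'"
  proof (rule ccontr)
    assume no: "\<not> ?thesis"
    have "real (pcard p UNIV) \<le> m + E"
    proof (rule upper)
      fix x
      obtain b where b: "b \<in> B" "b \<le> x" "\<And>c. c \<in> B \<Longrightarrow> c \<le> x \<Longrightarrow> c \<le> b"
        using periodic_predecessor[OF p perB B0] by metis
      with no obtain b' where b': "b' \<in> B" "b < b'" "b' \<le> b + n" by (meson not_le)
      then have "x < b'" using b(3)[OF b'(1)] by linarith
      then show "real (pcard p (shift x I - S)) \<le> \<epsilon>\<^sup>2 * pcard p I" using fill b b' by blast
    qed auto
    then show False using EK(2) p n0 by (simp add: m_def)
  qed
  then obtain b0 where b0: "b0 \<in> B" "\<And>b. b \<in> B \<Longrightarrow> b0 < b \<Longrightarrow> b0 + n < b" by blast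
  have add_p: "c + p \<in> B \<longleftrightarrow> c \<in> B" for c using perB by (simp add: periodic_def)
  have min_p: "c - p \<in> B \<longleftrightarrow> c \<in> B" for c using add_p[of "c - p"] by simp
  define F where "F = B \<inter> {b0 + 1..b0 + p}"
  have F: "finite F" "b0 + p \<in> F" using b0 p add_p by (auto simp: F_def)
  define x where "x = Min F"
  have xF: "x \<in> F" unfolding x_def using F by (intro Min_in) auto
  have xB: "x \<in> B" "b0 < x" "x \<le> b0 + p" using xF by (auto simp: F_def)
  have xmin: "x \<le> c" if "c \<in> B" "b0 < c" for c
  proof (cases "c \<le> b0 + p")
    case True
    then show ?thesis unfolding x_def using that F by (intro Min_le) (auto simp: F_def)
  qed (use xB in simp)
  have xn: "b0 + n < x" by (rule b0(2)[OF xB(1,2)])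
  \<comment> \<open>[x, x + M] is what the gap leaves of a period, from its right end x to the next
    copy of its left end b0.\<close>
  define M where "M = b0 + p - x"
  have M: "0 \<le> M" "M + n < p" "x + M \<in> B"
    using xB xn b0(1) add_p unfolding M_def by (linarith, linarith, simp)
  have red: "(b - x) mod p \<le> M \<and> x + (b - x) mod p \<in> B" if "b \<in> B" for b
  proof
    have "[x + (b - x) mod p = x + (b - x)] (mod p)" by (simp add: cong_def mod_add_right_eq)
    then show *: "x + (b - x) mod p \<in> B" using periodic_cong[OF perB] that by (metis add_diff_cancel_left' diff_add_cancel add.commute)
    show "(b - x) mod p \<le> M"
    proof (rule ccontr)
      assume "\<not> ?thesis"
      then have "b0 < x + (b - x) mod p - p" by (simp add: M_def)
      then have "x \<le> x + (b - x) mod p - p" using * min_p by (intro xmin) auto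
      then show False using pos_mod_bound[OF p, of "b - x"] by linarith
    qed
  qed
  have gap: "\<exists>b'\<in>B. b < b' \<and> b' \<le> b + n" if b: "b \<in> B" "x \<le> b" "b < x + M" for b
  proof (rule ccontr)
    assume no: "\<not> ?thesis"
    define l where "l = b - x"
    have l: "0 \<le> l" "l < M" using b by (auto simp: l_def)
    \<comment> \<open>A second long gap splits B into B1 and the rest, and Q separates the
      translates of the arc by the two parts. Both parts satisfy the lower bound on their own, so 2
      n + m \<le> |S| + 2 E, which is impossible for |S| \<le> n + m and 2 E < n.\<close>
    define B1 where "B1 = B \<inter> {z. (z - x) mod p \<le> l}"
    define Q where "Q = {z. (z - x) mod p < l + n}"
    have perB1: "periodic p B1" unfolding B1_def by (rule periodic_Int[OF perB periodic_residue])
    have perQ: "periodic p Q" unfolding Q_def by (rule periodic_residue)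
    have lower: "n + real (pcard p B') \<le> pcard p S' + E"
      if B': "B' \<subseteq> B" "periodic p B'" "B' \<noteq> {}" and S': "\<And>w. w \<in> B' \<Longrightarrow> shift w I - S' = shift w I - S" for B' S'
    proof -
      have "pcard p B' \<le> m" unfolding m_def using B'(1) by (rule pcard_mono)
      then have "real (pcard p I + pcard p B') \<le> pcard p S' + (1 + K) * \<epsilon> * pcard p I + 1"
        using B' S' single \<epsilon> EK E0 p n0 \<open>I \<noteq> {}\<close> cI
        by (intro robust_lower[OF pr perI B'(2)]) (auto simp: m_def)
      then show ?thesis by (simp add: cI E)
    qed
    have inI: "(w + r - x) mod p = (w - x) mod p + r" if "(w - x) mod p + r < p" "0 \<le> r" for w r
    proof -
      have "w + r - x = (w - x) + r" by simp
      then have "(w + r - x) mod p = ((w - x) mod p + r) mod p" by (simp only: mod_add_left_eq)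
      also have "\<dots> = (w - x) mod p + r" using that p by (intro mod_pos_pos_trivial) auto
      finally show ?thesis .
    qed
    have memI: "\<exists>r. 0 \<le> r \<and> r < n \<and> (z - x) mod p = (w + r - x) mod p" if "z \<in> shift w I" for z w
    proof -
      have "z - w \<in> arc p n" using that by (simp add: I_def)
      then obtain r where r: "[z - w = r] (mod p)" "0 \<le> r" "r < n" using mem_arcE p by blast
      have "[z - x = w + r - x] (mod p)" using r(1) by (simp add: cong_iff_dvd_diff algebra_simps)
      then show ?thesis using r by (auto simp: cong_def)
    qed
    have "n + real (pcard p B1) \<le> pcard p (S \<inter> Q) + E"
    proof (rule lower)
      have "x \<in> B1" using xB l by (simp add: B1_def)
      then show "B1 \<noteq> {}" by auto
      fix w assume w: "w \<in> B1"
      have "shift w I \<subseteq> Q"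
      proof
        fix z assume "z \<in> shift w I"
        then obtain r where r: "0 \<le> r" "r < n" "(z - x) mod p = (w + r - x) mod p" using memI by blast
        moreover have "(w - x) mod p \<le> l" using w by (simp add: B1_def)
        ultimately show "z \<in> Q" using inI[of w r] l M by (simp add: Q_def)
      qed
      then show "shift w I - (S \<inter> Q) = shift w I - S" by auto
    qed (use perB1 in \<open>auto simp: B1_def\<close>)
    moreover have "n + real (pcard p (B - B1)) \<le> pcard p (S - Q) + E"
    proof (rule lower)
      have "(x + M - x) mod p = M" using M n0 by simp
      then have "x + M \<in> B - B1" using M l by (simp add: B1_def)
      then show "B - B1 \<noteq> {}" by auto
      fix w assume w: "w \<in> B - B1"
      define r0 where "r0 = (w - x) mod p"
      have r0: "l < r0" "r0 \<le> M" "x + r0 \<in> B" using w red[of w] by (auto simp: B1_def r0_def)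
      have "l + n < r0"
      proof (rule ccontr)
        assume "\<not> ?thesis"
        then have "b < x + r0" "x + r0 \<le> b + n" using r0 by (auto simp: l_def)
        then show False using no r0 by blast
      qed
      then have "shift w I \<inter> Q = {}"
      proof (intro equals0I)
        fix z assume z: "z \<in> shift w I \<inter> Q"
        then obtain r where r: "0 \<le> r" "r < n" "(z - x) mod p = (w + r - x) mod p" using memI by blast
        then have "(z - x) mod p = r0 + r" using inI[of w r] r0 M by (simp add: r0_def)
        then show False using z \<open>l + n < r0\<close> r by (simp add: Q_def)
      qed
      then show "shift w I - (S - Q) = shift w I - S" by auto
    qed (use perB perB1 in auto)
    moreover have "pcard p (S - Q) + pcard p (S \<inter> Q) = pcard p S" by (rule pcard_Diff_Int)
    moreover have "pcard p (B - B1) + pcard p B1 = pcard p B"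
      using pcard_Diff_Int[of p B B1] by (simp add: B1_def Int_assoc[symmetric])
    ultimately show False using S EK(3) by linarith
  qed
  \<comment> \<open>Inside [x, x + M] all gaps are at most n, so all translates by it almost lie in
    S and \<open>upper\<close> bounds its length.\<close>
  have "real (pcard p {z. (z - x) mod p \<le> M}) \<le> m + E"
  proof (rule upper)
    show "periodic p {z. (z - x) mod p \<le> M}" by (rule periodic_residue)
    fix w assume "w \<in> {z. (z - x) mod p \<le> M}"
    then have r: "(w - x) mod p \<le> M" by simp
    define y where "y = x + (w - x) mod p"
    have "[w = y] (mod p)" unfolding y_def by (simp add: cong_iff_dvd_diff diff_diff_eq[symmetric] minus_mod_eq_mult_div)
    then have wy: "shift w I = shift y I" by (rule shift_cong[OF perI])
    have y: "x \<le> y" "y \<le> x + M" using r p by (auto simp: y_def)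
    show "real (pcard p (shift w I - S)) \<le> \<epsilon>\<^sup>2 * pcard p I"
    proof (cases "y \<in> B")
      case True
      then show ?thesis using single wy by simp
    next
      case False
      obtain b where b: "b \<in> B" "b \<le> y" "\<And>c. c \<in> B \<Longrightarrow> c \<le> y \<Longrightarrow> c \<le> b"
        using periodic_predecessor[OF p perB B0] by metis
      have "b \<noteq> y" using b(1) False by auto
      moreover have "x \<le> b" using b(3) xB y by blast
      ultimately obtain b' where b': "b' \<in> B" "b < b'" "b' \<le> b + n" using gap[of b] b y by force
      then have "y < b'" using b(3)[OF b'(1)] by linarith
      then show ?thesis using fill[of b b' y] b b' wy by simp
    qed
  qed
  moreover have "pcard p {z. (z - x) mod p \<le> M} = nat (M + 1)"
  proof -
    have "{z. (z - x) mod p \<le> M} = shift x (arc p (M + 1))" by (auto simp: arc_def)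
    then show ?thesis using p M n0 by (simp add: periodic_arc pcard_arc)
  qed
  ultimately have "real_of_int M + 1 \<le> pcard p B + E" using M by (simp add: m_def)
  from that[OF xB(1) M(3) M(1) this] red show ?thesis by simp
qed

subsection \<open>Covering with boundedly many translates\<close>

lemma sum_pcard_shift_commute:
  assumes "p > 0" "periodic p X" "periodic p Y"
  shows "(\<Sum>b\<in>Y \<inter> {0..<p}. pcard p (shift b X \<inter> S)) = (\<Sum>a\<in>X \<inter> {0..<p}. pcard p (shift a Y \<inter> S))"
  unfolding sum_reps_Int[OF assms(1,2), symmetric] sum_reps_Int[OF assms(1,3), symmetric]
  by (intro sum.cong refl reps_commute assms)

lemma pcard_interval:
  assumes "0 \<le> l" "l < p" "periodic p X"
  shows "pcard p (X \<inter> {z. (z - u) mod p \<le> l}) = card (X \<inter> {u..u + l})"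
proof -
  have per: "periodic p (X \<inter> {z. (z - u) mod p \<le> l})"
    by (rule periodic_Int[OF assms(3) periodic_residue])
  have "pcard p (X \<inter> {z. (z - u) mod p \<le> l}) = pcard p (shift (- u) (X \<inter> {z. (z - u) mod p \<le> l}))"
    using assms per by simp
  also have "\<dots> = card {z \<in> {0..l}. z + u \<in> X}"
    unfolding pcard_def using assms by (intro arg_cong[where f = card]) auto
  also have "\<dots> = card (X \<inter> {u..u + l})"
    by (rule bij_betw_same_card[of "\<lambda>z. z + u"], rule bij_betw_byWitness[of _ "\<lambda>z. z - u"]) auto
  finally show ?thesis .
qed

lemma card_Diff_plus_Int: "finite X \<Longrightarrow> card X = card (X - Y) + card (Y \<inter> X)"
proof -
  assume "finite X"
  then have "card ((X - Y) \<union> (Y \<inter> X)) = card (X - Y) + card (Y \<inter> X)" by (intro card_Un_disjoint) auto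
  moreover have "(X - Y) \<union> (Y \<inter> X) = X" by auto
  ultimately show ?thesis by simp
qed

text \<open>Any single translate misses exactly the $q$ holes of the core; a second one, chosen by averaging
  close to the first, fills all but a small proportion of them.\<close>

lemma cover_translate:
  fixes d s q u l b :: int
  assumes holes: "int (card ({u - s..u + l + s} - A)) \<le> d"
    and q: "q = int (card ({u..u + l} - A))"
    and W: "W \<subseteq> B \<inter> {b - s..b + s}" "k \<le> int (card W)" and b: "b \<in> B" "0 < k"
  obtains b' where "b' \<in> B" "int (card ({u + b..u + l + b} - (shift b A \<union> shift b' A))) * k \<le> q * d"
proof -
  define H where "H = {u + b..u + l + b} - shift b A"
  have finW: "finite W" using W(1) finite_subset by blast
  have "card H = card ({u..u + l} - A)" unfolding H_def
    by (rule bij_betw_same_card[of "\<lambda>z. z - b"], rule bij_betw_byWitness[of _ "\<lambda>z. z + b"]) auto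
  then have cH: "int (card H) = q" using q by simp
  \<comment> \<open>Double counting: for fixed x the points x - b' lie within s of the core, so x is
    missed by at most d of the b'.\<close>
  have "(\<Sum>b'\<in>W. int (card (H - shift b' A))) = (\<Sum>b'\<in>W. \<Sum>x\<in>H. of_bool (x - b' \<notin> A))"
    by (intro sum.cong refl) (auto simp: H_def intro!: arg_cong[where f = card])
  also have "\<dots> = (\<Sum>x\<in>H. \<Sum>b'\<in>W. of_bool (x - b' \<notin> A))" by (rule sum.swap)
  also have "\<dots> \<le> (\<Sum>x\<in>H. d)"
  proof (intro sum_mono)
    fix x assume x: "x \<in> H"
    have "card {b' \<in> W. x - b' \<notin> A} \<le> card ({u - s..u + l + s} - A)"
      by (rule card_inj_on_le[of "\<lambda>b'. x - b'"]) (use x W(1) in \<open>auto simp: H_def inj_on_def\<close>)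
    moreover have "(\<Sum>b'\<in>W. of_bool (x - b' \<notin> A)) = int (card {b' \<in> W. x - b' \<notin> A})"
      using finW by (simp add: Int_def)
    ultimately show "(\<Sum>b'\<in>W. of_bool (x - b' \<notin> A)) \<le> d" using holes by simp
  qed
  also have "\<dots> = q * d" by (simp add: cH)
  finally have sum: "(\<Sum>b'\<in>W. int (card (H - shift b' A))) \<le> q * d" .
  have "\<exists>b'\<in>W. int (card (H - shift b' A)) * k \<le> q * d"
  proof (rule ccontr)
    assume no: "\<not> ?thesis"
    have d0: "0 \<le> q * d" using q holes by (simp add: order_trans[OF of_nat_0_le_iff])
    have "W \<noteq> {}" using W(2) b(2) by auto
    have pos: "1 \<le> int (card (H - shift b' A))" if "b' \<in> W" for b'
      using no that d0 by (cases "card (H - shift b' A) = 0") auto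
    define t where "t = Min ((\<lambda>b'. int (card (H - shift b' A))) ` W)"
    have t: "t \<in> (\<lambda>b'. int (card (H - shift b' A))) ` W" unfolding t_def using finW \<open>W \<noteq> {}\<close> by (intro Min_in) auto
    then have tk: "q * d < t * k" "0 < t" using no pos by force+
    have "t * k \<le> t * int (card W)" using W(2) tk(2) by (intro mult_left_mono) auto
    also have "\<dots> = (\<Sum>b'\<in>W. t)" by simp
    also have "\<dots> \<le> (\<Sum>b'\<in>W. int (card (H - shift b' A)))"
      unfolding t_def using finW by (intro sum_mono Min_le) auto
    finally show False using sum tk by linarith
  qed
  then obtain b' where "b' \<in> W" "int (card (H - shift b' A)) * k \<le> q * d" by blast
  moreover have "H - shift b' A = {u + b..u + l + b} - (shift b A \<union> shift b' A)" by (auto simp: H_def)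
  ultimately show ?thesis using that W(1) by auto
qed

text \<open>At most L translates of the core cover the whole interval. Each gets a partner from
  \<open>cover_translate\<close>, after which at most q d / (k + 1) of its q holes are left; k = d L
  makes the total at most q. So all of them together have no more holes than a single one.\<close>

lemma cover_core:
  fixes d s \<tau> l M :: int
  assumes holes: "int (card ({0..l + 2 * s} - A)) \<le> d"
    and B: "0 \<in> B" "M \<in> B" "0 \<le> M" "int (card ({0..M} - B)) \<le> d"
    and par: "d < \<tau>" "2 * \<tau> \<le> l" "0 \<le> s" "2 * s \<le> M" "M div \<tau> + 3 \<le> int L" "d * (int L + 1) \<le> s"
  obtains F where "finite F" "F \<subseteq> B" "card F \<le> 2 * L"
    "card ({s..s + l + M} - translates A F) \<le> card ({s..s + l} - A)"
proof -
  define q where "q = int (card ({s..s + l} - A))"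
  define k where "k = d * int L"
  have d0: "0 \<le> d" using holes by linarith
  have \<tau>: "0 < \<tau>" using d0 par(1) by simp
  have k0: "0 \<le> k" using d0 by (simp add: k_def)
  have q0: "0 \<le> q" by (simp add: q_def)
  have ex: "\<exists>c\<in>B. y \<le> c \<and> c \<le> y + d" if "0 \<le> y" "y + d \<le> M" for y
  proof (rule ccontr)
    assume "\<not> ?thesis"
    then have "{y..y + d} \<subseteq> {0..M} - B" using that by fastforce
    then have "card {y..y + d} \<le> card ({0..M} - B)" by (intro card_mono) auto
    then show False using B(4) d0 by simp
  qed
  have pair: "\<exists>b'. b' \<in> B \<and> int (card ({s + b..s + l + b} - (shift b A \<union> shift b' A))) * (k + 1) \<le> q * d"
    if b: "b \<in> B" "0 \<le> b" "b \<le> M" for b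
  proof -
    \<comment> \<open>A window of s + 1 positions around b inside [0, M]: to the left of b if there
      is room, else to the right. B contains all but d of them.\<close>
    define lo where "lo = (if s \<le> b then b - s else b)"
    define W where "W = B \<inter> {lo..lo + s}"
    have lo: "0 \<le> lo" "lo + s \<le> M" "b - s \<le> lo" "lo \<le> b" using b par(3,4) by (auto simp: lo_def)
    have "card {lo..lo + s} \<le> card (W \<union> ({0..M} - B))"
      using lo by (intro card_mono) (auto simp: W_def)
    also have "\<dots> \<le> card W + card ({0..M} - B)" by (rule card_Un_le)
    finally have "int (card {lo..lo + s}) \<le> int (card W) + int (card ({0..M} - B))" by linarith
    then have "s + 1 \<le> int (card W) + d" using B(4) par(3) by simp
    then have kW: "k + 1 \<le> int (card W)" using par(6) unfolding k_def by (simp add: algebra_simps)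
    obtain b' where "b' \<in> B" "int (card ({s + b..s + l + b} - (shift b A \<union> shift b' A))) * (k + 1) \<le> q * d"
    proof (rule cover_translate[of s s l A d q W B b "k + 1"])
      have "{s - s..s + l + s} = {0..l + 2 * s}" by auto
      then show "int (card ({s - s..s + l + s} - A)) \<le> d" using holes by (simp only:)
      show "W \<subseteq> B \<inter> {b - s..b + s}" using lo by (auto simp: W_def)
    qed (use kW k0 b q_def in auto)
    then show ?thesis by blast
  qed
  define g where "g b = (SOME b'. b' \<in> B \<and> int (card ({s + b..s + l + b} - (shift b A \<union> shift b' A))) * (k + 1) \<le> q * d)" for b
  have g: "g b \<in> B" "int (card ({s + b..s + l + b} - (shift b A \<union> shift (g b) A))) * (k + 1) \<le> q * d"
    if "b \<in> B" "0 \<le> b" "b \<le> M" for b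
    using someI_ex[OF pair[OF that]] unfolding g_def by auto
  \<comment> \<open>With at most d holes in [0, M], the set B meets every block of d + 1 consecutive
    integers there. For blocks that stick out the default 0 is an element of B anyway.\<close>
  define f where "f i = (if i * \<tau> + d \<le> M then SOME c. c \<in> B \<and> i * \<tau> \<le> c \<and> c \<le> i * \<tau> + d else 0)" for i
  have f: "f i \<in> B \<and> i * \<tau> \<le> f i \<and> f i \<le> i * \<tau> + d" if "0 \<le> i" "i * \<tau> + d \<le> M" for i
  proof -
    have "\<exists>c. c \<in> B \<and> i * \<tau> \<le> c \<and> c \<le> i * \<tau> + d" using ex[of "i * \<tau>"] that \<tau> by auto
    from someI_ex[OF this] show ?thesis using that by (simp add: f_def)
  qed
  define F0 where "F0 = {0, M} \<union> f ` {0..M div \<tau>}"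
  have F0: "b \<in> B \<and> 0 \<le> b \<and> b \<le> M" if b: "b \<in> F0" for b
  proof -
    consider "b = 0 \<or> b = M" | i where "0 \<le> i" "b = f i" using b unfolding F0_def by auto
    then show ?thesis
    proof cases
      case 1
      then show ?thesis using B by auto
    next
      case (2 i)
      show ?thesis
      proof (cases "i * \<tau> + d \<le> M")
        case True
        have "0 \<le> i * \<tau>" using 2 \<tau> by simp
        then show ?thesis using f[OF 2(1) True] 2(2) True by auto
      next
        case False
        then show ?thesis using 2 B by (simp add: f_def)
      qed
    qed
  qed
  have finF0: "finite F0" by (simp add: F0_def)
  have cF0: "card F0 \<le> L"
  proof -
    have "card F0 \<le> card {0, M} + card (f ` {0..M div \<tau>})" unfolding F0_def by (rule card_Un_le)
    also have "card {0, M} \<le> 2" by (simp add: card_insert_if)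
    also have "card (f ` {0..M div \<tau>}) \<le> card {0..M div \<tau>}" by (rule card_image_le) simp
    finally have "card F0 \<le> 2 + nat (M div \<tau> + 1)" by simp
    moreover have "0 \<le> M div \<tau>" using B(3) \<tau> by (simp add: pos_imp_zdiv_nonneg_iff)
    ultimately show ?thesis using par(5) by linarith
  qed
  define F where "F = F0 \<union> g ` F0"
  have cover: "\<exists>b\<in>F0. x \<in> {s + b..s + l + b}" if x: "x \<in> {s..s + l + M}" for x
  proof -
    define y where "y = x - s"
    consider "y \<le> l" | "M \<le> y" | "l < y" "y < M" by linarith
    then show ?thesis
    proof cases
      case 1
      then show ?thesis using x by (intro bexI[of _ 0]) (auto simp: y_def F0_def)
    next
      case 2
      then show ?thesis using x by (intro bexI[of _ M]) (auto simp: y_def F0_def)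
    next
      case 3
      \<comment> \<open>One block back, since f i may exceed i \<tau> by up to d < \<tau>. Thus f i
        \<le> y, while still y - f i < 2 \<tau> \<le> l.\<close>
      define i where "i = y div \<tau> - 1"
      have it: "i * \<tau> = y - y mod \<tau> - \<tau>" by (simp add: i_def algebra_simps minus_mod_eq_mult_div)
      have md: "0 \<le> y mod \<tau>" "y mod \<tau> < \<tau>" using \<tau> by auto
      have "0 \<le> i * \<tau>" using it md par(2) 3 by linarith
      then have i0: "0 \<le> i" using \<tau> by (simp add: zero_le_mult_iff)
      have iM: "i * \<tau> + d \<le> M" using it md 3 par(1) by linarith
      have "i \<le> M div \<tau>"
      proof -
        have "y div \<tau> \<le> M div \<tau>" using 3 \<tau> by (intro zdiv_mono1) auto
        then show ?thesis by (simp add: i_def)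
      qed
      then have "f i \<in> F0" using i0 by (simp add: F0_def)
      moreover have "f i \<le> y" "y - l \<le> f i" using f[OF i0 iM] it md par(1,2) by linarith+
      ultimately show ?thesis by (intro bexI[of _ "f i"]) (auto simp: y_def)
    qed
  qed
  have "int (card ({s..s + l + M} - translates A F)) \<le> (\<Sum>b\<in>F0. int (card ({s + b..s + l + b} - (shift b A \<union> shift (g b) A))))"
  proof -
    have "{s..s + l + M} - translates A F \<subseteq> (\<Union>b\<in>F0. {s + b..s + l + b} - (shift b A \<union> shift (g b) A))"
    proof
      fix x assume x: "x \<in> {s..s + l + M} - translates A F"
      then obtain b where b: "b \<in> F0" "x \<in> {s + b..s + l + b}" using cover by blast
      have "x \<notin> shift b A" "x \<notin> shift (g b) A" using x b(1) unfolding translates_def F_def by blast+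
      then show "x \<in> (\<Union>b\<in>F0. {s + b..s + l + b} - (shift b A \<union> shift (g b) A))" using b by blast
    qed
    then have "card ({s..s + l + M} - translates A F) \<le> card (\<Union>b\<in>F0. {s + b..s + l + b} - (shift b A \<union> shift (g b) A))"
      using finF0 by (intro card_mono) auto
    also have "\<dots> \<le> (\<Sum>b\<in>F0. card ({s + b..s + l + b} - (shift b A \<union> shift (g b) A)))"
      by (rule card_UN_le[OF finF0])
    finally show ?thesis by (simp flip: of_nat_sum)
  qed
  then have "int (card ({s..s + l + M} - translates A F)) * (k + 1)
      \<le> (\<Sum>b\<in>F0. int (card ({s + b..s + l + b} - (shift b A \<union> shift (g b) A)))) * (k + 1)"
    using k0 by (intro mult_right_mono) auto
  also have "\<dots> \<le> (\<Sum>b\<in>F0. q * d)" unfolding sum_distrib_right using F0 g(2) by (intro sum_mono) auto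
  also have "\<dots> = int (card F0) * (q * d)" by simp
  also have "\<dots> \<le> int L * (q * d)" using cF0 q0 d0 by (intro mult_right_mono) auto
  also have "\<dots> = q * k" by (simp add: k_def)
  also have "\<dots> \<le> q * (k + 1)" using q0 by (intro mult_left_mono) auto
  finally have "int (card ({s..s + l + M} - translates A F)) \<le> q" using k0 by simp
  moreover have "card F \<le> 2 * L"
  proof -
    have "card F \<le> card F0 + card (g ` F0)" unfolding F_def by (rule card_Un_le)
    then show ?thesis using card_image_le[OF finF0, of g] cF0 by linarith
  qed
  moreover have "F \<subseteq> B" using F0 g(1) unfolding F_def by blast
  ultimately show ?thesis using that[of F] finF0 by (simp add: F_def q_def)
qed

text \<open>Elements of $D$ just to the left and to the right of the arc are moved by $0$ and $M$; an element
  further away leaves the forbidden arc under a positive proportion of $B$, so that these gain a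
  fixed proportion of their number with every suitable new translate.\<close>

lemma cover_outside:
  fixes d l M u \<kappa> :: int
  assumes p: "p > 0" and per: "periodic p D" "periodic p B" and D: "\<And>z. z \<in> D \<Longrightarrow> l < (z - u) mod p"
    and B: "0 \<in> B" "M \<in> B" "0 \<le> M" "int (card ({0..M} - B)) \<le> d"
    and par: "0 \<le> l" "0 < \<kappa>" "\<kappa> \<le> M + 1" "l + M + 2 * \<kappa> < p" "2 * (d + int (pcard p D)) \<le> \<kappa>" "2 * int (pcard p B) \<le> int k * \<kappa>"
  obtains F where "finite F" "F \<subseteq> B" "card F \<le> k + 2"
    "pcard p D \<le> pcard p (translates D F \<inter> {z. l + M < (z - u) mod p})"
proof -
  \<comment> \<open>The position of z on the circle, counted from u. Positions up to l + M are
    reserved for the core; D starts above l, and only points above l + M count.\<close>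
  define c where "c z = (z - u) mod p" for z
  define Q where "Q = {z. l + M < c z}"
  define D1 where "D1 = {z \<in> D. p - \<kappa> \<le> c z}"
  define D2 where "D2 = {z \<in> D. c z \<le> l + \<kappa>}"
  define D3 where "D3 = {z \<in> D. l + \<kappa> < c z \<and> c z < p - \<kappa>}"
  define m where "m = int (pcard p B)"
  have c: "0 \<le> c z" "c z < p" for z using p by (auto simp: c_def)
  have cadd: "c (z + t) = c z + t" if "0 \<le> t" "c z + t < p" for z t
  proof -
    have "z + t - u = (z - u) + t" by simp
    then have "c (z + t) = (c z + t) mod p" unfolding c_def by (simp only: mod_add_left_eq)
    then show ?thesis using that c[of z] by simp
  qed
  have cp: "c (z + p) = c z" for z unfolding c_def by (metis add_diff_eq diff_add_eq mod_add_self2)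
  have perP: "periodic p {z \<in> D. P (c z)}" "periodic p {z. P (c z)}" for P
    using per(1) cp by (auto simp: periodic_def)
  have perD: "periodic p D1" "periodic p D2" "periodic p D3" and perQ: "periodic p Q"
    unfolding D1_def D2_def D3_def Q_def by (rule perP)+
  have "D = D1 \<union> (D2 \<union> D3)" by (auto simp: D1_def D2_def D3_def)
  moreover have "D1 \<inter> (D2 \<union> D3) = {}" "D2 \<inter> D3 = {}" using par B(3) by (auto simp: D1_def D2_def D3_def)
  ultimately have sum: "pcard p D = pcard p D1 + (pcard p D2 + pcard p D3)" by (simp add: pcard_Un_disjoint)
  \<comment> \<open>The b in [lo, hi] carry a past l + M but not around the circle. As a keeps a
    distance of \<kappa> from both ends, there are at least \<kappa> such positions in [0, M], of
    which B misses at most d.\<close>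
  have many: "\<kappa> - d \<le> int (pcard p (shift a B \<inter> Q))" if a: "a \<in> D3" for a
  proof -
    define lo where "lo = max 0 (l + M + 1 - c a)"
    define hi where "hi = min M (p - 1 - c a)"
    have a': "l + \<kappa> < c a" "c a < p - \<kappa>" using a by (auto simp: D3_def)
    have len: "\<kappa> \<le> hi - lo + 1" using a' par(1-4) B(3) by (auto simp: lo_def hi_def min_def max_def)
    have "card {lo..hi} \<le> card ((B \<inter> {lo..hi}) \<union> ({0..M} - B))" by (intro card_mono) (auto simp: lo_def hi_def)
    also have "\<dots> \<le> card (B \<inter> {lo..hi}) + card ({0..M} - B)" by (rule card_Un_le)
    finally have "int (card {lo..hi}) \<le> int (card (B \<inter> {lo..hi})) + int (card ({0..M} - B))" by linarith
    moreover have "hi - lo + 1 \<le> int (card {lo..hi})" by simp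
    ultimately have "\<kappa> - d \<le> int (card (B \<inter> {lo..hi}))" using len B(4) by linarith
    also have "card (B \<inter> {lo..hi}) \<le> pcard p (shift a B \<inter> Q)"
      unfolding pcard_def
    proof (rule card_inj_on_le[of "\<lambda>t. (a + t) mod p"])
      show "inj_on (\<lambda>t. (a + t) mod p) (B \<inter> {lo..hi})"
      proof (rule inj_onI)
        fix t t' assume t: "t \<in> B \<inter> {lo..hi}" "t' \<in> B \<inter> {lo..hi}" "(a + t) mod p = (a + t') mod p"
        then have "[a + t = a + t'] (mod p)" by (simp add: cong_def)
        then have "[t = t'] (mod p)" by (simp add: cong_add_lcancel)
        moreover have "0 \<le> t" "t < p" "0 \<le> t'" "t' < p" using t par B(3) by (auto simp: lo_def hi_def)
        ultimately show "t = t'" by (simp add: cong_def)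
      qed
      show "(\<lambda>t. (a + t) mod p) ` (B \<inter> {lo..hi}) \<subseteq> shift a B \<inter> Q \<inter> {0..<p}"
      proof clarify
        fix t assume t: "t \<in> B" "t \<in> {lo..hi}"
        then have "c (a + t) = c a + t" by (intro cadd) (auto simp: lo_def hi_def)
        then have "a + t \<in> shift a B \<inter> Q" using t by (auto simp: Q_def lo_def)
        then have "(a + t) mod p \<in> shift a B \<inter> Q"
          using periodic_mod[OF periodic_Int[OF periodic_shift[OF per(2)] perQ]] by blast
        then show "(a + t) mod p \<in> shift a B \<inter> Q \<inter> {0..<p}" using p by auto
      qed
    qed simp
    finally show ?thesis by simp
  qed
  have m0: "0 < m" using pcard_pos_iff[OF p per(2)] B(1) by (auto simp: m_def)
  \<comment> \<open>By averaging over B. The set H has fewer than |D| \<le> \<kappa>/2 - d elements,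
    so each a in D3 keeps at least \<kappa>/2 elements of B that lead outside H.\<close>
  have step: "\<exists>b\<in>B. int (pcard p D3) * \<kappa> \<le> 2 * m * int (pcard p ((shift b D3 \<inter> Q) - H))"
    if H: "pcard p H < pcard p D" "periodic p H" for H
  proof (rule ccontr)
    assume no: "\<not> ?thesis"
    have "int (pcard p D3) * \<kappa> \<le> (\<Sum>a\<in>D3 \<inter> {0..<p}. 2 * int (pcard p (shift a B \<inter> (Q - H))))"
    proof -
      have "\<kappa> \<le> 2 * int (pcard p (shift a B \<inter> (Q - H)))" if a: "a \<in> D3" for a
      proof -
        have "shift a B \<inter> Q \<subseteq> (shift a B \<inter> (Q - H)) \<union> H" by auto
        then have "pcard p (shift a B \<inter> Q) \<le> pcard p (shift a B \<inter> (Q - H)) + pcard p H"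
          using pcard_mono pcard_Un_le order_trans by metis
        then have "int (pcard p (shift a B \<inter> Q)) \<le> int (pcard p (shift a B \<inter> (Q - H))) + int (pcard p H)"
          by (simp only: of_nat_add[symmetric] of_nat_le_iff)
        moreover have "int (pcard p H) < int (pcard p D)" using H(1) by (simp only: of_nat_less_iff)
        moreover have "2 * d + 2 * int (pcard p D) \<le> \<kappa>" using par(5) by (simp only: distrib_left)
        ultimately show ?thesis using many[OF a] by linarith
      qed
      then have "(\<Sum>a\<in>D3 \<inter> {0..<p}. \<kappa>) \<le> (\<Sum>a\<in>D3 \<inter> {0..<p}. 2 * int (pcard p (shift a B \<inter> (Q - H))))"
        by (intro sum_mono) auto
      then show ?thesis by (simp add: pcard_def[of p D3])
    qed
    also have "\<dots> = 2 * (\<Sum>b\<in>B \<inter> {0..<p}. int (pcard p (shift b D3 \<inter> (Q - H))))"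
      using sum_pcard_shift_commute[OF p perD(3) per(2), of "Q - H"]
      by (simp flip: sum_distrib_left of_nat_sum)
    finally have le: "int (pcard p D3) * \<kappa> \<le> (\<Sum>b\<in>B \<inter> {0..<p}. 2 * int (pcard p (shift b D3 \<inter> (Q - H))))"
      by (simp add: sum_distrib_left)
    have "m * (\<Sum>b\<in>B \<inter> {0..<p}. 2 * int (pcard p (shift b D3 \<inter> (Q - H)))) < (\<Sum>b\<in>B \<inter> {0..<p}. int (pcard p D3) * \<kappa>)"
      unfolding sum_distrib_left
    proof (rule sum_strict_mono)
      show "B \<inter> {0..<p} \<noteq> {}" using B(1) p by auto
      fix b assume "b \<in> B \<inter> {0..<p}"
      then show "m * (2 * int (pcard p (shift b D3 \<inter> (Q - H)))) < int (pcard p D3) * \<kappa>"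
        using no by (auto simp: Int_Diff mult_ac)
    qed simp
    also have "\<dots> = m * (int (pcard p D3) * \<kappa>)" by (simp add: m_def pcard_def[of p B])
    also have "\<dots> \<le> m * (\<Sum>b\<in>B \<inter> {0..<p}. 2 * int (pcard p (shift b D3 \<inter> (Q - H))))"
      using le m0 by (intro mult_left_mono) auto
    finally show False by simp
  qed
  \<comment> \<open>The translates by 0 and M account for D1 and D2. Every further one adds at least
    |D3| \<kappa> / (2 m) until the goal is reached, so k \<ge> 2 m / \<kappa> of them make up for
    D3.\<close>
  have grow: "\<exists>F. finite F \<and> F \<subseteq> B \<and> card F \<le> j + 2 \<and> (pcard p D \<le> pcard p (translates D F \<inter> Q) \<or>
      2 * m * (int (pcard p D1) + int (pcard p D2)) + int j * (int (pcard p D3) * \<kappa>) \<le> 2 * m * int (pcard p (translates D F \<inter> Q)))" for j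
  proof (induction j)
    case 0
    have "D1 \<union> shift M D2 \<subseteq> translates D {0, M} \<inter> Q"
    proof -
      have "z \<in> Q" if "z - M \<in> D2" for z
      proof -
        have "l < c (z - M)" "c (z - M) \<le> l + \<kappa>" using that D by (auto simp: D2_def c_def)
        moreover from this have "c (z - M + M) = c (z - M) + M" using par B(3) by (intro cadd) auto
        ultimately show ?thesis by (simp add: Q_def)
      qed
      moreover have "z \<in> Q" if "z \<in> D1" for z using that par by (auto simp: D1_def Q_def)
      ultimately show ?thesis by (auto simp: translates_def D1_def D2_def)
    qed
    then have "pcard p (D1 \<union> shift M D2) \<le> pcard p (translates D {0, M} \<inter> Q)" by (rule pcard_mono)
    moreover have "D1 \<inter> shift M D2 = {}"
    proof (intro equals0I)
      fix z assume z: "z \<in> D1 \<inter> shift M D2"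
      then have "c (z - M) \<le> l + \<kappa>" by (simp add: D2_def)
      moreover from this have "c (z - M + M) = c (z - M) + M" using par B(3) by (intro cadd) auto
      ultimately show False using z par(4) by (simp add: D1_def)
    qed
    ultimately have "int (pcard p D1) + int (pcard p D2) \<le> int (pcard p (translates D {0, M} \<inter> Q))"
      using p perD by (simp add: pcard_Un_disjoint)
    then have "2 * m * (int (pcard p D1) + int (pcard p D2)) \<le> 2 * m * int (pcard p (translates D {0, M} \<inter> Q))"
      using m0 by (intro mult_left_mono) auto
    then show ?case using B by (intro exI[of _ "{0, M}"]) (auto simp: card_insert_if)
  next
    case (Suc j)
    then obtain F where F: "finite F" "F \<subseteq> B" "card F \<le> j + 2" "pcard p D \<le> pcard p (translates D F \<inter> Q) \<or>
      2 * m * (int (pcard p D1) + int (pcard p D2)) + int j * (int (pcard p D3) * \<kappa>) \<le> 2 * m * int (pcard p (translates D F \<inter> Q))"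
      by blast
    show ?case
    proof (cases "pcard p D \<le> pcard p (translates D F \<inter> Q)")
      case True
      then show ?thesis using F by (intro exI[of _ F]) auto
    next
      case False
      have "periodic p (translates D F \<inter> Q)" using per(1) perQ by auto
      then obtain b where b: "b \<in> B" "int (pcard p D3) * \<kappa> \<le> 2 * m * int (pcard p ((shift b D3 \<inter> Q) - (translates D F \<inter> Q)))"
        using step False by (meson not_le)
      have "(shift b D3 \<inter> Q) \<union> (translates D F \<inter> Q) \<subseteq> translates D (insert b F) \<inter> Q"
        by (auto simp: translates_insert D3_def)
      then have "pcard p ((shift b D3 \<inter> Q) \<union> (translates D F \<inter> Q)) \<le> pcard p (translates D (insert b F) \<inter> Q)"
        by (rule pcard_mono)
      then have "int (pcard p ((shift b D3 \<inter> Q) - (translates D F \<inter> Q))) + int (pcard p (translates D F \<inter> Q)) \<le> int (pcard p (translates D (insert b F) \<inter> Q))"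
        by (simp only: pcard_Diff_Un[symmetric] of_nat_add[symmetric] of_nat_le_iff)
      then have "2 * m * (int (pcard p ((shift b D3 \<inter> Q) - (translates D F \<inter> Q))) + int (pcard p (translates D F \<inter> Q))) \<le> 2 * m * int (pcard p (translates D (insert b F) \<inter> Q))"
        using m0 by (intro mult_left_mono) auto
      then have "2 * m * (int (pcard p D1) + int (pcard p D2)) + int (Suc j) * (int (pcard p D3) * \<kappa>) \<le> 2 * m * int (pcard p (translates D (insert b F) \<inter> Q))"
        using b(2) F(4) False by (simp add: algebra_simps)
      then show ?thesis using F b by (intro exI[of _ "insert b F"]) (auto simp: card_insert_if)
    qed
  qed
  obtain F where F: "finite F" "F \<subseteq> B" "card F \<le> k + 2" "pcard p D \<le> pcard p (translates D F \<inter> Q) \<or>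
      2 * m * (int (pcard p D1) + int (pcard p D2)) + int k * (int (pcard p D3) * \<kappa>) \<le> 2 * m * int (pcard p (translates D F \<inter> Q))"
    using grow[of k] by blast
  have "pcard p D \<le> pcard p (translates D F \<inter> Q)"
    using F(4)
  proof
    assume *: "2 * m * (int (pcard p D1) + int (pcard p D2)) + int k * (int (pcard p D3) * \<kappa>) \<le> 2 * m * int (pcard p (translates D F \<inter> Q))"
    have "int (pcard p D3) * (2 * m) \<le> int (pcard p D3) * (int k * \<kappa>)" using par(6) by (intro mult_left_mono) (auto simp: m_def)
    then have "2 * m * int (pcard p D) \<le> 2 * m * int (pcard p (translates D F \<inter> Q))"
      using * by (simp add: sum algebra_simps)
    then show ?thesis using m0 by simp
  qed
  then show ?thesis using that[OF F(1-3)] by (simp add: Q_def c_def)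
qed

text \<open>The middle interval receives at least l + M + 1 - q elements, where q is the number of
  holes of A in its core, and the part of A outside the core has n - (l + 1 - q) elements. In the
  sum l and q cancel and leave n + M \<ge> n + m - 1. The margin s at both ends of the core is the
  room in which the partner translates move.\<close>

lemma translates_near_arc:
  fixes d s \<tau> M \<kappa> n m :: int
  assumes p: "p > 0" and per: "periodic p A" "periodic p B" and n: "n = int (pcard p A)" and m: "m = int (pcard p B)"
    and A: "int (card ({0..<n} - A)) \<le> d"
    and B: "0 \<in> B" "M \<in> B" "0 \<le> M" "\<And>b. b \<in> B \<Longrightarrow> b mod p \<le> M" "M + 1 \<le> m + d"
    and par: "d < \<tau>" "2 * \<tau> \<le> n - 1 - 2 * s" "0 \<le> s" "2 * s \<le> M" "M div \<tau> + 3 \<le> int L" "d * (int L + 1) \<le> s"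
      "4 * (d + s) \<le> \<kappa>" "0 < \<kappa>" "\<kappa> \<le> M + 1" "n + M + 2 * \<kappa> \<le> p" "2 * m \<le> int k * \<kappa>"
  obtains F where "finite F" "F \<subseteq> B" "card F \<le> 2 * L + (k + 2)" "n + m \<le> int (pcard p (translates A F)) + 1"
proof -
  define l where "l = n - 1 - 2 * s"
  have d0: "0 \<le> d" using A by linarith
  have l0: "0 \<le> l" using par(1,2) d0 by (simp add: l_def)
  have Mp: "l + M < p" using par l0 d0 unfolding l_def by linarith
  have mM: "m \<le> M + 1"
  proof -
    have "B \<inter> {0..<p} \<subseteq> {0..M}" using B(4) by fastforce
    then have "pcard p B \<le> card {0..M}" unfolding pcard_def by (intro card_mono) auto
    then show ?thesis using B(3) by (simp add: m)
  qed
  have holesB: "int (card ({0..M} - B)) \<le> d"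
  proof -
    have "B \<inter> {0..<p} = B \<inter> {0..M}" using B(4) Mp l0 by fastforce
    then have "card (B \<inter> {0..M}) = pcard p B" by (simp add: pcard_def)
    moreover have "card {0..M} = card ({0..M} - B) + card (B \<inter> {0..M})" by (rule card_Diff_plus_Int) simp
    ultimately show ?thesis using B(3,5) m by simp
  qed
  have "{0..<n} = {0..l + 2 * s}" by (auto simp: l_def)
  then have holesA: "int (card ({0..l + 2 * s} - A)) \<le> d" using A by simp
  obtain F1 where F1: "finite F1" "F1 \<subseteq> B" "card F1 \<le> 2 * L"
      "card ({s..s + l + M} - translates A F1) \<le> card ({s..s + l} - A)"
    using cover_core[OF holesA B(1-3) holesB par(1)] par l_def by metis
  define q where "q = int (card ({s..s + l} - A))"
  define R where "R t = {z. (z - s) mod p \<le> t}" for t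
  have inter: "int (card (X \<inter> {s..s + t})) = t + 1 - int (card ({s..s + t} - X))" if "0 \<le> t" for X t
  proof -
    have "card {s..s + t} = card ({s..s + t} - X) + card (X \<inter> {s..s + t})" by (rule card_Diff_plus_Int) simp
    then show ?thesis using that by simp
  qed
  define D where "D = A - R l"
  have perR: "periodic p (R t)" for t unfolding R_def by (rule periodic_residue)
  have perD: "periodic p D" unfolding D_def using per(1) perR by auto
  have "pcard p (A \<inter> R l) = card (A \<inter> {s..s + l})"
    unfolding R_def using Mp B(3) l0 per(1) by (intro pcard_interval) auto
  then have cA: "int (pcard p D) + (l + 1 - q) = n"
    using pcard_Diff_Int[of p A "R l"] inter[OF l0, of A] by (simp add: D_def n q_def)
  have "q \<le> d"
  proof -
    have "card ({s..s + l} - A) \<le> card ({0..l + 2 * s} - A)" using par(3) by (intro card_mono) auto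
    then show ?thesis using holesA by (simp add: q_def)
  qed
  then have cD: "int (pcard p D) \<le> d + 2 * s" using cA by (simp add: l_def)
  obtain F2 where F2: "finite F2" "F2 \<subseteq> B" "card F2 \<le> k + 2"
    "pcard p D \<le> pcard p (translates D F2 \<inter> {z. l + M < (z - s) mod p})"
  proof (rule cover_outside[OF p perD per(2) _ B(1-3) holesB l0 par(8,9), of s k])
    show "l < (z - s) mod p" if "z \<in> D" for z using that by (simp add: D_def R_def)
    show "l + M + 2 * \<kappa> < p" using par by (simp add: l_def)
    show "2 * (d + int (pcard p D)) \<le> \<kappa>" using cD par(7) by simp
    show "2 * int (pcard p B) \<le> int k * \<kappa>" using par(11) m by simp
  qed
  have "pcard p (translates A F1 \<inter> R (l + M)) = card (translates A F1 \<inter> {s..s + (l + M)})"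
    unfolding R_def using Mp B(3) l0 per(1) by (intro pcard_interval) auto
  then have c1: "l + M + 1 - q \<le> int (pcard p (translates A F1 \<inter> R (l + M)))"
    using inter[of "l + M" "translates A F1"] F1(4) l0 B(3) by (simp add: q_def add.assoc)
  have "(translates A F1 \<inter> R (l + M)) \<union> (translates D F2 \<inter> {z. l + M < (z - s) mod p}) \<subseteq> translates A (F1 \<union> F2)"
    by (auto simp: translates_def D_def)
  then have "pcard p ((translates A F1 \<inter> R (l + M)) \<union> (translates D F2 \<inter> {z. l + M < (z - s) mod p})) \<le> pcard p (translates A (F1 \<union> F2))"
    by (rule pcard_mono)
  moreover have "pcard p ((translates A F1 \<inter> R (l + M)) \<union> (translates D F2 \<inter> {z. l + M < (z - s) mod p}))
     = pcard p (translates A F1 \<inter> R (l + M)) + pcard p (translates D F2 \<inter> {z. l + M < (z - s) mod p})"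
    by (rule pcard_Un_disjoint) (auto simp: R_def)
  ultimately have "n + m \<le> int (pcard p (translates A (F1 \<union> F2))) + 1"
    using c1 F2(4) cA mM by linarith
  moreover have "card (F1 \<union> F2) \<le> 2 * L + (k + 2)" using card_Un_le[of F1 F2] F1(3) F2(3) by linarith
  ultimately show ?thesis using that[of "F1 \<union> F2"] F1 F2 by simp
qed

subsection \<open>Choice of the constants\<close>

lemma almost_invariant_translation_bounded:
  fixes \<beta> K \<epsilon>0 :: real
  assumes "0 < \<beta>" "\<beta> \<le> 1" "1 \<le> K" "0 < \<epsilon>0" "\<epsilon>0 \<le> \<beta>"
  shows "\<exists>(C::nat) (N::real). \<forall>p A B. setting \<beta> K p A B \<longrightarrow> N \<le> real (pcard p A) \<longrightarrow>
     (\<forall>F. finite F \<longrightarrow> F \<subseteq> B \<longrightarrow> card F \<le> C \<longrightarrow> pcard p (translates A F) < pcard p A + pcard p B) \<longrightarrow>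
     (\<exists>t. \<not> p dvd t \<and> real (pcard p (shift t B - B)) \<le> \<epsilon>0 * real (pcard p A))"
proof -
  \<comment> \<open>The two extra units leave room for E + 1 in m + E + 1 \<le> K' n. Both E - 1 and
    2 \<kappa> m become at most \<epsilon>0/4 n; c and c' serve the tuple count and the greedy
    cover, and N makes n/2 exceed the ratio of (n + m)^c to (\<kappa> m)^c.\<close>
  define K' where "K' = K + 2"
  define \<epsilon> where "\<epsilon> = \<epsilon>0 / (8 * K')"
  define \<kappa> where "\<kappa> = \<epsilon>0 / (8 * K)"
  define c where "c = nat \<lceil>(1 + K) / \<epsilon>\<^sup>2\<rceil>"
  define c' where "c' = nat \<lceil>2 * c * (1 + K)\<rceil>"
  define N where "N = max (8 / \<epsilon>0) (2 * ((1 + K) * K / \<kappa>) ^ c + 1)"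
  have K': "1 \<le> K'" "3 \<le> K'" using assms by (auto simp: K'_def)
  have \<epsilon>: "0 < \<epsilon>" "\<epsilon> \<le> 1" using assms K' by (auto simp: \<epsilon>_def field_simps)
  have \<kappa>: "0 < \<kappa>" "\<kappa> \<le> 1" using assms by (auto simp: \<kappa>_def field_simps)
  have c: "(1 + K) / \<epsilon>\<^sup>2 \<le> c" unfolding c_def by (rule real_nat_ceiling_ge)
  have c0: "0 < c"
  proof -
    have "0 < (1 + K) / \<epsilon>\<^sup>2" using \<epsilon> assms by simp
    then show ?thesis using c by linarith
  qed
  have c': "2 * c * (1 + K) \<le> c'" unfolding c'_def by (rule real_nat_ceiling_ge)
  show ?thesis
  proof (rule exI[of _ "max c c'"], rule exI[of _ N], intro allI impI)
    fix p A B
    assume st: "setting \<beta> K p A B" and N: "N \<le> real (pcard p A)"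
      and NB: "\<forall>F. finite F \<longrightarrow> F \<subseteq> B \<longrightarrow> card F \<le> max c c' \<longrightarrow> pcard p (translates A F) < pcard p A + pcard p B"
    define n where "n = pcard p A"
    define m where "m = pcard p B"
    have pr: "prime p" and perA: "periodic p A" and perB: "periodic p B" and A0: "A \<noteq> {}" and B0: "B \<noteq> {}"
      and nm: "real n \<le> K * m" and mn: "real m \<le> K * n" and nmp: "real n + real m \<le> (1 - \<beta>) * p"
      using st by (auto simp: setting_def n_def m_def)
    have p: "p > 0" using pr prime_gt_0_int by blast
    have n0: "0 < real n" using pcard_pos_iff[OF p perA] A0 n_def by simp
    have e0n: "8 \<le> \<epsilon>0 * n" using N assms(4) unfolding N_def n_def by (simp add: field_simps)
    have nmK: "real (n + m) \<le> (1 + K) * n" using mn by (simp add: algebra_simps)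
    define E where "E = (1 + K') * \<epsilon> * n + 1"
    have "(1 + K') * \<epsilon> \<le> \<epsilon>0 / 4" unfolding \<epsilon>_def using K' assms by (simp add: field_simps)
    then have "(1 + K') * \<epsilon> * n \<le> \<epsilon>0 / 4 * n" by (intro mult_right_mono) auto
    then have E: "E \<le> \<epsilon>0 / 4 * n + 1" by (simp add: E_def)
    have np: "real n \<le> p" using nmp p assms(1) pcard_le[of p A] unfolding n_def by linarith
    have e0p: "\<epsilon>0 * n \<le> \<beta> * p" using assms np by (intro mult_mono) auto
    have e01: "\<epsilon>0 * n \<le> n" using assms n0 by (simp add: mult_left_le_one_le)
    obtain t where t: "\<not> p dvd t" "real (pcard p (shift t B - B)) \<le> 2 * \<kappa> * m + E"
    proof (rule almost_invariant_translation[OF pr perA perB A0 \<kappa> \<epsilon> K'(1) c0 n_def m_def _ _ _ E_def])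
      show "pcard p (translates A F) < n + m" if "finite F" "F \<subseteq> B" "card F \<le> max c c'" for F
        using NB that by (simp add: n_def m_def)
      have "(1 + K) * n \<le> (c * \<epsilon>\<^sup>2) * n" using c \<epsilon> by (intro mult_right_mono) (auto simp: field_simps)
      then show "real n + real m \<le> c * (\<epsilon>\<^sup>2 * n)" using nmK by (simp add: mult_ac)
      have "2 * c * real (n + m) \<le> 2 * c * ((1 + K) * n)" using nmK by (intro mult_left_mono) auto
      also have "\<dots> \<le> c' * n" using mult_right_mono[OF c', of "real n"] by (simp add: mult_ac)
      finally have "real (2 * c * (n + m)) \<le> real (c' * n)" by simp
      then show "2 * c * (n + m) \<le> c' * n" by (simp only: of_nat_le_iff)
      show "m + E + 1 \<le> K' * n" using mn E e0n e01 by (simp add: K'_def algebra_simps)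
      have "\<beta> * p + (real n + real m) \<le> p" using nmp by (simp add: algebra_simps)
      then show "real n + real m + E + 1 \<le> p" using E e0n e0p by simp
      show "real (n + m) ^ c < (\<kappa> * m) ^ c * (real n / 2)"
      proof -
        have "real (n + m) \<le> ((1 + K) * K / \<kappa>) * (\<kappa> * m)"
        proof -
          have "(1 + K) * n \<le> (1 + K) * (K * m)" using nm assms by (intro mult_left_mono) auto
          then show ?thesis using nmK \<kappa> by (simp add: mult_ac)
        qed
        then have "real (n + m) ^ c \<le> (((1 + K) * K / \<kappa>) * (\<kappa> * m)) ^ c" by (intro power_mono) auto
        also have "\<dots> = (\<kappa> * m) ^ c * ((1 + K) * K / \<kappa>) ^ c" by (simp only: power_mult_distrib mult.commute)
        also have "\<dots> < (\<kappa> * m) ^ c * (real n / 2)"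
        proof (rule mult_strict_left_mono)
          show "((1 + K) * K / \<kappa>) ^ c < real n / 2" using N by (simp add: N_def n_def)
          have "m > 0" using pcard_pos_iff[OF p perB] B0 m_def by simp
          then show "0 < (\<kappa> * m) ^ c" using \<kappa> by simp
        qed
        finally show ?thesis .
      qed
    qed blast
    have "2 * \<kappa> * m \<le> 2 * \<kappa> * (K * n)" using mn \<kappa> by (intro mult_left_mono) auto
    also have "\<dots> = \<epsilon>0 / 4 * n" using assms by (simp add: \<kappa>_def)
    finally have "2 * \<kappa> * m + E \<le> \<epsilon>0 * n" using E e0n by simp
    then show "\<exists>t. \<not> p dvd t \<and> real (pcard p (shift t B - B)) \<le> \<epsilon>0 * real (pcard p A)"
      using t unfolding n_def by force
  qed
qed

lemma linear_structure_bounded: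
  fixes \<beta> K \<rho>0 :: real
  assumes "0 < \<beta>" "\<beta> \<le> 1" "1 \<le> K" "0 < \<rho>0"
  shows "\<exists>(\<epsilon>0::real) (N::real). 0 < \<epsilon>0 \<and> (\<forall>p A B t. setting \<beta> K p A B \<longrightarrow> N \<le> real (pcard p A) \<longrightarrow>
     tight p A \<epsilon>0 B \<longrightarrow> \<not> p dvd t \<longrightarrow> real (pcard p (shift t B - B)) \<le> \<epsilon>0 * real (pcard p A) \<longrightarrow>
     (\<exists>c w. \<not> p dvd c \<and> 0 < w \<and> real_of_int w \<le> \<rho>0 * real (pcard p A) \<and>
       10 * int (defect p A (c * w)) \<le> 11 * w \<and> (\<forall>i. \<bar>i\<bar> \<le> w \<longrightarrow> int (defect p A (c * i)) \<le> 3 * w)))"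
proof -
  define \<theta> where "\<theta> = 1 - cos (pi / 8)"
  have "cos (pi / 8) < cos 0" by (rule cos_monotone_0_pi) auto
  then have \<theta>: "0 < \<theta>" "\<theta> \<le> 2" by (auto simp: \<theta>_def)
  \<comment> \<open>R will be about \<rho> n. The first bound serves the rectification and keeps
    radii up to 2R below m; the second gives w \<le> 2 R \<le> \<rho>0 n. The accuracy \<rho>/1000
    taken below is finer than R/400 in units of n.\<close>
  define \<rho> where "\<rho> = min (\<beta> * \<theta> / (100 * K)) (\<rho>0 / 2)"
  have \<rho>: "0 < \<rho>" "\<rho> \<le> \<beta> * \<theta> / (100 * K)" "\<rho> \<le> \<rho>0 / 2" using assms \<theta> by (auto simp: \<rho>_def)
  have \<rho>2: "\<rho> \<le> \<beta> * \<theta> / 100" "\<rho> \<le> \<beta> / 50" "\<rho> * K \<le> 1 / 50"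
  proof -
    have "\<beta> * \<theta> / (100 * K) \<le> \<beta> * \<theta> / (100 * 1)" using assms \<theta> by (intro divide_left_mono) auto
    then show *: "\<rho> \<le> \<beta> * \<theta> / 100" using \<rho> by simp
    have "\<beta> * \<theta> \<le> \<beta> * 2" using \<theta> assms by (intro mult_left_mono) auto
    then show "\<rho> \<le> \<beta> / 50" using * by simp
    have "\<rho> * K \<le> \<beta> * \<theta> / 100" using \<rho>(2) assms by (simp add: field_simps)
    then show "\<rho> * K \<le> 1 / 50" using \<open>\<beta> * \<theta> \<le> \<beta> * 2\<close> assms(2) by linarith
  qed
  have "0 < \<rho> / 1000" using \<rho> by simp
  from defect_balls_large[OF assms(1-3) this] obtain \<epsilon>0 :: real where \<epsilon>0: "0 < \<epsilon>0"
    and balls: "\<And>p A B d (s::real). setting \<beta> K p A B \<Longrightarrow> 1 \<le> \<epsilon>0 * pcard p A \<Longrightarrow> tight p A \<epsilon>0 B \<Longrightarrow> \<not> p dvd d \<Longrightarrow>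
     real (pcard p (shift d B - B)) \<le> \<epsilon>0 * pcard p A \<Longrightarrow> s \<le> pcard p B \<Longrightarrow> 2 * s \<le> pcard p A \<Longrightarrow>
     2 * s - \<rho> / 1000 * pcard p A \<le> pcard p {x. pcard p (shift x A - A) \<le> s}" by meson
  define N where "N = max (2000 / \<rho>) (1 / \<epsilon>0)"
  show ?thesis
  proof (rule exI[of _ \<epsilon>0], rule exI[of _ N], intro conjI allI impI \<epsilon>0)
    fix p A B t
    assume st: "setting \<beta> K p A B" and N: "N \<le> real (pcard p A)" and ti: "tight p A \<epsilon>0 B"
      and t: "\<not> p dvd t" "real (pcard p (shift t B - B)) \<le> \<epsilon>0 * real (pcard p A)"
    define n where "n = pcard p A"
    define m where "m = pcard p B"
    have pr: "prime p" and perA: "periodic p A" and perB: "periodic p B" and A0: "A \<noteq> {}" and B0: "B \<noteq> {}"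
      and nm: "real n \<le> K * m" and mn: "real m \<le> K * n" and nmp: "real n + real m \<le> (1 - \<beta>) * p"
      using st by (auto simp: setting_def n_def m_def)
    have p: "p > 0" using pr prime_gt_0_int by blast
    have n0: "0 < real n" using pcard_pos_iff[OF p perA] A0 n_def by simp
    have \<rho>n: "2000 \<le> \<rho> * n" using N \<rho> unfolding N_def n_def by (simp add: field_simps)
    have e0n: "1 \<le> \<epsilon>0 * n" using N \<epsilon>0 unfolding N_def n_def by (simp add: field_simps)
    define R where "R = nat \<lfloor>\<rho> * n\<rfloor>"
    have R: "real R \<le> \<rho> * n" "\<rho> * n - 1 < real R" using \<rho>n unfolding R_def by linarith+
    have \<rho>\<beta>n: "\<rho> * n \<le> \<beta> / 50 * n" "\<rho> * n \<le> (\<beta> * \<theta> / 100) * n" by (rule mult_right_mono; use \<rho>2 in simp)+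
    have bn: "\<beta> * n \<le> n" using assms n0 by (simp add: mult_left_le_one_le)
    have np: "real n \<le> p" using pcard_le[of p A] p unfolding n_def by linarith
    have bnp: "\<beta> * n \<le> \<beta> * p" using assms np by (intro mult_left_mono) auto
    have nbp: "real n + \<beta> * p \<le> p" using nmp by (simp add: algebra_simps)
    have \<rho>m: "50 * (\<rho> * n) \<le> m"
    proof -
      have "\<rho> * n \<le> \<rho> * (K * m)" using nm \<rho> by (intro mult_left_mono) auto
      also have "\<dots> \<le> 1 / 50 * m" using mult_right_mono[OF \<rho>2(3), of "real m"] by (simp add: mult_ac)
      finally show ?thesis by simp
    qed
    obtain c w where cw: "\<not> p dvd c" "0 < w" "w \<le> 2 * int R" "10 * int (defect p A (c * w)) \<le> 11 * w"
       "\<And>i. \<bar>i\<bar> \<le> w \<Longrightarrow> int (defect p A (c * i)) \<le> 3 * w"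
    proof (rule linear_structure[OF pr perA A0 assms(1), of R])
      show "real (pcard p A) \<le> (1 - \<beta>) * p" using nmp n_def by simp
      show "1000 \<le> R" using R \<rho>n by linarith
      show "2 * real k - R / 400 \<le> pcard p (defect_ball p A k)" if "k \<le> 2 * R" for k
      proof -
        have k: "real k \<le> 2 * (\<rho> * n)" using that R by linarith
        have "2 * real k - \<rho> / 1000 * n \<le> pcard p {x. real (pcard p (shift x A - A)) \<le> real k}"
          unfolding n_def using e0n k \<rho>m \<rho>\<beta>n bn n0
          by (intro balls[OF st _ ti t]) (unfold n_def[symmetric] m_def[symmetric], linarith+)
        moreover have "{x. real (pcard p (shift x A - A)) \<le> real k} = defect_ball p A k"
          by (simp only: of_nat_le_iff defect_ball_def defect_def)
        ultimately show ?thesis using R \<rho>n by simp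
      qed
      have "8 * real R + 2 \<le> n" using R \<rho>n \<rho>\<beta>n bn by linarith
      then show "8 * R + 2 \<le> pcard p A" unfolding n_def by linarith
      have "real n + (8 * real R + 2) \<le> p" using R \<rho>n \<rho>\<beta>n bnp nbp by linarith
      then show "pcard p A + (8 * R + 2) \<le> nat p" unfolding n_def by linarith
      show "10 * real R \<le> \<beta> * (1 - cos (pi / 8)) * pcard p A"
      proof -
        have "0 \<le> \<beta> * \<theta> * n" using assms(1) \<theta> by simp
        moreover have "(\<beta> * \<theta> / 100) * n = (\<beta> * \<theta> * n) / 100" by simp
        ultimately have "10 * real R \<le> \<beta> * \<theta> * n" using R(1) \<rho>\<beta>n(2) by linarith
        then show ?thesis by (simp only: \<theta>_def n_def)
      qed
    qed blast
    have "real_of_int w \<le> 2 * real R" using cw(3) by linarith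
    also have "\<dots> \<le> \<rho>0 * n"
      using R mult_right_mono[OF \<rho>(3), of "real n"] by simp
    finally show "\<exists>c w. \<not> p dvd c \<and> 0 < w \<and> real_of_int w \<le> \<rho>0 * real (pcard p A) \<and>
       10 * int (defect p A (c * w)) \<le> 11 * w \<and> (\<forall>i. \<bar>i\<bar> \<le> w \<longrightarrow> int (defect p A (c * i)) \<le> 3 * w)"
      using cw n_def by blast
  qed
qed

lemma translates_near_arc_bounded:
  fixes \<beta> K :: real
  assumes "0 < \<beta>" "\<beta> \<le> 1" "1 \<le> K"
  shows "\<exists>(d0::real) (C::nat) (N::real). 0 < d0 \<and> d0 \<le> \<beta> / 8 \<and> (\<forall>p A B M. setting \<beta> K p A B \<longrightarrow> N \<le> real (pcard p A) \<longrightarrow>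
     real (card ({0..<int (pcard p A)} - A)) \<le> d0 * real (pcard p A) \<longrightarrow> 0 \<in> B \<longrightarrow> M \<in> B \<longrightarrow> 0 \<le> M \<longrightarrow>
     (\<forall>b\<in>B. b mod p \<le> M) \<longrightarrow> real_of_int M + 1 \<le> real (pcard p B) + d0 * real (pcard p A) \<longrightarrow>
     (\<exists>F. finite F \<and> F \<subseteq> B \<and> card F \<le> C \<and> pcard p A + pcard p B \<le> pcard p (translates A F) + 1))"
proof -
  \<comment> \<open>Widths as proportions of n: \<kappa>0 for the zones next to the arc, s0 for the
    margin of the core, d0 for the holes, each small against the one before. L bounds the number of
    blocks of length about n/4 in [0, M], k the translates for the outside, and N makes rounding
    negligible.\<close>
  define \<kappa>0 where "\<kappa>0 = \<beta> / (8 * K)"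
  define L where "L = nat \<lceil>8 * (K + 1)\<rceil> + 3"
  define s0 where "s0 = \<kappa>0 / 16"
  define d0 where "d0 = s0 / (4 * (real L + 1))"
  define k where "k = nat \<lceil>4 * K / \<kappa>0\<rceil>"
  define N where "N = 100 / d0"
  have \<kappa>0: "0 < \<kappa>0" "\<kappa>0 \<le> \<beta> / 8" "K * \<kappa>0 \<le> 1 / 8" using assms by (auto simp: \<kappa>0_def field_simps)
  have L: "8 * (K + 1) \<le> real L - 3" unfolding L_def using assms by (simp add: real_nat_ceiling_ge)
  have s0: "0 < s0" using \<kappa>0 by (simp add: s0_def)
  have d0: "0 < d0" "d0 * (4 * (real L + 1)) = s0" "d0 \<le> s0 / 4"
    using s0 by (auto simp: d0_def field_simps)
  have k: "4 * K / \<kappa>0 \<le> k" unfolding k_def by (rule real_nat_ceiling_ge)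
  show ?thesis
  proof (rule exI[of _ d0], rule exI[of _ "2 * L + (k + 2)"], rule exI[of _ N], intro conjI allI impI d0(1))
    show "d0 \<le> \<beta> / 8" using d0 \<kappa>0 s0_def by linarith
    fix p A B M
    assume st: "setting \<beta> K p A B" and N: "N \<le> real (pcard p A)"
      and hA: "real (card ({0..<int (pcard p A)} - A)) \<le> d0 * real (pcard p A)"
      and hB: "0 \<in> B" "M \<in> B" "0 \<le> M" "\<forall>b\<in>B. b mod p \<le> M" "real_of_int M + 1 \<le> real (pcard p B) + d0 * real (pcard p A)"
    define n where "n = int (pcard p A)"
    define m where "m = int (pcard p B)"
    have pr: "prime p" and perA: "periodic p A" and perB: "periodic p B" and A0: "A \<noteq> {}" and B0: "B \<noteq> {}"
      and nm: "real_of_int n \<le> K * m" and mn: "real_of_int m \<le> K * n" and nmp: "real_of_int n + real_of_int m \<le> (1 - \<beta>) * p"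
      using st by (auto simp: setting_def n_def m_def)
    have p: "p > 0" using pr prime_gt_0_int by blast
    define x where "x = d0 * real_of_int n"
    have x: "100 \<le> x" using N d0 unfolding N_def n_def x_def by (simp add: field_simps)
    have n0: "0 < n" using pcard_pos_iff[OF p perA] A0 n_def by simp
    have s0n: "s0 * n = 4 * (real L + 1) * x" using d0(2) by (simp add: x_def mult_ac flip: d0(2))
    have \<kappa>0n: "\<kappa>0 * n = 16 * (s0 * n)" by (simp add: s0_def)
    have L1: "20 \<le> real L + 1" using L assms(3) by (simp only: distrib_left)
    have s0x: "80 * x \<le> s0 * n" unfolding s0n using L1 x by (intro mult_right_mono) auto
    have np: "real_of_int n \<le> p" using pcard_le[of p A] p unfolding n_def by linarith
    have \<beta>n: "\<kappa>0 * n \<le> \<beta> / 8 * n" "\<beta> * n \<le> \<beta> * p" "\<beta> * n \<le> 1 * n"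
      using \<kappa>0 n0 assms np by (auto intro!: mult_right_mono mult_left_mono)
    have mM: "m \<le> M + 1"
    proof -
      have "B \<inter> {0..<p} \<subseteq> {0..M}" using hB(4) by fastforce
      then have "pcard p B \<le> card {0..M}" unfolding pcard_def by (intro card_mono) auto
      then show ?thesis using hB(3) by (simp add: m_def)
    qed
    have \<kappa>m: "8 * (\<kappa>0 * n) \<le> m"
    proof -
      have "\<kappa>0 * n \<le> \<kappa>0 * (K * m)" using nm \<kappa>0 by (intro mult_left_mono) auto
      also have "\<dots> \<le> 1 / 8 * m" using mult_right_mono[OF \<kappa>0(3), of "real_of_int m"] by (simp add: mult_ac m_def)
      finally show ?thesis by simp
    qed
    define d where "d = \<lfloor>x\<rfloor>"
    define s where "s = \<lfloor>s0 * n\<rfloor>"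
    define \<kappa> where "\<kappa> = \<lfloor>\<kappa>0 * n\<rfloor>"
    define \<tau> where "\<tau> = n div 4"
    have d: "real_of_int d \<le> x" "x - 1 < d" unfolding d_def by linarith+
    have s: "real_of_int s \<le> s0 * n" "s0 * n - 1 < s" unfolding s_def by linarith+
    have \<kappa>: "real_of_int \<kappa> \<le> \<kappa>0 * n" "\<kappa>0 * n - 1 < \<kappa>" unfolding \<kappa>_def by linarith+
    have \<tau>: "4 * \<tau> \<le> n" "n \<le> 4 * \<tau> + 3" unfolding \<tau>_def by linarith+
    have \<tau>r: "4 * real_of_int \<tau> \<le> n" "real_of_int n \<le> 4 * \<tau> + 3" using \<tau> by linarith+
    have Mr: "real_of_int M + 1 \<le> m + x" using hB(5) by (simp add: m_def n_def x_def)
    have mMr: "real_of_int m \<le> M + 1" using mM by linarith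
    obtain F where F: "finite F" "F \<subseteq> B" "card F \<le> 2 * L + (k + 2)" "n + m \<le> int (pcard p (translates A F)) + 1"
    proof (rule translates_near_arc[OF p perA perB n_def m_def _ hB(1-3), of d \<tau> s L \<kappa> k])
      have "int (card ({0..<n} - A)) \<le> \<lfloor>x\<rfloor>" using hA by (simp add: le_floor_iff x_def n_def)
      then show "int (card ({0..<n} - A)) \<le> d" by (simp add: d_def)
      show "b mod p \<le> M" if "b \<in> B" for b using hB(4) that by blast
      have "M + 1 \<le> m + \<lfloor>x\<rfloor>" using Mr by linarith
      then show "M + 1 \<le> m + d" by (simp add: d_def)
      have "real_of_int d < \<tau>" using d \<tau>r s0x \<kappa>0n \<beta>n x by linarith
      then show "d < \<tau>" by simp
      have "2 * real_of_int \<tau> \<le> n - 1 - 2 * real_of_int s" using s \<tau>r \<kappa>0n \<beta>n s0x x by linarith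
      then show "2 * \<tau> \<le> n - 1 - 2 * s" by linarith
      have "0 \<le> real_of_int s" using s s0x x by linarith
      then show "0 \<le> s" by simp
      have "2 * real_of_int s \<le> M" using s mMr \<kappa>m \<kappa>0n s0x x by linarith
      then show "2 * s \<le> M" by linarith
      show "M div \<tau> + 3 \<le> int L"
      proof -
        have "real_of_int M \<le> 8 * (K + 1) * \<tau>"
        proof -
          have "real_of_int n \<le> 8 * \<tau>" using \<tau>r d s0x \<kappa>0n \<beta>n x by linarith
          then have "(K + 1) * n \<le> (K + 1) * (8 * \<tau>)" using assms by (intro mult_left_mono) auto
          moreover have "real_of_int M \<le> (K + 1) * n"
          proof -
            have "x \<le> n" using s0x \<kappa>0n \<beta>n x by linarith
            then have "real_of_int M \<le> K * n + n" using Mr mn by linarith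
            then show ?thesis by (simp add: algebra_simps)
          qed
          ultimately show ?thesis by (simp add: mult_ac)
        qed
        also have "\<dots> \<le> (real L - 3) * \<tau>" using L \<open>real_of_int d < \<tau>\<close> d x by (intro mult_right_mono) auto
        finally have "real_of_int M \<le> real_of_int ((int L - 3) * \<tau>)" by simp
        then have "M \<le> (int L - 3) * \<tau>" by (simp only: of_int_le_iff)
        moreover have "0 < \<tau>" using \<open>real_of_int d < \<tau>\<close> d x by linarith
        ultimately have "M div \<tau> \<le> int L - 3" by (metis div_le_mono2 nonzero_mult_div_cancel_right order_less_irrefl zdiv_mono1)
        then show ?thesis by simp
      qed
      have "real_of_int d * (real L + 1) \<le> x * (real L + 1)" using d by (intro mult_right_mono) auto
      also have "\<dots> \<le> s"
      proof -
        have "s0 * n = 4 * (x * (real L + 1))" using s0n by simp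
        then show ?thesis using s(2) s0x x by linarith
      qed
      finally have "real_of_int (d * (int L + 1)) \<le> real_of_int s" by simp
      then show "d * (int L + 1) \<le> s" by (simp only: of_int_le_iff)
      have "4 * real_of_int d + 4 * real_of_int s \<le> \<kappa>" using d s \<kappa> \<kappa>0n s0x x by linarith
      then have "real_of_int (4 * (d + s)) \<le> real_of_int \<kappa>" by simp
      then show "4 * (d + s) \<le> \<kappa>" by (simp only: of_int_le_iff)
      have "0 < real_of_int \<kappa>" using \<kappa> \<kappa>0n s0x x by linarith
      then show "0 < \<kappa>" by simp
      have "real_of_int \<kappa> \<le> M + 1" using \<kappa> \<kappa>m mMr \<kappa>0n s0x x by linarith
      then show "\<kappa> \<le> M + 1" by linarith
      have "real_of_int n + m + \<beta> * p \<le> p" using nmp by (simp add: algebra_simps)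
      then have "real_of_int n + M + 2 * \<kappa> \<le> p" using Mr \<kappa> \<beta>n \<kappa>0n s0x x by linarith
      then show "n + M + 2 * \<kappa> \<le> p" by linarith
      have "2 * real_of_int m \<le> k * real_of_int \<kappa>"
      proof -
        have "4 * K * n \<le> (k * \<kappa>0) * n" using k \<kappa>0 n0 by (intro mult_right_mono) (auto simp: field_simps)
        moreover have "\<kappa>0 * n \<le> 2 * \<kappa>" using \<kappa> \<kappa>0n s0x x by linarith
        then have "k * (\<kappa>0 * n) \<le> k * (2 * real_of_int \<kappa>)" by (intro mult_left_mono) auto
        ultimately show ?thesis using mn by (simp add: mult_ac)
      qed
      then have "real_of_int (2 * m) \<le> real_of_int (int k * \<kappa>)" by simp
      then show "2 * m \<le> int k * \<kappa>" by (simp only: of_int_le_iff)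
    qed blast
    have "pcard p A + pcard p B \<le> pcard p (translates A F) + 1" using F(4) by (simp add: n_def m_def)
    then show "\<exists>F. finite F \<and> F \<subseteq> B \<and> card F \<le> 2 * L + (k + 2) \<and> pcard p A + pcard p B \<le> pcard p (translates A F) + 1"
      using F by blast
  qed
qed

section \<open>Dilations and the assembly of all stages\<close>

text \<open>A preimage, so that periodicity is evident; for c not divisible by p this is A
  multiplied by the inverse of c modulo p.\<close>

definition dilate :: "int \<Rightarrow> int set \<Rightarrow> int set" where
  "dilate c A = {x. c * x \<in> A}"

lemma periodic_dilate [intro]: "periodic p A \<Longrightarrow> periodic p (dilate c A)"
  using periodic_add_mult[of p A _ c] by (simp add: periodic_def dilate_def distrib_left mult.commute)

lemma pcard_dilate:
  assumes "prime p" "\<not> p dvd c" "periodic p A"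
  shows "pcard p (dilate c A) = pcard p A"
  using pcard_affine[OF prime_gt_0_int[OF assms(1)] coprime_prime_int[OF assms(1,2)] assms(3), of 0]
  by (simp add: dilate_def)

lemma shift_dilate: "shift x (dilate c A) = dilate c (shift (c * x) A)"
  by (auto simp: dilate_def right_diff_distrib)

lemma dilate_Diff: "dilate c (A - B) = dilate c A - dilate c B"
  by (auto simp: dilate_def)

lemma dilate_nonempty:
  assumes "prime p" "\<not> p dvd c" "periodic p A" "A \<noteq> {}" shows "dilate c A \<noteq> {}"
  using pcard_pos_iff[OF prime_gt_0_int[OF assms(1)]] pcard_dilate[OF assms(1-3)] assms(3,4) periodic_dilate
  by metis

lemma setting_dilate:
  assumes "setting \<beta> K p A B" "\<not> p dvd c" shows "setting \<beta> K p (dilate c A) (dilate c B)"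
proof -
  have *: "prime p" "periodic p A" "periodic p B" "A \<noteq> {}" "B \<noteq> {}" using assms(1) by (auto simp: setting_def)
  show ?thesis
    using assms(1) dilate_nonempty[OF *(1) assms(2) *(2,4)] dilate_nonempty[OF *(1) assms(2) *(3,5)]
    by (simp add: setting_def pcard_dilate[OF *(1) assms(2)] periodic_dilate)
qed

lemma setting_shift:
  assumes "setting \<beta> K p A B" shows "setting \<beta> K p (shift x A) (shift y B)"
proof -
  have p: "p > 0" using assms prime_gt_0_int by (auto simp: setting_def)
  have "shift x A \<noteq> {}" if "A \<noteq> {}" for x A
  proof -
    obtain a where "a \<in> A" using \<open>A \<noteq> {}\<close> by auto
    then have "a + x \<in> shift x A" by simp
    then show ?thesis by blast
  qed
  then show ?thesis using assms p unfolding setting_def by auto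
qed

text \<open>The Cauchy-Davenport theorem, as the case t = 1 of Pollard's. It settles small A, for
  which all of B has bounded size.\<close>

lemma full_translates:
  assumes "prime p" "periodic p A" "periodic p B" "A \<noteq> {}" "B \<noteq> {}" "pcard p A + pcard p B \<le> nat p"
  shows "pcard p A + pcard p B \<le> pcard p (translates A (B \<inter> {0..<p})) + 1"
proof -
  have p: "p > 0" using assms(1) prime_gt_0_int by blast
  have "shift w A - translates A (B \<inter> {0..<p}) = {}" if "w \<in> B \<inter> {0..<p}" for w
    using that by (auto simp: translates_def)
  then have "(\<Sum>w\<in>B \<inter> {0..<p}. pcard p (shift w A - translates A (B \<inter> {0..<p}))) = 0"
    by (intro sum.neutral ballI) (simp only: pcard_empty)
  moreover have "1 \<le> pcard p A" "1 \<le> pcard p B" using pcard_pos_iff[OF p] assms by (simp_all add: Suc_le_eq)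
  ultimately show ?thesis
    using pollard_robust[OF assms(1-3), of 1 "translates A (B \<inter> {0..<p})"] assms(6) by simp
qed

text \<open>The constants are fixed from the last stage backwards: d0 is the accuracy asked for by
  the covering, \<epsilon>1 the one for confining B, \<rho> the relative size of w, \<epsilon>0 the
  accuracy for the linear structure and \<eta> the one for S.\<close>

lemma bounded_translates:
  fixes \<beta> K :: real
  assumes \<beta>K: "0 < \<beta>" "\<beta> \<le> 1" "1 \<le> K"
  shows "\<exists>C::nat. \<forall>p A B. setting \<beta> K p A B \<longrightarrow>
     (\<exists>F. finite F \<and> F \<subseteq> B \<and> card F \<le> C \<and> pcard p A + pcard p B \<le> pcard p (translates A F) + 1)"
proof -
  obtain d0 :: real and C1 :: nat and N1 :: real where d0: "0 < d0" "d0 \<le> \<beta> / 8"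
    and fin: "\<And>p A B M. setting \<beta> K p A B \<Longrightarrow> N1 \<le> real (pcard p A) \<Longrightarrow>
     real (card ({0..<int (pcard p A)} - A)) \<le> d0 * real (pcard p A) \<Longrightarrow> 0 \<in> B \<Longrightarrow> M \<in> B \<Longrightarrow> 0 \<le> M \<Longrightarrow>
     \<forall>b\<in>B. b mod p \<le> M \<Longrightarrow> real_of_int M + 1 \<le> real (pcard p B) + d0 * real (pcard p A) \<Longrightarrow>
     \<exists>F. finite F \<and> F \<subseteq> B \<and> card F \<le> C1 \<and> pcard p A + pcard p B \<le> pcard p (translates A F) + 1"
    using translates_near_arc_bounded[OF \<beta>K] by metis
  define K' where "K' = K + 2"
  have K': "3 \<le> K'" using \<beta>K by (simp add: K'_def)
  define \<epsilon>1 where "\<epsilon>1 = d0 / (8 * K')"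
  have \<epsilon>1: "0 < \<epsilon>1" "\<epsilon>1 \<le> 1" "(1 + K') * \<epsilon>1 \<le> d0 / 4" "\<epsilon>1\<^sup>2 \<le> d0"
  proof -
    show "0 < \<epsilon>1" using d0 K' by (simp add: \<epsilon>1_def)
    show *: "\<epsilon>1 \<le> 1" using d0 K' \<beta>K by (simp add: \<epsilon>1_def field_simps)
    show "(1 + K') * \<epsilon>1 \<le> d0 / 4" using d0 K' by (simp add: \<epsilon>1_def field_simps)
    have "\<epsilon>1 \<le> d0" using d0 K' by (simp add: \<epsilon>1_def field_simps)
    moreover have "\<epsilon>1\<^sup>2 \<le> \<epsilon>1" using * \<open>0 < \<epsilon>1\<close> by (simp add: power2_eq_square mult_left_le)
    ultimately show "\<epsilon>1\<^sup>2 \<le> d0" by simp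
  qed
  \<comment> \<open>The 75 w \<le> 75 \<rho> n holes in the arc and the error \<eta> n of S together
    must stay below \<epsilon>1^2 n / 2; \<rho> and \<eta> each take a part of this.\<close>
  define \<rho> where "\<rho> = min (\<beta> / 100) (\<epsilon>1\<^sup>2 / 400)"
  have \<rho>: "0 < \<rho>" "\<rho> \<le> \<beta> / 100" "\<rho> \<le> \<epsilon>1\<^sup>2 / 400" using \<beta>K \<epsilon>1 by (auto simp: \<rho>_def)
  obtain \<epsilon>0 N2 :: real where \<epsilon>0: "0 < \<epsilon>0" and lin: "\<And>p A B t. setting \<beta> K p A B \<Longrightarrow> N2 \<le> real (pcard p A) \<Longrightarrow>
     tight p A \<epsilon>0 B \<Longrightarrow> \<not> p dvd t \<Longrightarrow> real (pcard p (shift t B - B)) \<le> \<epsilon>0 * real (pcard p A) \<Longrightarrow>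
     \<exists>c w. \<not> p dvd c \<and> 0 < w \<and> real_of_int w \<le> \<rho> * real (pcard p A) \<and>
       10 * int (defect p A (c * w)) \<le> 11 * w \<and> (\<forall>i. \<bar>i\<bar> \<le> w \<longrightarrow> int (defect p A (c * i)) \<le> 3 * w)"
    using linear_structure_bounded[OF \<beta>K \<rho>(1)] by metis
  define \<eta> where "\<eta> = min \<epsilon>0 (\<epsilon>1\<^sup>2 / 8)"
  have \<eta>: "0 < \<eta>" "\<eta> \<le> \<epsilon>0" "\<eta> \<le> \<epsilon>1\<^sup>2 / 8" using \<epsilon>0 \<epsilon>1 by (auto simp: \<eta>_def)
  have "0 < min \<epsilon>0 \<beta>" "min \<epsilon>0 \<beta> \<le> \<beta>" using \<epsilon>0 \<beta>K by auto
  from almost_invariant_translation_bounded[OF \<beta>K this] obtain C3 :: nat and N3 :: real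
    where near: "\<And>p A B. setting \<beta> K p A B \<Longrightarrow> N3 \<le> real (pcard p A) \<Longrightarrow>
     (\<And>F. finite F \<Longrightarrow> F \<subseteq> B \<Longrightarrow> card F \<le> C3 \<Longrightarrow> pcard p (translates A F) < pcard p A + pcard p B) \<Longrightarrow>
     \<exists>t. \<not> p dvd t \<and> real (pcard p (shift t B - B)) \<le> min \<epsilon>0 \<beta> * real (pcard p A)" by metis
  define C4 where "C4 = nat \<lceil>(1 + K) / \<eta>\<rceil>"
  define N where "N = max (max N1 N2) (max N3 (16 / d0))"
  define C0 where "C0 = nat \<lceil>K * N\<rceil>"
  define C where "C = max (max C0 C1) (max C3 C4)"
  have leC: "C0 \<le> C" "C1 \<le> C" "C3 \<le> C" "C4 \<le> C" by (simp_all add: C_def)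
  have C4: "(1 + K) / \<eta> \<le> C4" unfolding C4_def by (rule real_nat_ceiling_ge)
  show ?thesis
  proof (intro exI[of _ C] allI impI)
    fix p A B
    assume st: "setting \<beta> K p A B"
    define n where "n = pcard p A"
    define m where "m = pcard p B"
    have pr: "prime p" and perA: "periodic p A" and perB: "periodic p B" and A0: "A \<noteq> {}" and B0: "B \<noteq> {}"
      and nm: "real n \<le> K * m" and mn: "real m \<le> K * n" and nmp: "real n + real m \<le> (1 - \<beta>) * p"
      using st by (auto simp: setting_def n_def m_def)
    have p: "p > 0" using pr prime_gt_0_int by blast
    have nbp: "real n + real m + \<beta> * p \<le> p" using nmp by (simp add: algebra_simps)
    have bp: "0 \<le> \<beta> * p" using \<beta>K p by simp
    show "\<exists>F. finite F \<and> F \<subseteq> B \<and> card F \<le> C \<and> pcard p A + pcard p B \<le> pcard p (translates A F) + 1"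
    proof (cases "real n < N")
      case True
      have "pcard p A + pcard p B \<le> nat p" using nbp bp p unfolding n_def m_def by linarith
      then have "pcard p A + pcard p B \<le> pcard p (translates A (B \<inter> {0..<p})) + 1"
        by (rule full_translates[OF pr perA perB A0 B0])
      moreover have "card (B \<inter> {0..<p}) \<le> C"
      proof -
        have "real m \<le> K * N" using mn True \<beta>K by (meson mult_left_mono order_trans less_imp_le zero_le_one)
        then have "real m \<le> C0" unfolding C0_def using real_nat_ceiling_ge order_trans by blast
        then have "m \<le> C" using leC(1) by linarith
        then show ?thesis by (simp add: m_def pcard_def)
      qed
      ultimately show ?thesis by (intro exI[of _ "B \<inter> {0..<p}"]) auto
    next
      case False
      then have nN: "N \<le> real n" by simp
      have n0: "0 < n" using pcard_pos_iff[OF p perA] A0 n_def by simp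
      show ?thesis
      proof (rule ccontr)
        assume no: "\<not> ?thesis"
        have NB: "pcard p (translates A F) + 1 < n + m" if "finite F" "F \<subseteq> B" "card F \<le> C" for F
          using no that unfolding n_def m_def by (meson not_le)
        obtain t where t: "\<not> p dvd t" "real (pcard p (shift t B - B)) \<le> min \<epsilon>0 \<beta> * real n"
        proof -
          have "\<exists>t. \<not> p dvd t \<and> real (pcard p (shift t B - B)) \<le> min \<epsilon>0 \<beta> * real (pcard p A)"
          proof (rule near[OF st])
            show "N3 \<le> real (pcard p A)" using nN by (simp add: N_def n_def)
            show "pcard p (translates A F) < pcard p A + pcard p B" if "finite F" "F \<subseteq> B" "card F \<le> C3" for F
              using NB[OF that(1,2) order_trans[OF that(3) leC(3)]] by (simp add: n_def m_def)
          qed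
          then show ?thesis using that by (auto simp: n_def)
        qed
        have "min \<epsilon>0 \<beta> * real n \<le> \<epsilon>0 * real n" by (intro mult_right_mono) auto
        with t have t2: "real (pcard p (shift t B - B)) \<le> \<epsilon>0 * real (pcard p A)" by (simp add: n_def)
        have nmK: "real (n + m) \<le> (1 + K) * n" using mn by (simp add: algebra_simps)
        obtain F where F: "finite F" "F \<subseteq> B" "card F \<le> C4"
          "\<And>b. b \<in> B \<Longrightarrow> real (pcard p (shift b A - translates A F)) \<le> \<eta> * n"
        proof (rule greedy_cover[of B C4 p A "\<eta> * n"])
          fix F assume F: "finite F" "F \<subseteq> B" "card F \<le> C4"
          have "pcard p (translates A F) < n + m" using NB[OF F(1,2) order_trans[OF F(3) leC(4)]] by simp
          then have "real (pcard p (translates A F)) < real (n + m)" by (simp only: of_nat_less_iff)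
          also have "\<dots> \<le> (1 + K) * n" by (rule nmK)
          also have "\<dots> \<le> (C4 * \<eta>) * n" using C4 \<eta>(1) by (intro mult_right_mono) (auto simp: field_simps)
          finally show "real (pcard p (translates A F)) < C4 * (\<eta> * n)" by (simp add: mult_ac)
        qed blast
        define S where "S = translates A F"
        have perS: "periodic p S" using perA by (auto simp: S_def)
        have cS: "pcard p S < n + m" using NB[OF F(1,2) order_trans[OF F(3) leC(4)]] by (simp add: S_def)
        have \<eta>n: "\<eta> * n \<le> \<epsilon>0 * n" "\<eta> * n \<le> \<epsilon>1\<^sup>2 / 8 * n" by (rule mult_right_mono; use \<eta> in simp)+
        have ti: "tight p A \<epsilon>0 B"
          unfolding tight_def
        proof (intro exI[of _ S] conjI ballI perS)
          show "real (pcard p (shift b A - S)) \<le> \<epsilon>0 * real (pcard p A)" if "b \<in> B" for b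
            using F(4)[OF that] \<eta>n by (simp add: S_def n_def)
          have "0 \<le> \<epsilon>0 * n" using \<epsilon>0 by simp
          then show "real (pcard p S) \<le> real (pcard p A) + real (pcard p B) + \<epsilon>0 * real (pcard p A)"
            using cS by (simp add: n_def m_def)
        qed
        obtain c w where c: "\<not> p dvd c" and w: "0 < w" "real_of_int w \<le> \<rho> * n"
          and w1: "10 * int (defect p A (c * w)) \<le> 11 * w" and w2: "\<And>i. \<bar>i\<bar> \<le> w \<Longrightarrow> int (defect p A (c * i)) \<le> 3 * w"
          using lin[OF st _ ti t(1) t2] nN by (auto simp: N_def n_def)
        define A2 where "A2 = dilate c A"
        define B2 where "B2 = dilate c B"
        define S2 where "S2 = dilate c S"
        have perA2: "periodic p A2" "periodic p B2" "periodic p S2" using perA perB perS by (auto simp: A2_def B2_def S2_def)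
        have cA2: "pcard p A2 = n" "pcard p B2 = m" "pcard p S2 = pcard p S"
          unfolding A2_def B2_def S2_def n_def m_def by (rule pcard_dilate[OF pr c]; fact)+
        have defA2: "defect p A2 i = defect p A (c * i)" for i
          unfolding defect_def A2_def shift_dilate dilate_Diff[symmetric] using perA by (intro pcard_dilate[OF pr c]) auto
        have \<rho>n: "\<rho> * n \<le> \<beta> / 100 * n" "\<rho> * n \<le> \<epsilon>1\<^sup>2 / 400 * n" by (rule mult_right_mono; use \<rho> in simp)+
        have np: "real n \<le> p" using nbp bp by linarith
        have \<beta>n: "\<beta> * n \<le> \<beta> * p" using np \<beta>K by (intro mult_left_mono) auto
        have \<beta>n1: "\<beta> * n \<le> n" using \<beta>K by (simp add: mult_left_le_one_le)
        note \<beta>n = \<beta>n \<beta>n1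
        have n0r: "0 < \<beta> * n" using n0 \<beta>K by simp
        obtain a where a: "int (card ({a..<a + int n} - A2)) \<le> 75 * w"
        proof (rule near_arc[OF p perA2(1) w(1)])
          show "10 * int (defect p A2 w) \<le> 11 * w" using w1 defA2 by simp
          show "int (defect p A2 i) \<le> 3 * w" if "\<bar>i\<bar> \<le> w" for i using w2[OF that] defA2 by simp
          show "int n = int (pcard p A2)" using cA2 by simp
          have "40 * real_of_int w < n" using w \<rho>n \<beta>n n0r by linarith
          then show "40 * w < int n" by linarith
          have "40 * real_of_int w < p - real n" using w \<rho>n \<beta>n n0r nbp by linarith
          then show "40 * w < p - int n" by linarith
        qed blast
        define A3 where "A3 = shift (- a) A2"
        define S3 where "S3 = shift (- a) S2"
        have perA3: "periodic p A3" "periodic p S3" using perA2 by (auto simp: A3_def S3_def)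
        have hA3: "int (card ({0..<int n} - A3)) \<le> 75 * w"
        proof -
          have "card ({0..<int n} - A3) = card ({a..<a + int n} - A2)"
            by (rule bij_betw_same_card[of "\<lambda>z. z + a"], rule bij_betw_byWitness[of _ "\<lambda>z. z - a"]) (auto simp: A3_def)
          then show ?thesis using a by simp
        qed
        have arcA3: "pcard p (arc p (int n) - A3) \<le> card ({0..<int n} - A3)"
        proof -
          have "(arc p (int n) - A3) \<inter> {0..<p} \<subseteq> {0..<int n} - A3" by (auto simp: arc_def)
          then show ?thesis unfolding pcard_def by (intro card_mono) auto
        qed
        define E where "E = (1 + K') * \<epsilon>1 * n + 1"
        have d0n: "16 \<le> d0 * n" using nN d0 by (simp add: N_def field_simps)
        have E: "E \<le> d0 / 4 * n + 1" unfolding E_def using mult_right_mono[OF \<epsilon>1(3), of "real n"] by simp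
        have d0\<beta>: "d0 * n \<le> \<beta> / 8 * n" using d0 by (intro mult_right_mono) auto
        have B2ne: "B2 \<noteq> {}" unfolding B2_def by (rule dilate_nonempty[OF pr c perB B0])
        obtain x M where xM: "x \<in> B2" "x + M \<in> B2" "0 \<le> M" "real_of_int M + 1 \<le> pcard p B2 + E" "\<And>b. b \<in> B2 \<Longrightarrow> (b - x) mod p \<le> M"
        proof (rule confined_to_interval[OF pr perA2(2) perA3(2) B2ne, of "int n" \<epsilon>1 K' E])
          show "0 < int n" "0 < \<epsilon>1" "\<epsilon>1 \<le> 1" "1 \<le> K'" using n0 \<epsilon>1 K' by auto
          show "2 * real (pcard p (shift b (arc p (int n)) - S3)) \<le> \<epsilon>1\<^sup>2 * real_of_int (int n)" if b: "b \<in> B2" for b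
          proof -
            have cb: "c * b \<in> B" using b by (simp add: B2_def dilate_def)
            have "shift b (arc p (int n)) - S3 \<subseteq> shift b (arc p (int n) - A3) \<union> (shift b A3 - S3)" by auto
            then have "pcard p (shift b (arc p (int n)) - S3) \<le> pcard p (shift b (arc p (int n) - A3)) + pcard p (shift b A3 - S3)"
              using pcard_mono pcard_Un_le order_trans by metis
            moreover have "pcard p (shift b (arc p (int n) - A3)) = pcard p (arc p (int n) - A3)"
              using p perA3 by (intro pcard_shift) auto
            moreover have "pcard p (shift b A3 - S3) = pcard p (shift (c * b) A - S)"
            proof -
              have "shift b A3 - S3 = shift (- a) (shift b A2 - S2)" by (auto simp: A3_def S3_def algebra_simps)
              then have "pcard p (shift b A3 - S3) = pcard p (shift b A2 - S2)" using p perA2 by (simp add: periodic_Diff periodic_shift)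
              also have "shift b A2 - S2 = dilate c (shift (c * b) A - S)" by (simp add: A2_def S2_def shift_dilate dilate_Diff)
              also have "pcard p \<dots> = pcard p (shift (c * b) A - S)" using perA perS by (intro pcard_dilate[OF pr c]) auto
              finally show ?thesis .
            qed
            moreover have "real (pcard p (shift (c * b) A - S)) \<le> \<eta> * n" using F(4)[OF cb] by (simp add: S_def)
            moreover have "real (card ({0..<int n} - A3)) \<le> 75 * (\<rho> * n)" using hA3 w(2) by linarith
            ultimately have "real (pcard p (shift b (arc p (int n)) - S3)) \<le> 75 * (\<rho> * n) + \<eta> * n" using arcA3 by linarith
            then show ?thesis using \<rho>n \<eta>n by simp
          qed
          have "pcard p S3 = pcard p S" using p perA2 cA2 by (simp add: S3_def)
          then show "real (pcard p S3) \<le> real_of_int (int n) + real (pcard p B2)" using cS cA2 by simp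
          show "E = (1 + K') * \<epsilon>1 * real_of_int (int n) + 1" by (simp add: E_def)
          show "real (pcard p B2) + E + 1 \<le> K' * real_of_int (int n)"
            using mn E d0\<beta> \<beta>n d0n cA2 by (simp add: K'_def algebra_simps)
          have "E + 1 \<le> \<beta> * p" using E d0\<beta> \<beta>n d0n by linarith
          then show "real_of_int (int n + int (pcard p B2)) + E + 1 \<le> real_of_int p" using nbp cA2 by simp
          show "2 * E < real_of_int (int n)" using E d0\<beta> \<beta>n d0n by simp
        qed blast
        define B3 where "B3 = shift (- x) B2"
        have st3: "setting \<beta> K p A3 B3"
          unfolding A3_def B3_def A2_def B2_def by (intro setting_shift setting_dilate st c)
        have cA3: "pcard p A3 = n" "pcard p B3 = m" using p perA2 cA2 by (simp_all add: A3_def B3_def)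
        have "\<exists>F. finite F \<and> F \<subseteq> B3 \<and> card F \<le> C1 \<and> pcard p A3 + pcard p B3 \<le> pcard p (translates A3 F) + 1"
        proof (rule fin[OF st3, of M])
          show "N1 \<le> real (pcard p A3)" using nN cA3 by (simp add: N_def)
          have "75 * real_of_int w \<le> d0 * n"
            using w(2) \<rho>n mult_right_mono[OF \<epsilon>1(4), of "real n"] d0n by simp
          then show "real (card ({0..<int (pcard p A3)} - A3)) \<le> d0 * real (pcard p A3)"
            using hA3 by (simp add: cA3)
          show "0 \<in> B3" "M \<in> B3" "0 \<le> M" using xM by (auto simp: B3_def add.commute)
          show "\<forall>b\<in>B3. b mod p \<le> M"
          proof
            fix b assume "b \<in> B3"
            then have "b + x \<in> B2" by (simp add: B3_def)
            from xM(5)[OF this] show "b mod p \<le> M" by simp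
          qed
          show "real_of_int M + 1 \<le> real (pcard p B3) + d0 * real (pcard p A3)"
            using xM(4) E d0n cA2 cA3 by simp
        qed
        then obtain F3 where F3: "finite F3" "F3 \<subseteq> B3" "card F3 \<le> C1" "n + m \<le> pcard p (translates A3 F3) + 1"
          using cA3 by auto
        \<comment> \<open>Undo the normalisation: an element f of B3 stems from c (f + x) in B, and
          the translation of A by a only moves the union.\<close>
        define F' where "F' = (\<lambda>f. c * (f + x)) ` F3"
        have "pcard p (translates A F') = pcard p (dilate c (translates A F'))"
          using perA by (intro pcard_dilate[OF pr c, symmetric]) auto
        also have "dilate c (translates A F') = shift (a + x) (translates A3 F3)"
          by (auto simp: dilate_def translates_def F'_def A3_def A2_def algebra_simps)
        also have "pcard p \<dots> = pcard p (translates A3 F3)" using p perA3 by (intro pcard_shift) auto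
        finally have "n + m \<le> pcard p (translates A F') + 1" using F3(4) by simp
        moreover have "finite F'" "card F' \<le> C"
          using F3(1,3) leC(2) card_image_le[OF F3(1), of "\<lambda>f. c * (f + x)"] by (auto simp: F'_def)
        moreover have "F' \<subseteq> B" using F3(2) by (auto simp: F'_def B3_def B2_def dilate_def)
        ultimately show False using NB[of F'] by simp
      qed
    qed
  qed
qed

section \<open>Transfer to the residue ring\<close>

lemma set_add_residue_ring:
  "A <+>\<^bsub>residue_ring p\<^esub> F = (\<lambda>(a, b). (a + b) mod p) ` (A \<times> F)"
  by (auto simp: set_add_def' residue_ring_def)

theorem theorem4:
  fixes \<alpha> \<beta> :: real
  assumes "\<alpha> > 0" and "\<beta> > 0"
  shows "\<exists>c::nat. c > 0 \<and>
    (\<forall>(p::nat) (A::int set) (B::int set).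
      prime p \<longrightarrow>
      A \<subseteq> carrier (residue_ring (int p)) \<longrightarrow> B \<subseteq> carrier (residue_ring (int p)) \<longrightarrow>
      A \<noteq> {} \<longrightarrow> B \<noteq> {} \<longrightarrow>
      \<alpha> * real (card B) \<le> real (card A) \<longrightarrow> real (card A) \<le> 1 / \<alpha> * real (card B) \<longrightarrow>
      real (card A) + real (card B) \<le> (1 - \<beta>) * real p \<longrightarrow>
      (\<exists>b :: nat \<Rightarrow> int. (\<forall>i\<in>{1..c}. b i \<in> B) \<and>
        card (A <+>\<^bsub>residue_ring (int p)\<^esub> (b ` {1..c})) \<ge> card A + card B - 1))"
proof -
  \<comment> \<open>K bounds the ratio of the sizes in both directions. Cutting \<beta> off at 1
    only weakens the hypothesis on the sum of the sizes.\<close>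
  define K where "K = max 1 (1 / \<alpha>)"
  define \<beta>' where "\<beta>' = min \<beta> 1"
  have "0 < \<beta>'" "\<beta>' \<le> 1" "1 \<le> K" using assms by (auto simp: K_def \<beta>'_def)
  from bounded_translates[OF this] obtain C :: nat where C: "\<And>p A B. setting \<beta>' K p A B \<Longrightarrow>
     \<exists>F. finite F \<and> F \<subseteq> B \<and> card F \<le> C \<and> pcard p A + pcard p B \<le> pcard p (translates A F) + 1" by metis
  show ?thesis
  proof (intro exI[of _ "C + 1"] conjI allI impI)
    fix p :: nat and A B :: "int set"
    assume p: "prime p" and AB: "A \<subseteq> carrier (residue_ring (int p))" "B \<subseteq> carrier (residue_ring (int p))"
      and ne: "A \<noteq> {}" "B \<noteq> {}"
      and al: "\<alpha> * real (card B) \<le> real (card A)" "real (card A) \<le> 1 / \<alpha> * real (card B)"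
      and sz: "real (card A) + real (card B) \<le> (1 - \<beta>) * real p"
    define q where "q = int p"
    have pq: "prime q" "1 < q" using p prime_gt_1_nat[OF p] by (auto simp: q_def)
    have sub: "A \<subseteq> {0..<q}" "B \<subseteq> {0..<q}" using AB by (auto simp: residue_ring_def q_def)
    define lift where "lift X = {z. z mod q \<in> X}" for X
    have lift: "lift X \<inter> {0..<q} = X" "pcard q (lift X) = card X" if "X \<subseteq> {0..<q}" for X
    proof -
      show "lift X \<inter> {0..<q} = X" using that by (auto simp: lift_def)
      then show "pcard q (lift X) = card X" by (simp add: pcard_def)
    qed
    have per: "periodic q (lift X)" for X by (simp add: periodic_def lift_def)
    have st: "setting \<beta>' K q (lift A) (lift B)"
      unfolding setting_def
    proof (intro conjI pq(1) per)
      show "lift A \<noteq> {}" "lift B \<noteq> {}" using lift(1)[OF sub(1)] lift(1)[OF sub(2)] ne by auto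
      have "real (card B) \<le> 1 / \<alpha> * real (card A)" using al(1) assms(1) by (simp add: field_simps)
      moreover have "1 / \<alpha> * real (card X) \<le> K * real (card X)" for X :: "int set"
        by (intro mult_right_mono) (auto simp: K_def)
      ultimately show "real (pcard q (lift A)) \<le> K * real (pcard q (lift B))" "real (pcard q (lift B)) \<le> K * real (pcard q (lift A))"
        using al(2) by (simp_all add: lift(2) sub) (meson order_trans)+
      have "(1 - \<beta>) * real p \<le> (1 - \<beta>') * real p" by (intro mult_right_mono) (auto simp: \<beta>'_def)
      then show "real (pcard q (lift A)) + real (pcard q (lift B)) \<le> (1 - \<beta>') * real_of_int q"
        using sz unfolding lift(2)[OF sub(1)] lift(2)[OF sub(2)] by (simp add: q_def)
    qed
    from C[OF st] obtain F where F: "finite F" "F \<subseteq> lift B" "card F \<le> C"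
      "card A + card B \<le> pcard q (translates (lift A) F) + 1" by (auto simp: lift(2) sub)
    define G where "G = (\<lambda>f. f mod q) ` F"
    obtain b0 where b0: "b0 \<in> B" using ne by auto
    have G: "finite G" "G \<subseteq> B" "card G \<le> C"
      using F card_image_le[OF F(1), of "\<lambda>f. f mod q"] by (auto simp: G_def lift_def)
    obtain g where g: "bij_betw g {0..<card G} G" using ex_bij_betw_nat_finite[OF G(1)] by blast
    \<comment> \<open>The sequence lists G and repeats b0 afterwards, as exactly C + 1 terms are
      required; the extra term keeps the constant positive.\<close>
    define b where "b i = (if i \<le> card G then g (i - 1) else b0)" for i
    have gG: "g ` {0..<card G} = G" using g by (simp add: bij_betw_def)
    have bB: "b i \<in> B" if "i \<in> {1..C + 1}" for i
    proof (cases "i \<le> card G")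
      case True
      then have "i - 1 \<in> {0..<card G}" using that by auto
      then have "g (i - 1) \<in> g ` {0..<card G}" by (rule imageI)
      then have "g (i - 1) \<in> G" by (simp only: gG)
      then show ?thesis using True G(2) by (auto simp: b_def)
    qed (use b0 in \<open>simp add: b_def\<close>)
    have Gb: "G \<subseteq> b ` {1..C + 1}"
    proof
      fix x assume "x \<in> G"
      then have "x \<in> g ` {0..<card G}" by (simp only: gG)
      then obtain j where j: "j < card G" "x = g j" by auto
      then show "x \<in> b ` {1..C + 1}" using G(3) by (intro image_eqI[of _ _ "j + 1"]) (auto simp: b_def)
    qed
    let ?X = "A <+>\<^bsub>residue_ring (int p)\<^esub> (b ` {1..C + 1})"
    have X: "?X = (\<lambda>(a, b). (a + b) mod q) ` (A \<times> b ` {1..C + 1})"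
      by (simp add: set_add_residue_ring q_def)
    have "translates (lift A) F \<inter> {0..<q} \<subseteq> ?X"
    proof
      fix z assume z: "z \<in> translates (lift A) F \<inter> {0..<q}"
      then obtain f where f: "f \<in> F" "(z - f) mod q \<in> A" by (auto simp: translates_def lift_def)
      have "f mod q \<in> b ` {1..C + 1}" using f(1) Gb by (auto simp: G_def)
      moreover have "z = ((z - f) mod q + f mod q) mod q" using z by (simp add: mod_add_eq)
      ultimately show "z \<in> ?X" unfolding X using f(2) by (intro image_eqI[of _ _ "((z - f) mod q, f mod q)"]) auto
    qed
    moreover have "finite ?X" unfolding X using sub(1) finite_subset by (intro finite_imageI finite_cartesian_product) auto
    ultimately have "pcard q (translates (lift A) F) \<le> card ?X" unfolding pcard_def by (rule card_mono[rotated])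
    then have "card A + card B - 1 \<le> card ?X" using F(4) by linarith
    then show "\<exists>b :: nat \<Rightarrow> int. (\<forall>i\<in>{1..C + 1}. b i \<in> B) \<and>
        card (A <+>\<^bsub>residue_ring (int p)\<^esub> (b ` {1..C + 1})) \<ge> card A + card B - 1"
      using bB by blast
  qed simp
qed

end
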